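(* Let $d\ge 1$ and let $G\leq\operatorname{O}(d)$ be a finite reflection group. Let $\kappa(G)$ denote its optimal max filtering condition number. (a) If $G$ is the trivial group, then $\kappa(G)=1$, and minimal optimal templates are given by any orthonormal basis of $\mathbb{R}^d$. (b) If $G$ is essential and irreducible, then for any matrix $A\in\mathbb{R}^{d\times d}$ with unit-norm rows that form a fundamental system for $G$, it holds that $\kappa(G)=\frac{\sigma_{\max}(A)}{\sigma_{\min}(A)}$ (the ratio of the largest to the smallest singular value of $A$), and minimal optimal templates are given by the columns of $A^{-1}$. (c) Otherwise, $G$ can be decomposed into irreducible constituents: there is an orthogonal decomposition $\mathbb{R}^d=\bigoplus_i V_i$ into $G$-invariant subspaces $V_i\cong\mathbb{R}^{d_i}$, and correspondingly $G$ is the direct product of groups $G_i\leq\operatorname{O}(V_i)\cong\operatorname{O}(d_i)$ (with $G_i$ acting on $V_i$ and trivially on the other summands), where one of the $G_i$ is trivial precisely when $G$ is not essential, and the others are essential and irreducible as reflection groups on $V_i$. Then $\kappa(G)=\max_i\kappa(G_i)$, and minimal optimal templates for $G$ are given by an orthogonal direct sum of minimal optimal templates for the constituents, that is, by the union over $i$ of the following families of vectors in $V_i\subseteq\mathbb{R}^d$: any orthonormal basis of $V_i$ if $G_i$ is trivial, and the columns of $A_i^{-1}$ if $G_i$ is nontrivial, where $A_i\in\mathbb{R}^{d_i\times d_i}$ is any matrix with unit-norm rows that form a fundamental system for $G_i$.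
   Context: For nonzero $u\in\mathbb{R}^d$, let $R(u)=I-\frac{2}{\|u\|^2}uu^\top$; such maps are called reflections. A reflection group is a subgroup of $\operatorname{O}(d)$ generated by reflections. It is essential if the origin is its only fixed point. It is reducible if it is a direct product of nontrivial reflection groups in $\operatorname{O}(d)$ (in which case $\mathbb{R}^d$ correspondingly decomposes into orthogonal invariant subspaces), and irreducible otherwise. Weyl chambers of a finite reflection group $G$ are the connected components of $\mathbb{R}^d\setminus U$, where $U$ is the union of the hyperplanes fixed by the individual reflections in $G$. Given a Weyl chamber $C$, its boundary is contained in a union of $\ell$ such hyperplanes and no fewer; the unit normal vectors $\alpha_1,\dots,\alpha_\ell$ to these hyperplanes, signed so that $\langle\alpha_i,x\rangle\ge0$ for all $x\in C$, form the fundamental system of $G$ corresponding to $C$. A fundamental system for $G$ is one corresponding to some Weyl chamber. If $G$ is essential, then $\ell=d$ and the fundamental system is a basis of $\mathbb{R}^d$. For a finite group $G\leq\operatorname{O}(d)$, $\mathbb{R}^d/G$ is the set of orbits $G\cdot x$ with metric $d(G\cdot x,G\cdot y)=\min_{p\in G\cdot x,\,q\in G\cdot y}\|p-q\|$. The max filtering map is $\langle\!\langle G\cdot x,G\cdot y\rangle\!\rangle=\max_{p\in G\cdot x,\,q\in G\cdot y}\langle p,q\rangle$. Given vectors $t_1,\dots,t_n\in\mathbb{R}^d$ (templates), the max filter bank is $\Phi\colon\mathbb{R}^d/G\to\mathbb{R}^n$, $\Phi(G\cdot x)=\{\langle\!\langle G\cdot t_i,G\cdot x\rangle\!\rangle\}_{i=1}^n$.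 The optimal max filtering condition number $\kappa(G)$ is the infimum of quotients $C/c$ over all $n\in\mathbb{N}$, templates $t_1,\dots,t_n\in\mathbb{R}^d$, and constants $C,c>0$ that are respectively upper and lower Lipschitz bounds of the max filter bank $\Phi$, i.e. $c\,d(G\cdot x,G\cdot y)\le\|\Phi(G\cdot x)-\Phi(G\cdot y)\|\le C\,d(G\cdot x,G\cdot y)$ for all $x,y$. Templates $t_1,\dots,t_n$ are optimal if their max filter bank has upper and lower Lipschitz bounds $C,c$ with $C/c=\kappa(G)$, and minimal optimal if moreover $n$ is the smallest possible number of optimal templates. The same notions apply to a finite group acting by linear isometries on any finite-dimensional real inner product space. *)

theory Defs
  imports
    "HOL-Analysis.Analysis"
    "HOL-Algebra.Generated_Groups"
    "HOL-Algebra.Product_Groups"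
    "Jordan_Normal_Form.Matrix"
begin

text \<open>
  Everything is relative to a subspace \<open>V\<close> of a Euclidean space, and \<open>V = UNIV\<close> is the
  whole space. An isometry of \<open>V\<close> is represented by its extension by the identity on the orthogonal
  complement of \<open>V\<close>, so that \<open>O(V)\<close> is a subgroup of the orthogonal group of the ambient space.
\<close>

definition orth_group :: "'a::euclidean_space set \<Rightarrow> ('a \<Rightarrow> 'a) monoid" where
  "orth_group V = \<lparr>carrier = {f. orthogonal_transformation f \<and> (\<forall>x\<in>orthogonal_comp V. f x = x)},
                   monoid.mult = (\<circ>), one = id\<rparr>"

definition reflection :: "'a::euclidean_space \<Rightarrow> 'a \<Rightarrow> 'a" where
  "reflection u x = x - (2 / (norm u)\<^sup>2) *\<^sub>R ((u \<bullet> x) *\<^sub>R u)"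

definition reflection_group :: "'a::euclidean_space set \<Rightarrow> ('a \<Rightarrow> 'a) set \<Rightarrow> bool" where
  "reflection_group V G \<longleftrightarrow>
     (\<exists>U. U \<subseteq> V - {0} \<and> G = generate (orth_group V) (reflection ` U))"

definition essential :: "'a::euclidean_space set \<Rightarrow> ('a \<Rightarrow> 'a) set \<Rightarrow> bool" where
  "essential V G \<longleftrightarrow> {x\<in>V. \<forall>g\<in>G. g x = x} = {0}"

text \<open>
  Internal direct product: the map \<open>(h\<^sub>0, \<dots>, h\<^bsub>k-1\<^esub>) \<mapsto> h\<^sub>0 \<circ> \<dots> \<circ> h\<^bsub>k-1\<^esub>\<close> is a group isomorphism from
  the external direct product of the \<open>H i\<close> onto \<open>G\<close>.
\<close>

definition is_direct_product ::
  "nat \<Rightarrow> (nat \<Rightarrow> ('a::euclidean_space \<Rightarrow> 'a) set) \<Rightarrow> ('a \<Rightarrow> 'a) set \<Rightarrow> bool" where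
  "is_direct_product k H G \<longleftrightarrow>
     (\<lambda>h. foldr (\<lambda>i f. h i \<circ> f) [0..<k] id)
       \<in> iso (product_group {..<k} (\<lambda>i. (orth_group UNIV)\<lparr>carrier := H i\<rparr>))
             ((orth_group UNIV)\<lparr>carrier := G\<rparr>)"

definition reducible :: "'a::euclidean_space set \<Rightarrow> ('a \<Rightarrow> 'a) set \<Rightarrow> bool" where
  "reducible V G \<longleftrightarrow>
     (\<exists>k H. k \<ge> 2 \<and> (\<forall>i<k. reflection_group V (H i) \<and> H i \<noteq> {id}) \<and> is_direct_product k H G)"

abbreviation irreducible_on :: "'a::euclidean_space set \<Rightarrow> ('a \<Rightarrow> 'a) set \<Rightarrow> bool" where
  "irreducible_on V G \<equiv> \<not> reducible V G"

definition hyperplane :: "'a::euclidean_space set \<Rightarrow> 'a \<Rightarrow> 'a set" where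
  "hyperplane V u = {x\<in>V. u \<bullet> x = 0}"

definition reflecting_hyperplanes ::
  "'a::euclidean_space set \<Rightarrow> ('a \<Rightarrow> 'a) set \<Rightarrow> 'a set set" where
  "reflecting_hyperplanes V G = {hyperplane V u |u. u \<in> V \<and> u \<noteq> 0 \<and> reflection u \<in> G}"

definition weyl_chambers :: "'a::euclidean_space set \<Rightarrow> ('a \<Rightarrow> 'a) set \<Rightarrow> 'a set set" where
  "weyl_chambers V G = components (V - \<Union>(reflecting_hyperplanes V G))"

text \<open>
  The last conjunct says that the boundary of the chamber is not covered by fewer reflecting
  hyperplanes. Distinct elements of \<open>B\<close> have distinct hyperplanes because of the sign condition.
\<close>

definition fundamental_system_of ::
  "'a::euclidean_space set \<Rightarrow> ('a \<Rightarrow> 'a) set \<Rightarrow> 'a set \<Rightarrow> 'a set \<Rightarrow> bool" where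
  "fundamental_system_of V G C B \<longleftrightarrow>
     finite B \<and>
     (\<forall>\<alpha>\<in>B. \<alpha> \<in> V \<and> norm \<alpha> = 1 \<and> hyperplane V \<alpha> \<in> reflecting_hyperplanes V G \<and>
            (\<forall>x\<in>C. \<alpha> \<bullet> x \<ge> 0)) \<and>
     (top_of_set V) frontier_of C \<subseteq> (\<Union>\<alpha>\<in>B. hyperplane V \<alpha>) \<and>
     (\<forall>\<H>. \<H> \<subseteq> reflecting_hyperplanes V G \<and> finite \<H> \<and> (top_of_set V) frontier_of C \<subseteq> \<Union>\<H>
           \<longrightarrow> card B \<le> card \<H>)"

definition fundamental_system ::
  "'a::euclidean_space set \<Rightarrow> ('a \<Rightarrow> 'a) set \<Rightarrow> 'a set \<Rightarrow> bool" where
  "fundamental_system V G B \<longleftrightarrow> (\<exists>C\<in>weyl_chambers V G. fundamental_system_of V G C B)"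

definition orbit_of :: "('a \<Rightarrow> 'a) set \<Rightarrow> 'a \<Rightarrow> 'a set" where
  "orbit_of G x = (\<lambda>g. g x) ` G"

definition orbit_space :: "'a set \<Rightarrow> ('a \<Rightarrow> 'a) set \<Rightarrow> 'a set set" where
  "orbit_space V G = orbit_of G ` V"

definition orbit_dist :: "'a::euclidean_space set \<Rightarrow> 'a set \<Rightarrow> real" where
  "orbit_dist P Q = Min ((\<lambda>(p, q). norm (p - q)) ` (P \<times> Q))"

definition max_filter :: "'a::euclidean_space set \<Rightarrow> 'a set \<Rightarrow> real" where
  "max_filter P Q = Max ((\<lambda>(p, q). p \<bullet> q) ` (P \<times> Q))"

text \<open>Only the coordinates \<open>i < length ts\<close> are meaningful.\<close>

definition max_filter_bank ::
  "('a::euclidean_space \<Rightarrow> 'a) set \<Rightarrow> 'a list \<Rightarrow> 'a set \<Rightarrow> nat \<Rightarrow> real" where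
  "max_filter_bank G ts P i = max_filter (orbit_of G (ts ! i)) P"

definition bank_dist ::
  "('a::euclidean_space \<Rightarrow> 'a) set \<Rightarrow> 'a list \<Rightarrow> 'a set \<Rightarrow> 'a set \<Rightarrow> real" where
  "bank_dist G ts P Q =
     L2_set (\<lambda>i. max_filter_bank G ts P i - max_filter_bank G ts Q i) {..<length ts}"

definition upper_lipschitz_bound ::
  "'a::euclidean_space set \<Rightarrow> ('a \<Rightarrow> 'a) set \<Rightarrow> 'a list \<Rightarrow> real \<Rightarrow> bool" where
  "upper_lipschitz_bound V G ts C \<longleftrightarrow>
     C > 0 \<and> (\<forall>P\<in>orbit_space V G. \<forall>Q\<in>orbit_space V G. bank_dist G ts P Q \<le> C * orbit_dist P Q)"

definition lower_lipschitz_bound ::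
  "'a::euclidean_space set \<Rightarrow> ('a \<Rightarrow> 'a) set \<Rightarrow> 'a list \<Rightarrow> real \<Rightarrow> bool" where
  "lower_lipschitz_bound V G ts c \<longleftrightarrow>
     c > 0 \<and> (\<forall>P\<in>orbit_space V G. \<forall>Q\<in>orbit_space V G. c * orbit_dist P Q \<le> bank_dist G ts P Q)"

definition opt_cond :: "'a::euclidean_space set \<Rightarrow> ('a \<Rightarrow> 'a) set \<Rightarrow> real" where
  "opt_cond V G = Inf {C / c |ts C c. set ts \<subseteq> V \<and>
     upper_lipschitz_bound V G ts C \<and> lower_lipschitz_bound V G ts c}"

definition optimal_templates ::
  "'a::euclidean_space set \<Rightarrow> ('a \<Rightarrow> 'a) set \<Rightarrow> 'a list \<Rightarrow> bool" where
  "optimal_templates V G ts \<longleftrightarrow> set ts \<subseteq> V \<and>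
     (\<exists>C c. upper_lipschitz_bound V G ts C \<and> lower_lipschitz_bound V G ts c \<and>
            C / c = opt_cond V G)"

definition minimal_optimal_templates ::
  "'a::euclidean_space set \<Rightarrow> ('a \<Rightarrow> 'a) set \<Rightarrow> 'a list \<Rightarrow> bool" where
  "minimal_optimal_templates V G ts \<longleftrightarrow> optimal_templates V G ts \<and>
     (\<forall>ts'. optimal_templates V G ts' \<longrightarrow> length ts \<le> length ts')"

definition orthonormal_basis :: "'a::euclidean_space set \<Rightarrow> 'a set \<Rightarrow> bool" where
  "orthonormal_basis V B \<longleftrightarrow> pairwise Linear_Algebra.orthogonal B \<and> (\<forall>b\<in>B. norm b = 1) \<and> span B = V"

definition singular_values :: "real^'n^'n \<Rightarrow> real set" where
  "singular_values A =
     {s. s \<ge> 0 \<and> (\<exists>v. v \<noteq> 0 \<and> (Finite_Cartesian_Product.transpose A ** A) *v v = s\<^sup>2 *\<^sub>R v)}"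

definition sigma_max :: "real^'n^'n \<Rightarrow> real" where
  "sigma_max A = Max (singular_values A)"

definition sigma_min :: "real^'n^'n \<Rightarrow> real" where
  "sigma_min A = Min (singular_values A)"

text \<open>
  The dimension of a constituent varies within one statement, so its matrices are taken with
  natural-number dimensions, and an orthonormal basis \<open>es\<close> of \<open>V\<close> identifies coordinate vectors of
  length \<open>dim V\<close> with elements of \<open>V\<close>.
\<close>

definition from_coords :: "'a::euclidean_space list \<Rightarrow> real vec \<Rightarrow> 'a" where
  "from_coords es v = (\<Sum>j<length es. vec_index v j *\<^sub>R (es ! j))"

definition fundamental_matrix ::
  "'a::euclidean_space set \<Rightarrow> ('a \<Rightarrow> 'a) set \<Rightarrow> 'a list \<Rightarrow> real mat \<Rightarrow> bool" where
  "fundamental_matrix V G es A \<longleftrightarrow>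
     distinct es \<and> orthonormal_basis V (set es) \<and>
     A \<in> carrier_mat (dim V) (dim V) \<and>
     fundamental_system V G (from_coords es ` set (Matrix.rows A))"

definition constituent_templates ::
  "'a::euclidean_space set \<Rightarrow> ('a \<Rightarrow> 'a) set \<Rightarrow> 'a set \<Rightarrow> bool" where
  "constituent_templates V G T \<longleftrightarrow>
     (if G = {id} then orthonormal_basis V T
      else \<exists>es A A'. fundamental_matrix V G es A \<and> inverts_mat A A' \<and> inverts_mat A' A \<and>
             T = from_coords es ` set (Matrix.cols A'))"

definition irreducible_decomposition ::
  "('a::euclidean_space \<Rightarrow> 'a) set \<Rightarrow> nat \<Rightarrow> (nat \<Rightarrow> 'a set) \<Rightarrow> (nat \<Rightarrow> ('a \<Rightarrow> 'a) set) \<Rightarrow> bool"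
where
  "irreducible_decomposition G k V H \<longleftrightarrow>
     (\<forall>i<k. subspace (V i) \<and> (\<forall>g\<in>G. g ` V i \<subseteq> V i)) \<and>
     (\<forall>i<k. \<forall>j<k. i \<noteq> j \<longrightarrow> (\<forall>x\<in>V i. \<forall>y\<in>V j. Linear_Algebra.orthogonal x y)) \<and>
     span (\<Union>i<k. V i) = UNIV \<and>
     (\<forall>i<k. reflection_group (V i) (H i)) \<and>
     is_direct_product k H G \<and>
     (if essential UNIV G then \<forall>i<k. H i \<noteq> {id} else \<exists>!i. i < k \<and> H i = {id}) \<and>
     (\<forall>i<k. H i \<noteq> {id} \<longrightarrow> essential (V i) (H i) \<and> irreducible_on (V i) (H i))"

end

theory Submission
  imports Defs "Jordan_Normal_Form.Determinant"
begin

text \<open>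
  On the closed chamber of a simple system \<open>B\<close> the max filter with a template of the chamber is the
  inner product, and the orbit distance is the Euclidean distance. So the Lipschitz bounds of a bank
  of templates \<open>t\<^sub>i\<close>, moved into the chamber, are the bounds of the linear map \<open>z \<mapsto> (t\<^sub>i \<bullet> z)\<^sub>i\<close>.

  The Coxeter graph is a forest, so signs \<open>\<epsilon>\<close> exist with
  \<open>|\<Sum> v\<^sub>\<alpha> \<alpha>|\<^sup>2 + |\<Sum> \<epsilon>\<^sub>\<alpha> v\<^sub>\<alpha> \<alpha>|\<^sup>2 = 2 \<Sum> v\<^sub>\<alpha>\<^sup>2\<close>, and the spectrum of the Gram matrix of \<open>B\<close> has the
  extreme points \<open>1 - r\<close> and \<open>1 + r\<close>. If \<open>v \<ge> 0\<close> then \<open>|t \<bullet> (\<Sum> \<epsilon>\<^sub>\<alpha> v\<^sub>\<alpha> \<alpha>)| \<le> t \<bullet> (\<Sum> v\<^sub>\<alpha> \<alpha>)\<close> for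
  every template \<open>t\<close> of the chamber, and extremal \<open>v\<close> (which may be taken nonnegative, as distinct
  simple roots have nonpositive inner products) give the lower bound \<open>sqrt ((1 + r) / (1 - r))\<close> for the
  quotient of the Lipschitz bounds. It is attained by the dual basis of \<open>B\<close> together with an
  orthonormal basis of the orthogonal complement of \<open>B\<close>. For a product of groups, \<open>B\<close> is the union
  of the simple systems of the factors and \<open>r\<close> is the maximum.
\<close>

no_notation scalar_prod (infix \<open>\<bullet>\<close> 70)
no_notation vec_index (infixl \<open>$\<close> 100)
hide_const (open) Matrix.orthogonal Matrix.rows Matrix.row Matrix.mat

section \<open>Reflections and the groups they generate\<close>

text \<open>A linear map \<open>z \<mapsto> t \<bullet> z\<close>, taken over enough templates
  \<open>t\<close>, could well be an isometry, so a lower bound for the quotient must come from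
  confining the templates to the chamber. There they pair nonnegatively with the simple roots, so
  signs put on nonnegative coefficients can only shrink each coordinate of the bank. With
  \<open>x\<close> the unsigned and \<open>y\<close> the signed combination this gives
  \<open>c * norm y \<le> C * norm x\<close>; as their squared norms add up to 2 for unit
  coefficients, a short \<open>x\<close> means a long \<open>y\<close>. The number of templates is
  bounded for another reason: a positive lower Lipschitz bound makes the chamber representatives
  span \<open>V\<close>. A fundamental system is given by the frontier of a chamber, so simple
  systems are described geometrically, by wall points and by the absence of roots vanishing inside
  the chamber. Angles between simple roots, generation by simple reflections and the exchange
  property are then read off from signs of roots at wall points and at one interior point.\<close>

lemma reflection_scaleR:
  assumes "r \<noteq> 0"
  shows "reflection (r *\<^sub>R u) = reflection u"
proof
  fix x
  have "2 / (norm (r *\<^sub>R u))\<^sup>2 * ((r *\<^sub>R u) \<bullet> x) * r = 2 / (norm u)\<^sup>2 * (u \<bullet> x)"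
    using assms by (cases "u = 0") (auto simp: power_mult_distrib divide_simps power2_eq_square)
  then show "reflection (r *\<^sub>R u) x = reflection u x"
    by (simp add: reflection_def)
qed

lemma reflection_minus [simp]: "reflection (- u) = reflection u"
  by (rule ext) (simp add: reflection_def)

lemma reflection_unit: "norm u = 1 \<Longrightarrow> reflection u x = x - (2 * (u \<bullet> x)) *\<^sub>R u"
  by (simp add: reflection_def)

lemma linear_reflection: "linear (reflection u)"
  by (rule linearI) (auto simp: reflection_def algebra_simps inner_add_right)

lemma reflection_self: "reflection u u = - u"
  by (cases "u = 0") (auto simp: reflection_def dot_square_norm scaleR_2)

lemma reflection_fix_iff: "u \<noteq> 0 \<Longrightarrow> reflection u x = x \<longleftrightarrow> u \<bullet> x = 0"
  by (auto simp: reflection_def)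

lemma reflection_orth: "u \<bullet> x = 0 \<Longrightarrow> reflection u x = x"
  by (auto simp: reflection_def)

lemma inner_reflection: "reflection u x \<bullet> reflection u y = x \<bullet> y"
proof (cases "u = 0")
  case False
  then have "(norm u)\<^sup>2 \<noteq> 0" by simp
  then show ?thesis
    by (simp add: reflection_def inner_diff_left inner_diff_right dot_square_norm inner_commute
        divide_simps power2_eq_square)
qed (simp add: reflection_def)

lemma isometry_reflection: "orthogonal_transformation (reflection u)"
  by (simp add: orthogonal_transformation_def linear_reflection inner_reflection)

lemma reflection_involution [simp]: "reflection u (reflection u x) = x"
proof -
  define r where "r = 2 / (norm u)\<^sup>2 * (u \<bullet> x)"
  have x: "reflection u x = x - r *\<^sub>R u"
    by (simp add: reflection_def r_def)
  have "reflection u (x - r *\<^sub>R u) = reflection u x - r *\<^sub>R reflection u u"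
    by (simp add: linear_diff[OF linear_reflection] linear_scale[OF linear_reflection])
  then show ?thesis by (simp add: x reflection_self)
qed

lemma reflection_comp_self [simp]: "reflection u \<circ> reflection u = id"
  by (rule ext) simp

lemma inner_reflection_adjoint: "x \<bullet> reflection u y = reflection u x \<bullet> y"
  by (metis inner_reflection reflection_involution)

lemma reflection_in_subspace:
  "subspace V \<Longrightarrow> u \<in> V \<Longrightarrow> x \<in> V \<Longrightarrow> reflection u x \<in> V"
  by (simp add: reflection_def subspace_diff subspace_scale)

text \<open>Evaluation at \<open>u\<close> suffices: \<open>reflection u\<close> sends
  \<open>u\<close> to \<open>- u\<close>, whereas \<open>reflection v\<close> moves it only along
  \<open>v\<close>.\<close>

lemma reflection_eq_parallel:
  assumes "reflection u = reflection v" "u \<noteq> 0" "v \<noteq> 0"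
  obtains r where "r \<noteq> 0" "u = r *\<^sub>R v"
proof -
  have "- u = u - (2 / (norm v)\<^sup>2) *\<^sub>R ((v \<bullet> u) *\<^sub>R v)"
    using assms(1) reflection_self[of u] by (simp add: reflection_def)
  then have "2 *\<^sub>R u = (2 / (norm v)\<^sup>2 * (v \<bullet> u)) *\<^sub>R v"
    by (simp add: algebra_simps scaleR_2)
  then have "u = ((v \<bullet> u) / (norm v)\<^sup>2) *\<^sub>R v"
    by (metis (no_types, opaque_lifting) divide_inverse mult.assoc mult.commute pth_1 scaleR_scaleR
        scaleR_left_imp_eq zero_neq_numeral)
  then show ?thesis using assms(2) that[of "(v \<bullet> u) / (norm v)\<^sup>2"] by force
qed

lemma reflection_ne_id: "u \<noteq> 0 \<Longrightarrow> reflection u \<noteq> id"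
proof
  assume "u \<noteq> 0" "reflection u = id"
  then have "u \<bullet> u = 0" using reflection_fix_iff[of u u] by simp
  then show False using \<open>u \<noteq> 0\<close> by simp
qed

text \<open>The conjugation rule in a form without inverses; it keeps the set of roots stable under
  the group and moves a reflection across a word.\<close>

lemma reflection_conj:
  assumes "orthogonal_transformation f"
  shows "f (reflection u x) = reflection (f u) (f x)"
proof -
  have "linear f" "norm (f u) = norm u" "f u \<bullet> f x = u \<bullet> x"
    using assms by (auto simp: orthogonal_transformation_def norm_eq_sqrt_inner)
  then show ?thesis
    by (simp add: reflection_def linear_diff linear_scale)
qed

text \<open>Words are kept as lists because the exchange argument shortens a word without changing
  the map that it represents.\<close>

fun refl_word :: "'a::euclidean_space list \<Rightarrow> 'a \<Rightarrow> 'a" where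
  "refl_word [] = id"
| "refl_word (u # us) = reflection u \<circ> refl_word us"

lemma refl_word_append: "refl_word (us @ vs) = refl_word us \<circ> refl_word vs"
  by (induction us) (auto simp: comp_assoc)

lemma refl_word_rev: "refl_word (rev us) \<circ> refl_word us = id" "refl_word us \<circ> refl_word (rev us) = id"
proof -
  show *: "refl_word (rev us) \<circ> refl_word us = id" for us :: "'a list"
    by (induction us) (auto simp: refl_word_append fun_eq_iff)
  show "refl_word us \<circ> refl_word (rev us) = id"
    using *[of "rev us"] by simp
qed

lemma isometry_refl_word: "orthogonal_transformation (refl_word us)"
proof (induction us)
  case Nil
  then show ?case by (simp add: orthogonal_transformation_def linear_id)
next
  case (Cons u us)
  then show ?case
    by (simp add: orthogonal_transformation_compose isometry_reflection del: comp_apply)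
qed

lemma refl_word_in_subspace:
  "subspace V \<Longrightarrow> set us \<subseteq> V \<Longrightarrow> x \<in> V \<Longrightarrow> refl_word us x \<in> V"
  by (induction us) (auto intro: reflection_in_subspace)

lemma refl_word_orth: "(\<And>u. u \<in> set us \<Longrightarrow> u \<bullet> x = 0) \<Longrightarrow> refl_word us x = x"
  by (induction us) (auto simp: reflection_orth)

section \<open>The orthogonal group of a subspace and its reflection subgroups\<close>

lemma mult_orth_group [simp]: "f \<otimes>\<^bsub>orth_group V\<^esub> g = f \<circ> g"
  by (simp add: orth_group_def)

lemma one_orth_group [simp]: "\<one>\<^bsub>orth_group V\<^esub> = id"
  by (simp add: orth_group_def)

lemma carrier_orth_group_iff:
  "f \<in> carrier (orth_group V) \<longleftrightarrow> orthogonal_transformation f \<and> (\<forall>x. (\<forall>v\<in>V. v \<bullet> x = 0) \<longrightarrow> f x = x)"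
  by (auto simp: orth_group_def orthogonal_comp_def Linear_Algebra.orthogonal_def)

lemma group_orth_group: "group (orth_group V)"
proof (rule groupI)
  fix f assume f: "f \<in> carrier (orth_group V)"
  then have o: "orthogonal_transformation f" by (simp add: carrier_orth_group_iff)
  then have bij: "bij f" by (rule orthogonal_transformation_bij)
  have "Hilbert_Choice.inv f \<in> carrier (orth_group V)"
    using f bij unfolding carrier_orth_group_iff
    by (metis orthogonal_transformation_inv bij_inv_eq_iff)
  moreover have "Hilbert_Choice.inv f \<circ> f = id" using bij by (simp add: bij_is_inj)
  ultimately show "\<exists>g\<in>carrier (orth_group V). g \<otimes>\<^bsub>orth_group V\<^esub> f = \<one>\<^bsub>orth_group V\<^esub>"
    by auto
qed (auto simp: carrier_orth_group_iff comp_assoc orthogonal_transformation_def linear_id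
    intro: linear_compose)

lemma reflection_in_orth: "u \<in> V \<Longrightarrow> reflection u \<in> carrier (orth_group V)"
  by (auto simp: carrier_orth_group_iff isometry_reflection reflection_orth)

text \<open>Reflections are involutions, so words without inverse letters are already closed under
  inversion. From here on words replace the abstractly generated group.\<close>

lemma generate_reflections:
  assumes "U \<subseteq> V"
  shows "generate (orth_group V) (reflection ` U) = refl_word ` lists U"
proof (intro equalityI subsetI)
  interpret group "orth_group V" by (rule group_orth_group)
  fix f assume "f \<in> generate (orth_group V) (reflection ` U)"
  then show "f \<in> refl_word ` lists U"
  proof induction
    case one
    have "refl_word [] \<in> refl_word ` lists U" by blast
    then show ?case by (simp del: id_apply)
  next
    case (incl h)
    then obtain u where "u \<in> U" "h = reflection u" by auto
    then have "h = refl_word [u]" "[u] \<in> lists U" by auto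
    then show ?case by blast
  next
    case (inv h)
    then obtain u where u: "u \<in> U" "h = reflection u" by auto
    then have "inv\<^bsub>orth_group V\<^esub> h = h"
      using assms by (intro inv_equality) (auto simp: reflection_in_orth)
    then have "inv\<^bsub>orth_group V\<^esub> h = refl_word [u]" "[u] \<in> lists U" using u by auto
    then show ?case by blast
  next
    case (eng h1 h2)
    then obtain us vs where "us \<in> lists U" "h1 = refl_word us" "vs \<in> lists U" "h2 = refl_word vs"
      by auto
    then have "h1 \<otimes>\<^bsub>orth_group V\<^esub> h2 = refl_word (us @ vs)" "us @ vs \<in> lists U"
      by (auto simp: refl_word_append)
    then show ?case by blast
  qed
next
  fix f assume "f \<in> refl_word ` lists U"
  then obtain us where "us \<in> lists U" "f = refl_word us" by auto
  then show "f \<in> generate (orth_group V) (reflection ` U)"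
  proof (induction us arbitrary: f)
    case Nil
    then show ?case using generate.one[of "orth_group V"] by (metis one_orth_group refl_word.simps(1))
  next
    case (Cons u us)
    then have "reflection u \<circ> refl_word us \<in> generate (orth_group V) (reflection ` U)"
      using generate.eng[of "reflection u" "orth_group V" "reflection ` U" "refl_word us"]
      by (simp add: generate.incl del: comp_apply)
    then show ?case using Cons.prems by (simp only: refl_word.simps)
  qed
qed

lemma refl_group_iff:
  "reflection_group V G \<longleftrightarrow> (\<exists>U. U \<subseteq> V - {0} \<and> G = refl_word ` lists U)"
  unfolding reflection_group_def using generate_reflections by (metis Diff_subset subset_trans)

lemma refl_groupE:
  assumes "reflection_group V G"
  obtains U where "U \<subseteq> V - {0}" "G = refl_word ` lists U"
  using assms refl_group_iff by metis

lemma refl_group_id: "reflection_group V G \<Longrightarrow> id \<in> G"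
  by (metis refl_groupE refl_word.simps(1) imageI lists.Nil)

lemma refl_group_comp:
  assumes "reflection_group V G" "f \<in> G" "g \<in> G" shows "f \<circ> g \<in> G"
  using assms(1)
proof (rule refl_groupE)
  fix U assume U: "G = refl_word ` lists U"
  then obtain us vs where "us \<in> lists U" "f = refl_word us" "vs \<in> lists U" "g = refl_word vs"
    using assms by auto
  then have "f \<circ> g = refl_word (us @ vs)" "us @ vs \<in> lists U" by (auto simp: refl_word_append)
  then show ?thesis using U by blast
qed

lemma refl_group_inverse:
  assumes "reflection_group V G" "f \<in> G"
  obtains g where "g \<in> G" "g \<circ> f = id" "f \<circ> g = id"
  using assms(1)
proof (rule refl_groupE)
  fix U assume U: "G = refl_word ` lists U"
  then obtain us where "us \<in> lists U" "f = refl_word us" using assms by auto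
  then have "refl_word (rev us) \<in> G" using U by auto
  then show ?thesis using that refl_word_rev \<open>f = _\<close> by blast
qed

lemma refl_group_isometry:
  "reflection_group V G \<Longrightarrow> f \<in> G \<Longrightarrow> orthogonal_transformation f"
  by (auto elim!: refl_groupE intro: isometry_refl_word)

lemma refl_group_linear: "reflection_group V G \<Longrightarrow> f \<in> G \<Longrightarrow> linear f"
  by (simp add: refl_group_isometry orthogonal_transformation_linear)

lemma refl_group_inner:
  "reflection_group V G \<Longrightarrow> f \<in> G \<Longrightarrow> f x \<bullet> f y = x \<bullet> y"
  using refl_group_isometry
  by (metis orthogonal_transformation_def)

lemma refl_group_invariant:
  assumes "reflection_group V G" "subspace V" "f \<in> G" "x \<in> V" shows "f x \<in> V"
  using assms by (elim refl_groupE) (auto intro!: refl_word_in_subspace)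

lemma refl_group_orth:
  assumes "reflection_group V G" "f \<in> G" "\<And>v. v \<in> V \<Longrightarrow> v \<bullet> x = 0" shows "f x = x"
  using assms by (elim refl_groupE) (auto intro!: refl_word_orth)

lemma refl_group_inner_inverse:
  assumes "reflection_group V G" "f \<in> G"
  obtains g where "g \<in> G" "\<And>x y. f x \<bullet> y = x \<bullet> g y"
proof -
  obtain g where g: "g \<in> G" "g \<circ> f = id" "f \<circ> g = id"
    using refl_group_inverse[OF assms] .
  have "f x \<bullet> y = x \<bullet> g y" for x y
    using refl_group_inner[OF assms(1) g(1), of "f x" y] g(2) by (metis comp_apply id_apply)
  then show ?thesis using that g(1) by blast
qed

lemma refl_group_conj:
  assumes "reflection_group V G" "f \<in> G" "reflection u \<in> G"
  shows "reflection (f u) \<in> G"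
proof -
  obtain g where g: "g \<in> G" "g \<circ> f = id" "f \<circ> g = id"
    using refl_group_inverse[OF assms(1,2)] .
  have "reflection (f u) = f \<circ> reflection u \<circ> g"
  proof
    fix x
    have "f (reflection u (g x)) = reflection (f u) (f (g x))"
      using reflection_conj refl_group_isometry assms
      by metis
    then show "reflection (f u) x = (f \<circ> reflection u \<circ> g) x"
      using g(3) by (metis comp_apply id_apply)
  qed
  then show ?thesis using assms g refl_group_comp by metis
qed

section \<open>Simple systems and the closed chamber\<close>

text \<open>
  The points \<open>p\<close> are interior points of the walls of the chamber; their existence encodes that no
  element of \<open>B\<close> is redundant.
\<close>

definition simple_system :: "'a::euclidean_space set \<Rightarrow> ('a \<Rightarrow> 'a) set \<Rightarrow> 'a set \<Rightarrow> bool" where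
  "simple_system V G B \<longleftrightarrow>
     finite B \<and>
     (\<forall>\<alpha>\<in>B. \<alpha> \<in> V \<and> norm \<alpha> = 1 \<and> reflection \<alpha> \<in> G \<and>
            (\<exists>p\<in>V. \<alpha> \<bullet> p = 0 \<and> (\<forall>\<beta>\<in>B - {\<alpha>}. \<beta> \<bullet> p > 0))) \<and>
     (\<exists>c\<in>V. \<forall>\<alpha>\<in>B. \<alpha> \<bullet> c > 0) \<and>
     (\<forall>\<gamma>\<in>V. \<gamma> \<noteq> 0 \<and> reflection \<gamma> \<in> G \<longrightarrow> (\<forall>x\<in>V. (\<forall>\<alpha>\<in>B. \<alpha> \<bullet> x > 0) \<longrightarrow> \<gamma> \<bullet> x \<noteq> 0))"

text \<open>Finitely many strict linear inequalities survive a small step. This later keeps a moved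
  wall point in the chamber and shows that differences of chamber points fill the space.\<close>

lemma pos_perturbation:
  fixes a b :: "'b \<Rightarrow> real"
  assumes "finite S" "\<And>s. s \<in> S \<Longrightarrow> a s > 0"
  shows "\<exists>\<epsilon>>0. \<forall>s\<in>S. a s + \<epsilon> * b s > 0"
  using assms
proof (induction S rule: finite_induct)
  case empty
  then show ?case by (auto intro: exI[of _ 1])
next
  case (insert s S)
  then obtain e where e: "e > 0" "\<forall>s\<in>S. a s + e * b s > 0" by auto
  have as: "a s > 0" using insert by simp
  \<comment> \<open>The second bound gives \<open>d * \<bar>b s\<bar> < a s\<close> for either sign
    of \<open>b s\<close>, with a positive denominator even if \<open>b s = 0\<close>. Shrinking the
    old step \<open>e\<close> preserves the inequalities already obtained.\<close>
  define d where "d = min e (a s / (1 + \<bar>b s\<bar>))"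
  have d: "d > 0" "d \<le> e" using e as by (auto simp: d_def)
  have "d * \<bar>b s\<bar> < d * (1 + \<bar>b s\<bar>)" using d by simp
  also have "\<dots> \<le> a s"
    by (subst pos_le_divide_eq[symmetric]) (auto simp: d_def)
  finally have "d * \<bar>b s\<bar> < a s" .
  moreover have "- (d * b s) \<le> d * \<bar>b s\<bar>" using d(1)
    by (metis abs_ge_minus_self abs_mult abs_of_pos)
  ultimately have "a s + d * b s > 0" by linarith
  moreover have "a t + d * b t > 0" if "t \<in> S" for t
  proof (cases "b t \<ge> 0")
    case True
    then show ?thesis using insert.prems that d by (simp add: add_pos_nonneg)
  next
    case False
    then have "e * b t \<le> d * b t" using d by (simp add: mult_right_mono_neg)
    then show ?thesis using e(2) that by force
  qed
  ultimately show ?case using d(1) by auto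
qed

locale simple_refl =
  fixes V :: "'a::euclidean_space set" and G B
  assumes subspace_V: "subspace V"
    and finite_G: "finite G"
    and refl_G: "reflection_group V G"
    and simple: "simple_system V G B"
begin

text \<open>A fixed interior point of the chamber; the sign of the inner product with it separates
  positive from negative roots.\<close>

definition base_point :: 'a where
  "base_point = (SOME c. c \<in> V \<and> (\<forall>\<alpha>\<in>B. \<alpha> \<bullet> c > 0))"

definition roots :: "'a set" where
  "roots = {\<gamma>\<in>V. \<gamma> \<noteq> 0 \<and> reflection \<gamma> \<in> G}"

definition closed_chamber :: "'a set" where
  "closed_chamber = {x\<in>V. \<forall>\<alpha>\<in>B. \<alpha> \<bullet> x \<ge> 0}"

section \<open>Signs of roots on the chamber\<close>

lemma base_point: "base_point \<in> V" "\<And>\<alpha>. \<alpha> \<in> B \<Longrightarrow> \<alpha> \<bullet> base_point > 0"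
proof -
  have "\<exists>c. c \<in> V \<and> (\<forall>\<alpha>\<in>B. \<alpha> \<bullet> c > 0)"
    using simple by (auto simp: simple_system_def)
  then have "base_point \<in> V \<and> (\<forall>\<alpha>\<in>B. \<alpha> \<bullet> base_point > 0)"
    unfolding base_point_def by (rule someI_ex)
  then show "base_point \<in> V" "\<And>\<alpha>. \<alpha> \<in> B \<Longrightarrow> \<alpha> \<bullet> base_point > 0" by auto
qed

lemma finite_B: "finite B"
  and B_subset: "B \<subseteq> V"
  and norm_B: "\<alpha> \<in> B \<Longrightarrow> norm \<alpha> = 1"
  and reflection_B: "\<alpha> \<in> B \<Longrightarrow> reflection \<alpha> \<in> G"
  using simple by (auto simp: simple_system_def)

lemma B_nonzero: "\<alpha> \<in> B \<Longrightarrow> \<alpha> \<noteq> 0"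
  using norm_B by force

lemma B_roots: "B \<subseteq> roots"
  using B_subset B_nonzero reflection_B by (auto simp: roots_def)

lemma wall_point:
  assumes "\<alpha> \<in> B"
  obtains p where "p \<in> closed_chamber" "\<alpha> \<bullet> p = 0" "\<And>\<beta>. \<beta> \<in> B \<Longrightarrow> \<beta> \<noteq> \<alpha> \<Longrightarrow> \<beta> \<bullet> p > 0"
proof -
  obtain p where p: "p \<in> V" "\<alpha> \<bullet> p = 0" "\<And>\<beta>. \<beta> \<in> B \<Longrightarrow> \<beta> \<noteq> \<alpha> \<Longrightarrow> \<beta> \<bullet> p > 0"
    using simple assms by (auto simp: simple_system_def)
  then have "p \<in> closed_chamber" unfolding closed_chamber_def by force
  then show ?thesis using p that by blast
qed

lemma root_nonzero_chamber:
  assumes "\<gamma> \<in> roots" "x \<in> V" "\<And>\<alpha>. \<alpha> \<in> B \<Longrightarrow> \<alpha> \<bullet> x > 0"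
  shows "\<gamma> \<bullet> x \<noteq> 0"
  using simple assms by (auto simp: simple_system_def roots_def)

lemma roots_minus: "\<gamma> \<in> roots \<Longrightarrow> - \<gamma> \<in> roots"
  using subspace_V by (auto simp: roots_def subspace_neg)

lemma roots_image: "\<gamma> \<in> roots \<Longrightarrow> g \<in> G \<Longrightarrow> g \<gamma> \<in> roots"
  using refl_group_invariant[OF refl_G subspace_V] refl_group_conj[OF refl_G]
    refl_group_inner[OF refl_G, of g \<gamma> \<gamma>]
  unfolding roots_def by force

lemma roots_reflection: "\<gamma> \<in> roots \<Longrightarrow> \<alpha> \<in> roots \<Longrightarrow> reflection \<alpha> \<gamma> \<in> roots"
  using roots_image by (auto simp: roots_def)

text \<open>A root positive at the base point and negative at \<open>x\<close> would vanish at some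
  \<open>x + e *\<^sub>R base_point\<close> with \<open>e > 0\<close>. That point lies strictly
  inside the chamber, where no root vanishes.\<close>

lemma root_sign:
  assumes "\<gamma> \<in> roots" "\<gamma> \<bullet> base_point > 0" "x \<in> closed_chamber"
  shows "\<gamma> \<bullet> x \<ge> 0"
proof (rule ccontr)
  assume "\<not> \<gamma> \<bullet> x \<ge> 0"
  define e where "e = - (\<gamma> \<bullet> x) / (\<gamma> \<bullet> base_point)"
  have e: "e > 0" using \<open>\<not> \<gamma> \<bullet> x \<ge> 0\<close> assms(2) by (simp add: e_def divide_neg_pos)
  let ?z = "x + e *\<^sub>R base_point"
  have "?z \<in> V" using assms(3) base_point(1) subspace_V
    by (simp add: closed_chamber_def subspace_add subspace_scale)
  moreover have "\<alpha> \<bullet> ?z > 0" if "\<alpha> \<in> B" for \<alpha>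
    using assms(3) that e base_point(2)[OF that]
    by (auto simp: closed_chamber_def inner_add_right intro!: add_nonneg_pos)
  moreover have "\<gamma> \<bullet> ?z = 0"
    unfolding inner_add_right inner_scaleR_right using assms(2) by (simp add: e_def)
  ultimately show False using root_nonzero_chamber assms(1) by blast
qed

lemma root_base_point: "\<gamma> \<in> roots \<Longrightarrow> \<gamma> \<bullet> base_point \<noteq> 0"
  using root_nonzero_chamber base_point by blast

lemma root_sign_cases:
  assumes "\<gamma> \<in> roots" "x \<in> closed_chamber" "y \<in> closed_chamber"
  shows "\<not> (\<gamma> \<bullet> x > 0 \<and> \<gamma> \<bullet> y < 0)"
  using root_base_point[OF assms(1)] root_sign[OF assms(1) _ assms(3)]
    root_sign[OF roots_minus[OF assms(1)] _ assms(2)]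
  by fastforce

text \<open>\<open>\<delta>\<close> and its image agree at an inner point \<open>p\<close> of the
  wall of \<open>\<alpha>\<close>, so their opposite signs force \<open>\<delta>\<close> to vanish
  there. As \<open>p\<close> can move a little along the wall, against the component
  \<open>v\<close> of \<open>\<delta>\<close> orthogonal to \<open>\<alpha>\<close>, the root would
  become negative in the closed chamber unless \<open>v = 0\<close>.\<close>

lemma reflection_simple_neg:
  assumes "\<alpha> \<in> B" "\<delta> \<in> roots" "\<delta> \<bullet> base_point > 0" "reflection \<alpha> \<delta> \<bullet> base_point < 0"
  shows "\<delta> = (\<alpha> \<bullet> \<delta>) *\<^sub>R \<alpha>"
proof -
  obtain p where p: "p \<in> closed_chamber" "\<alpha> \<bullet> p = 0" "\<And>\<beta>. \<beta> \<in> B \<Longrightarrow> \<beta> \<noteq> \<alpha> \<Longrightarrow> \<beta> \<bullet> p > 0"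
    using wall_point[OF assms(1)] by metis
  have "- reflection \<alpha> \<delta> \<in> roots"
    using assms(1,2) B_roots by (auto intro: roots_minus roots_reflection)
  then have "reflection \<alpha> \<delta> \<bullet> p \<le> 0" using root_sign[of "- reflection \<alpha> \<delta>" p] p(1) assms(4) by simp
  then have "\<delta> \<bullet> p \<le> 0"
    using p(2) inner_reflection_adjoint[of \<delta> \<alpha> p] by (simp add: reflection_orth)
  then have \<delta>p: "\<delta> \<bullet> p = 0" using root_sign[OF assms(2,3) p(1)] by simp
  define v where "v = \<delta> - (\<alpha> \<bullet> \<delta>) *\<^sub>R \<alpha>"
  have \<alpha>1: "\<alpha> \<bullet> \<alpha> = 1" using norm_B assms(1) by (simp add: norm_eq_1)
  have \<alpha>v: "\<alpha> \<bullet> v = 0" by (simp add: v_def inner_diff_right \<alpha>1)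
  have \<delta>v: "\<delta> \<bullet> v = v \<bullet> v"
    using \<alpha>v by (simp add: v_def inner_diff_right inner_diff_left inner_commute)
  have "v \<in> V" using assms(1,2) B_subset subspace_V
    by (auto simp: v_def roots_def intro!: subspace_diff subspace_scale)
  obtain e where e: "e > 0" "\<forall>\<beta>\<in>B - {\<alpha>}. \<beta> \<bullet> p + e * - (\<beta> \<bullet> v) > 0"
    using pos_perturbation[of "B - {\<alpha>}" "\<lambda>\<beta>. \<beta> \<bullet> p" "\<lambda>\<beta>. - (\<beta> \<bullet> v)"] finite_B p(3) by auto
  have "\<beta> \<bullet> (p - e *\<^sub>R v) \<ge> 0" if "\<beta> \<in> B" for \<beta>
    using e(2) that \<alpha>v p(2) by (cases "\<beta> = \<alpha>") (auto simp: inner_diff_right less_imp_le)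
  then have "p - e *\<^sub>R v \<in> closed_chamber"
    using p(1) \<open>v \<in> V\<close> subspace_V by (auto simp: closed_chamber_def intro!: subspace_diff subspace_scale)
  then have "\<delta> \<bullet> (p - e *\<^sub>R v) \<ge> 0" by (rule root_sign[OF assms(2,3)])
  then have "e * (v \<bullet> v) \<le> 0" using \<delta>p \<delta>v by (simp add: inner_diff_right)
  then have "v \<bullet> v \<le> 0" using e(1) by (simp add: mult_le_0_iff)
  then have "v = 0" using inner_gt_zero_iff[of v] by (simp add: not_less[symmetric])
  then show ?thesis by (simp add: v_def)
qed

text \<open>
  For an inner product in \<open>{-1/2<..<0}\<close> the root \<open>s\<^sub>\<beta> (s\<^sub>\<alpha> \<beta>)\<close> would be positive on one wall
  and negative on another one.
\<close>

lemma simple_inner: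
  assumes "\<alpha> \<in> B" "\<beta> \<in> B" "\<alpha> \<noteq> \<beta>"
  shows "\<alpha> \<bullet> \<beta> = 0 \<or> \<alpha> \<bullet> \<beta> \<le> - 1 / 2"
proof -
  define k where "k = \<alpha> \<bullet> \<beta>"
  obtain p where p: "p \<in> closed_chamber" "\<alpha> \<bullet> p = 0" "\<And>\<beta>. \<beta> \<in> B \<Longrightarrow> \<beta> \<noteq> \<alpha> \<Longrightarrow> \<beta> \<bullet> p > 0"
    using wall_point[OF assms(1)] by metis
  obtain q where q: "q \<in> closed_chamber" "\<beta> \<bullet> q = 0" "\<And>\<alpha>. \<alpha> \<in> B \<Longrightarrow> \<alpha> \<noteq> \<beta> \<Longrightarrow> \<alpha> \<bullet> q > 0"
    using wall_point[OF assms(2)] by metis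
  have \<beta>p: "\<beta> \<bullet> p > 0" and \<alpha>q: "\<alpha> \<bullet> q > 0" using p q assms by auto
  have n: "norm \<alpha> = 1" "norm \<beta> = 1" using assms norm_B by auto
  have eq1: "reflection \<alpha> \<beta> = \<beta> - (2 * k) *\<^sub>R \<alpha>"
    by (simp add: reflection_unit n k_def)
  have "reflection \<beta> (reflection \<alpha> \<beta>) = reflection \<beta> \<beta> - (2 * k) *\<^sub>R reflection \<beta> \<alpha>"
    unfolding eq1 by (simp add: linear_diff[OF linear_reflection] linear_scale[OF linear_reflection])
  then have eq2: "reflection \<beta> (reflection \<alpha> \<beta>) = (4 * k\<^sup>2 - 1) *\<^sub>R \<beta> - (2 * k) *\<^sub>R \<alpha>"
    by (simp add: reflection_self reflection_unit[OF n(2)] k_def inner_commute algebra_simps power2_eq_square)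
  have r: "reflection \<alpha> \<beta> \<in> roots" "reflection \<beta> (reflection \<alpha> \<beta>) \<in> roots"
    using assms B_roots by (auto intro: roots_reflection)
  \<comment> \<open>For positive \<open>k\<close> the root
    \<open>\<beta> - (2 * k) *\<^sub>R \<alpha>\<close> is positive at \<open>p\<close> and negative
    at \<open>q\<close>.\<close>
  have "\<not> k > 0"
    using root_sign_cases[OF r(1) p(1) q(1)] \<beta>p \<alpha>q p(2) q(2)
    by (auto simp: eq1 inner_diff_left)
  moreover have "\<not> (k < 0 \<and> k > - 1 / 2)"
  proof
    assume k: "k < 0 \<and> k > - 1 / 2"
    then have "\<bar>k\<bar> < 1 / 2" by auto
    then have "k\<^sup>2 < (1 / 2)\<^sup>2" by (metis abs_ge_zero power2_abs power_strict_mono zero_less_numeral)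
    then have "4 * k\<^sup>2 - 1 < 0" by (simp add: power2_eq_square)
    then show False
      using root_sign_cases[OF r(2) q(1) p(1)] \<beta>p \<alpha>q p(2) q(2) k
      by (auto simp: eq2 inner_diff_left mult_neg_pos)
  qed
  ultimately show ?thesis unfolding k_def by linarith
qed

section \<open>Generation by simple reflections, exchange, and the chamber as a fundamental
  domain\<close>

lemma refl_word_B: "us \<in> lists B \<Longrightarrow> refl_word us \<in> G"
  by (induction us) (auto simp: refl_group_id[OF refl_G] reflection_B
      intro!: refl_group_comp[OF refl_G] simp del: id_apply comp_apply)

text \<open>Otherwise \<open>- \<delta>\<close> would lie in the closed chamber, where the positive
  root \<open>\<delta>\<close> cannot be negative.\<close>

lemma exists_pos_inner:
  assumes "\<delta> \<in> roots" "\<delta> \<bullet> base_point > 0"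
  shows "\<exists>\<alpha>\<in>B. \<alpha> \<bullet> \<delta> > 0"
proof (rule ccontr)
  assume "\<not> (\<exists>\<alpha>\<in>B. \<alpha> \<bullet> \<delta> > 0)"
  then have "- \<delta> \<in> closed_chamber"
    using assms(1) subspace_V by (auto simp: closed_chamber_def roots_def subspace_neg)
  then have "\<delta> \<bullet> - \<delta> \<ge> 0" using root_sign assms by blast
  then show False using assms(1) by (simp add: roots_def inner_gt_zero_iff flip: not_less)
qed

text \<open>Among the words over \<open>B\<close> that send a positive root \<open>\<delta>\<close>
  to a positive root, take one whose image has the smallest inner product with
  \<open>base_point\<close>. Some simple reflection lowers this number further, so it must produce a
  negative root, and then the image is a multiple of a simple root. Conjugating back expresses
  \<open>reflection \<delta>\<close>.\<close>

lemma reflection_by_simple: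
  assumes "\<delta> \<in> roots"
  shows "reflection \<delta> \<in> refl_word ` lists B"
proof -
  have *: "reflection \<delta> \<in> refl_word ` lists B" if \<delta>: "\<delta> \<in> roots" "\<delta> \<bullet> base_point > 0" for \<delta>
  proof -
    define S where "S = {w \<in> refl_word ` lists B. w \<delta> \<bullet> base_point > 0}"
    have "S \<subseteq> G" using refl_word_B by (auto simp: S_def)
    then have "finite S" using finite_G finite_subset by blast
    moreover have "refl_word [] \<in> S" using \<delta>(2) unfolding S_def by (auto simp del: refl_word.simps) auto
    ultimately obtain w where w: "w \<in> S" "\<And>w'. w' \<in> S \<Longrightarrow> w \<delta> \<bullet> base_point \<le> w' \<delta> \<bullet> base_point"
      using ex_min_if_finite[of "(\<lambda>w. w \<delta> \<bullet> base_point) ` S"] by (force simp: not_less)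
    then obtain us where us: "us \<in> lists B" "w = refl_word us" by (auto simp: S_def)
    have wG: "w \<in> G" using w(1) \<open>S \<subseteq> G\<close> by blast
    have w\<delta>: "w \<delta> \<in> roots" "w \<delta> \<bullet> base_point > 0"
      using roots_image \<delta>(1) wG w(1) by (auto simp: S_def)
    obtain \<alpha> where \<alpha>: "\<alpha> \<in> B" "\<alpha> \<bullet> w \<delta> > 0" using exists_pos_inner[OF w\<delta>] by blast
    have sw: "reflection \<alpha> (w \<delta>) \<in> roots" using w\<delta>(1) \<alpha>(1) B_roots roots_reflection by blast
    have "reflection \<alpha> (w \<delta>) \<bullet> base_point < w \<delta> \<bullet> base_point"
      using \<alpha> base_point(2) norm_B by (simp add: reflection_unit inner_diff_left)
    moreover have "reflection \<alpha> \<circ> w \<in> refl_word ` lists B"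
    proof -
      have "reflection \<alpha> \<circ> w = refl_word (\<alpha> # us)" "\<alpha> # us \<in> lists B" using us \<alpha>(1) by auto
      then show ?thesis by blast
    qed
    ultimately have "\<not> reflection \<alpha> (w \<delta>) \<bullet> base_point > 0"
      using w(2)[of "reflection \<alpha> \<circ> w"] unfolding S_def by (auto simp del: imageE)
    then have "reflection \<alpha> (w \<delta>) \<bullet> base_point < 0" using root_base_point[OF sw] by linarith
    then have eq: "w \<delta> = (\<alpha> \<bullet> w \<delta>) *\<^sub>R \<alpha>" using reflection_simple_neg \<alpha>(1) w\<delta> by blast
    have "reflection (w \<delta>) = reflection \<alpha>"
      using reflection_scaleR[of "\<alpha> \<bullet> w \<delta>" \<alpha>] \<alpha>(2) eq by simp
    then have "reflection \<alpha> (w x) = w (reflection \<delta> x)" for x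
      using reflection_conj[OF isometry_refl_word, of us \<delta> x]
      by (simp add: us(2))
    then have "refl_word (rev us) (reflection \<alpha> (refl_word us x)) = reflection \<delta> x" for x
      using refl_word_rev(1)[of us] us(2) by (metis comp_apply id_apply)
    then have "reflection \<delta> = refl_word (rev us @ [\<alpha>] @ us)"
      by (auto simp: refl_word_append fun_eq_iff)
    moreover have "rev us @ [\<alpha>] @ us \<in> lists B" using us \<alpha> by auto
    ultimately show ?thesis by blast
  qed
  show ?thesis
    using *[OF assms] *[OF roots_minus[OF assms]] root_base_point[OF assms]
    by (cases "\<delta> \<bullet> base_point > 0") auto
qed

lemma generated_by_simple: "G = refl_word ` lists B"
proof
  show "refl_word ` lists B \<subseteq> G" using refl_word_B by auto
  obtain U where U: "U \<subseteq> V - {0}" "G = refl_word ` lists U"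
    using refl_G by (rule refl_groupE)
  have "refl_word us \<in> refl_word ` lists B" if "us \<in> lists U" for us
    using that
  proof (induction us)
    case Nil
    then show ?case by blast
  next
    case (Cons u us)
    have "[u] \<in> lists U" using Cons.hyps by simp
    then have "refl_word [u] \<in> G" using U(2) by blast
    then have "reflection u \<in> G" by simp
    then have "u \<in> roots" using Cons.hyps(1) U(1) by (auto simp: roots_def)
    then obtain vs where vs: "vs \<in> lists B" "reflection u = refl_word vs"
      using reflection_by_simple by blast
    obtain ws where ws: "ws \<in> lists B" "refl_word us = refl_word ws" using Cons.IH by blast
    have "refl_word (u # us) = refl_word (vs @ ws)" "vs @ ws \<in> lists B"
      using vs ws by (auto simp: refl_word_append)
    then show ?case by blast
  qed
  then show "G \<subseteq> refl_word ` lists B" using U(2) by blast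
qed

text \<open>Since \<open>\<alpha>\<close> is positive and \<open>refl_word vs \<alpha>\<close> is
  negative, some letter of \<open>vs\<close> causes the change of sign. The root on which that
  letter acts is a multiple of it, so by conjugation this letter and the final
  \<open>\<alpha>\<close> cancel.\<close>

lemma exchange:
  assumes "vs \<in> lists B" "\<alpha> \<in> B" "refl_word vs \<alpha> \<bullet> base_point < 0"
  shows "\<exists>us\<in>lists B. length us < length vs \<and> refl_word us = refl_word (vs @ [\<alpha>])"
  using assms(1,3)
proof (induction vs)
  case Nil
  then show ?case using base_point(2)[OF assms(2)] by simp
next
  case (Cons \<beta> vs)
  let ?\<delta> = "refl_word vs \<alpha>"
  have \<delta>: "?\<delta> \<in> roots"
    using roots_image refl_word_B Cons.hyps assms(2) B_roots by blast
  show ?case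
  proof (cases "?\<delta> \<bullet> base_point < 0")
    case True
    then obtain us where us: "us\<in>lists B" "length us < length vs" "refl_word us = refl_word (vs @ [\<alpha>])"
      using Cons.IH by blast
    then have "\<beta> # us \<in> lists B" "length (\<beta> # us) < length (\<beta> # vs)"
      "refl_word (\<beta> # us) = refl_word ((\<beta> # vs) @ [\<alpha>])"
      using Cons.hyps by auto
    then show ?thesis by blast
  next
    case False
    then have pos: "?\<delta> \<bullet> base_point > 0" using root_base_point[OF \<delta>] by linarith
    have eq: "?\<delta> = (\<beta> \<bullet> ?\<delta>) *\<^sub>R \<beta>"
      using reflection_simple_neg[OF _ \<delta> pos] Cons by simp
    have "?\<delta> \<noteq> 0" using \<delta> by (simp add: roots_def)
    then have "\<beta> \<bullet> ?\<delta> \<noteq> 0" using eq by force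
    then have "reflection ?\<delta> = reflection \<beta>" using reflection_scaleR eq by metis
    then have "reflection \<beta> (refl_word vs (reflection \<alpha> x)) = refl_word vs x" for x
      using reflection_conj[OF isometry_refl_word, of vs \<alpha>]
      by (metis reflection_involution)
    then have "refl_word vs = refl_word ((\<beta> # vs) @ [\<alpha>])"
      by (auto simp: refl_word_append fun_eq_iff)
    moreover have "length vs < length (\<beta> # vs)" by simp
    ultimately show ?thesis using Cons.hyps by blast
  qed
qed

text \<open>
  Either the last letter changes \<open>y\<close> by a nonnegative multiple of a root which is positive on the
  chamber, or the exchange lemma shortens the word.
\<close>

lemma inner_word_le:
  assumes "us \<in> lists B" "x \<in> closed_chamber" "y \<in> closed_chamber"
  shows "x \<bullet> refl_word us y \<le> x \<bullet> y"
  using assms(1)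
proof (induction "length us" arbitrary: us rule: less_induct)
  case less
  show ?case
  proof (cases us rule: rev_cases)
    case Nil
    then show ?thesis by simp
  next
    case (snoc vs \<alpha>)
    then have vs: "vs \<in> lists B" "\<alpha> \<in> B" using less.prems by auto
    have r: "refl_word vs \<alpha> \<in> roots" using roots_image refl_word_B vs B_roots by blast
    show ?thesis
    proof (cases "refl_word vs \<alpha> \<bullet> base_point < 0")
      case True
      then obtain ws where ws: "ws \<in> lists B" "length ws < length vs" "refl_word ws = refl_word us"
        using exchange vs snoc by blast
      then show ?thesis using less.hyps[of ws] snoc by force
    next
      case False
      then have "refl_word vs \<alpha> \<bullet> base_point > 0" using root_base_point[OF r] by linarith
      then have pos: "refl_word vs \<alpha> \<bullet> x \<ge> 0" using root_sign r assms(2) by blast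
      have lin: "linear (refl_word vs)"
        by (simp add: orthogonal_transformation_linear isometry_refl_word)
      have "refl_word us y = refl_word vs (y - (2 * (\<alpha> \<bullet> y)) *\<^sub>R \<alpha>)"
        using snoc vs norm_B by (simp add: refl_word_append reflection_unit)
      also have "\<dots> = refl_word vs y - (2 * (\<alpha> \<bullet> y)) *\<^sub>R refl_word vs \<alpha>"
        by (simp add: linear_diff[OF lin] linear_scale[OF lin])
      finally have "x \<bullet> refl_word us y = x \<bullet> refl_word vs y - 2 * (\<alpha> \<bullet> y) * (refl_word vs \<alpha> \<bullet> x)"
        by (simp add: inner_diff_right inner_commute)
      moreover have "\<alpha> \<bullet> y \<ge> 0" using assms(3) vs(2) by (simp add: closed_chamber_def)
      moreover have "x \<bullet> refl_word vs y \<le> x \<bullet> y" using less.hyps[of vs] snoc vs by simp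
      ultimately show ?thesis using pos by (smt (verit) mult_nonneg_nonneg)
    qed
  qed
qed

lemma inner_group_le:
  "g \<in> G \<Longrightarrow> x \<in> closed_chamber \<Longrightarrow> y \<in> closed_chamber \<Longrightarrow> x \<bullet> g y \<le> x \<bullet> y"
  using generated_by_simple inner_word_le by blast

text \<open>The orbit point with the largest inner product with \<open>base_point\<close> works: no
  simple reflection can increase that product.\<close>

lemma orbit_meets_chamber:
  assumes "y \<in> V"
  shows "\<exists>g\<in>G. g y \<in> closed_chamber"
proof -
  let ?M = "Max ((\<lambda>h. h y \<bullet> base_point) ` G)"
  have "?M \<in> (\<lambda>h. h y \<bullet> base_point) ` G"
    using refl_group_id[OF refl_G] finite_G by (intro Max_in) auto
  then obtain g where "g \<in> G" "?M = g y \<bullet> base_point" by blast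
  then have g: "g \<in> G" "\<And>h. h \<in> G \<Longrightarrow> h y \<bullet> base_point \<le> g y \<bullet> base_point"
    using finite_G by (metis (no_types, lifting) Max_ge finite_imageI imageI)+
  have "\<alpha> \<bullet> g y \<ge> 0" if \<alpha>: "\<alpha> \<in> B" for \<alpha>
  proof -
    have "reflection \<alpha> \<circ> g \<in> G" using refl_group_comp[OF refl_G] reflection_B \<alpha> g(1) by blast
    then have "reflection \<alpha> (g y) \<bullet> base_point \<le> g y \<bullet> base_point" using g(2) by force
    then have "(\<alpha> \<bullet> g y) * (\<alpha> \<bullet> base_point) \<ge> 0"
      using norm_B[OF \<alpha>] by (simp add: reflection_unit inner_diff_left)
    then show ?thesis using base_point(2)[OF \<alpha>] by (simp add: zero_le_mult_iff)
  qed
  then have "g y \<in> closed_chamber"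
    using refl_group_invariant[OF refl_G subspace_V g(1) assms] by (simp add: closed_chamber_def)
  then show ?thesis using g(1) by blast
qed

end

section \<open>Max filter banks on the chamber\<close>

lemma finite_orbit: "finite G \<Longrightarrow> finite (orbit_of G x)"
  by (simp add: orbit_of_def)

lemma orbit_of_apply:
  assumes "reflection_group V G" "g \<in> G"
  shows "orbit_of G (g x) = orbit_of G x"
proof -
  obtain h where h: "h \<in> G" "h \<circ> g = id" "g \<circ> h = id"
    using refl_group_inverse[OF assms] .
  have "f (g x) \<in> orbit_of G x" if "f \<in> G" for f
    using refl_group_comp[OF assms(1) that assms(2)] unfolding orbit_of_def
    by (metis comp_apply imageI)
  moreover have "f x \<in> orbit_of G (g x)" if "f \<in> G" for f
  proof -
    have "f x = (f \<circ> h) (g x)" using h(2) by (metis comp_apply id_apply)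
    then show ?thesis
      using refl_group_comp[OF assms(1) that h(1)] unfolding orbit_of_def by blast
  qed
  ultimately show ?thesis unfolding orbit_of_def by blast
qed

lemma inner_sum_scaleR:
  fixes f g :: "'b::real_inner \<Rightarrow> real"
  shows "(\<Sum>\<alpha>\<in>S. f \<alpha> *\<^sub>R \<alpha>) \<bullet> (\<Sum>\<beta>\<in>T. g \<beta> *\<^sub>R \<beta>) = (\<Sum>\<alpha>\<in>S. \<Sum>\<beta>\<in>T. f \<alpha> * g \<beta> * (\<alpha> \<bullet> \<beta>))"
  by (subst inner_sum_left) (simp add: inner_sum_right sum_distrib_left ac_simps)

lemma self_in_orbit: "reflection_group V G \<Longrightarrow> x \<in> orbit_of G x"
  using refl_group_id unfolding orbit_of_def by (metis id_apply imageI)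

text \<open>Membership in the span pins the dual vectors down even if \<open>B\<close> spans only a
  proper subspace.\<close>

abbreviation dual_basis :: "'a::real_inner set \<Rightarrow> ('a \<Rightarrow> 'a) \<Rightarrow> bool" where
  "dual_basis B \<omega> \<equiv>
     \<forall>\<alpha>\<in>B. \<omega> \<alpha> \<in> span B \<and> (\<forall>\<beta>\<in>B. \<omega> \<alpha> \<bullet> \<beta> = (if \<alpha> = \<beta> then 1 else 0))"

context simple_refl
begin

lemma orbit_rep:
  assumes "x \<in> V"
  obtains y where "y \<in> closed_chamber" "orbit_of G y = orbit_of G x"
  using orbit_meets_chamber[OF assms] orbit_of_apply[OF refl_G] by metis

lemma inner_orbits_le:
  assumes "x \<in> closed_chamber" "y \<in> closed_chamber" "p \<in> orbit_of G x" "q \<in> orbit_of G y"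
  shows "p \<bullet> q \<le> x \<bullet> y"
proof -
  obtain g h where gh: "g \<in> G" "h \<in> G" "p = g x" "q = h y" using assms by (auto simp: orbit_of_def)
  obtain f where f: "f \<in> G" "\<And>x y. g x \<bullet> y = x \<bullet> f y"
    using refl_group_inner_inverse[OF refl_G gh(1)] by blast
  have "p \<bullet> q = x \<bullet> (f \<circ> h) y" using gh f by simp
  also have "\<dots> \<le> x \<bullet> y"
    using refl_group_comp[OF refl_G f(1) gh(2)] assms inner_group_le by blast
  finally show ?thesis .
qed

lemma max_filter_chamber:
  assumes "x \<in> closed_chamber" "y \<in> closed_chamber"
  shows "max_filter (orbit_of G x) (orbit_of G y) = x \<bullet> y"
  unfolding max_filter_def
proof (rule Max_eqI)
  show "finite ((\<lambda>(p, q). p \<bullet> q) ` (orbit_of G x \<times> orbit_of G y))"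
    using finite_orbit[OF finite_G] by blast
  show "x \<bullet> y \<in> (\<lambda>(p, q). p \<bullet> q) ` (orbit_of G x \<times> orbit_of G y)"
    using self_in_orbit[OF refl_G] by force
qed (use inner_orbits_le assms in auto)

text \<open>Norms are constant on orbits, so the distance is smallest where the inner product is
  largest.\<close>

lemma orbit_dist_chamber:
  assumes "x \<in> closed_chamber" "y \<in> closed_chamber"
  shows "orbit_dist (orbit_of G x) (orbit_of G y) = norm (x - y)"
  unfolding orbit_dist_def
proof (rule Min_eqI)
  show "finite ((\<lambda>(p, q). norm (p - q)) ` (orbit_of G x \<times> orbit_of G y))"
    using finite_orbit[OF finite_G] by blast
  show "norm (x - y) \<in> (\<lambda>(p, q). norm (p - q)) ` (orbit_of G x \<times> orbit_of G y)"
    using self_in_orbit[OF refl_G] by force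
  fix r assume "r \<in> (\<lambda>(p, q). norm (p - q)) ` (orbit_of G x \<times> orbit_of G y)"
  then obtain p q where pq: "p \<in> orbit_of G x" "q \<in> orbit_of G y" "r = norm (p - q)" by auto
  have "p \<bullet> p = x \<bullet> x" "q \<bullet> q = y \<bullet> y"
    using pq refl_group_inner[OF refl_G] by (auto simp: orbit_of_def)
  moreover have "p \<bullet> q \<le> x \<bullet> y" using inner_orbits_le assms pq by blast
  ultimately have "(x - y) \<bullet> (x - y) \<le> (p - q) \<bullet> (p - q)"
    by (simp add: inner_diff_left inner_diff_right inner_commute)
  then show "norm (x - y) \<le> r" by (simp add: pq(3) norm_le)
qed

text \<open>Equal orbits have orbit distance 0, which is the distance of the two
  representatives.\<close>

lemma chamber_rep_unique:
  assumes "x \<in> closed_chamber" "y \<in> closed_chamber" "orbit_of G x = orbit_of G y"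
  shows "x = y"
  using orbit_dist_chamber[of x y] orbit_dist_chamber[of y y] assms by simp

definition chamber_rep :: "'a \<Rightarrow> 'a" where
  "chamber_rep t = (SOME y. y \<in> closed_chamber \<and> orbit_of G y = orbit_of G t)"

lemma chamber_rep:
  assumes "t \<in> V"
  shows "chamber_rep t \<in> closed_chamber" "orbit_of G (chamber_rep t) = orbit_of G t"
proof -
  have "\<exists>y. y \<in> closed_chamber \<and> orbit_of G y = orbit_of G t"
    using orbit_rep[OF assms] by blast
  from someI_ex[OF this]
  show "chamber_rep t \<in> closed_chamber" "orbit_of G (chamber_rep t) = orbit_of G t"
    unfolding chamber_rep_def by auto
qed

lemma chamber_rep_eq: "t \<in> closed_chamber \<Longrightarrow> chamber_rep t = t"
  using chamber_rep chamber_rep_unique by (simp add: closed_chamber_def)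

definition bank_norm :: "'a list \<Rightarrow> 'a \<Rightarrow> real" where
  "bank_norm ts z = L2_set (\<lambda>i. chamber_rep (ts ! i) \<bullet> z) {..<length ts}"

lemma bank_dist_chamber:
  assumes "set ts \<subseteq> V" "x \<in> closed_chamber" "y \<in> closed_chamber"
  shows "bank_dist G ts (orbit_of G x) (orbit_of G y) = bank_norm ts (x - y)"
  unfolding bank_dist_def bank_norm_def
proof (rule L2_set_cong)
  fix i assume "i \<in> {..<length ts}"
  then have i: "ts ! i \<in> V" using assms(1) by auto
  have "max_filter_bank G ts (orbit_of G z) i = chamber_rep (ts ! i) \<bullet> z" if "z \<in> closed_chamber" for z
    unfolding max_filter_bank_def
    using max_filter_chamber[OF chamber_rep(1)[OF i] that] chamber_rep(2)[OF i] by simp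
  then show "max_filter_bank G ts (orbit_of G x) i - max_filter_bank G ts (orbit_of G y) i
      = chamber_rep (ts ! i) \<bullet> (x - y)"
    using assms by (simp add: inner_diff_right)
qed simp

text \<open>Since the chamber has an interior point, a large multiple of it absorbs any
  \<open>z\<close>. This turns Lipschitz conditions on pairs of orbits into conditions on all
  vectors of \<open>V\<close>.\<close>

lemma chamber_difference:
  assumes "z \<in> V"
  obtains x y where "x \<in> closed_chamber" "y \<in> closed_chamber" "z = x - y"
proof -
  obtain e where e: "e > 0" "\<forall>\<alpha>\<in>B. \<alpha> \<bullet> base_point + e * (\<alpha> \<bullet> z) > 0"
    using pos_perturbation[of B "\<lambda>\<alpha>. \<alpha> \<bullet> base_point" "\<lambda>\<alpha>. \<alpha> \<bullet> z"] finite_B base_point(2) by auto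
  let ?y = "(1 / e) *\<^sub>R base_point"
  have "\<alpha> \<bullet> (?y + z) \<ge> 0" if "\<alpha> \<in> B" for \<alpha>
  proof -
    have "\<alpha> \<bullet> (?y + z) = (\<alpha> \<bullet> base_point + e * (\<alpha> \<bullet> z)) / e"
      using e(1) by (simp add: inner_add_right field_simps)
    then show ?thesis using e that by (simp add: less_imp_le)
  qed
  then have "?y + z \<in> closed_chamber"
    using assms base_point(1) subspace_V by (simp add: closed_chamber_def subspace_add subspace_scale)
  moreover have "?y \<in> closed_chamber"
    using base_point subspace_V e(1) by (simp add: closed_chamber_def subspace_scale less_imp_le)
  ultimately show ?thesis using that[of "?y + z" ?y] by simp
qed

text \<open>The relation \<open>R\<close> is left open so that the upper and the lower Lipschitz
  condition are two instances.\<close>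

lemma bank_bound_iff:
  assumes "set ts \<subseteq> V"
  shows "(\<forall>P\<in>orbit_space V G. \<forall>Q\<in>orbit_space V G. R (bank_dist G ts P Q) (orbit_dist P Q))
    \<longleftrightarrow> (\<forall>z\<in>V. R (bank_norm ts z) (norm z))"
proof (intro iffI ballI)
  fix z assume *: "\<forall>P\<in>orbit_space V G. \<forall>Q\<in>orbit_space V G. R (bank_dist G ts P Q) (orbit_dist P Q)"
    and "z \<in> V"
  obtain x y where xy: "x \<in> closed_chamber" "y \<in> closed_chamber" "z = x - y"
    using chamber_difference[OF \<open>z \<in> V\<close>] .
  then have "orbit_of G x \<in> orbit_space V G" "orbit_of G y \<in> orbit_space V G"
    by (auto simp: orbit_space_def closed_chamber_def)
  then show "R (bank_norm ts z) (norm z)"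
    using * bank_dist_chamber[OF assms xy(1,2)] orbit_dist_chamber[OF xy(1,2)] xy(3) by metis
next
  fix P Q assume *: "\<forall>z\<in>V. R (bank_norm ts z) (norm z)"
    and PQ: "P \<in> orbit_space V G" "Q \<in> orbit_space V G"
  obtain p q where "p \<in> V" "P = orbit_of G p" "q \<in> V" "Q = orbit_of G q"
    using PQ by (auto simp: orbit_space_def)
  then obtain x y where xy: "x \<in> closed_chamber" "y \<in> closed_chamber"
    "P = orbit_of G x" "Q = orbit_of G y"
    using orbit_rep by metis
  have "x - y \<in> V" using xy subspace_V by (auto simp: closed_chamber_def subspace_diff)
  then show "R (bank_dist G ts P Q) (orbit_dist P Q)"
    using * bank_dist_chamber[OF assms xy(1,2)] orbit_dist_chamber[OF xy(1,2)] xy(3,4) by metis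
qed

lemma upper_lipschitz_bound_iff:
  assumes "set ts \<subseteq> V"
  shows "upper_lipschitz_bound V G ts C \<longleftrightarrow> C > 0 \<and> (\<forall>z\<in>V. bank_norm ts z \<le> C * norm z)"
  unfolding upper_lipschitz_bound_def
  using bank_bound_iff[OF assms, of "\<lambda>a b. a \<le> C * b"] by simp

lemma lower_lipschitz_bound_iff:
  assumes "set ts \<subseteq> V"
  shows "lower_lipschitz_bound V G ts c \<longleftrightarrow> c > 0 \<and> (\<forall>z\<in>V. c * norm z \<le> bank_norm ts z)"
  unfolding lower_lipschitz_bound_def
  using bank_bound_iff[OF assms, of "\<lambda>a b. c * b \<le> a"] by simp

text \<open>With fewer templates, some nonzero vector of \<open>V\<close> is orthogonal to all
  chamber representatives and is invisible to the bank.\<close>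

lemma length_ge_dim:
  assumes "set ts \<subseteq> V" "lower_lipschitz_bound V G ts c"
  shows "dim V \<le> length ts"
proof (rule ccontr)
  assume less: "\<not> dim V \<le> length ts"
  let ?S = "(\<lambda>i. chamber_rep (ts ! i)) ` {..<length ts}"
  have SV: "?S \<subseteq> V"
    using chamber_rep(1) assms(1) by (force simp: closed_chamber_def)
  have "dim ?S \<le> length ts"
    using dim_le_card'[of ?S] card_image_le[of "{..<length ts}" "\<lambda>i. chamber_rep (ts ! i)"] by simp
  then have "span ?S \<noteq> span V" using less by (metis dim_span)
  then have "span ?S \<subset> span V" using span_mono[OF SV] by blast
  then obtain z where z: "z \<noteq> 0" "z \<in> span V" "\<And>y. y \<in> span ?S \<Longrightarrow> orthogonal z y"
    using orthogonal_to_subspace_exists_gen by metis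
  have "chamber_rep (ts ! i) \<bullet> z = 0" if "i < length ts" for i
    using z(3)[of "chamber_rep (ts ! i)"] that
    by (simp add: Linear_Algebra.orthogonal_def inner_commute span_base)
  then have "bank_norm ts z = 0" by (simp add: bank_norm_def L2_set_def)
  moreover have "c * norm z \<le> bank_norm ts z" "c > 0"
    using assms z(2) lower_lipschitz_bound_iff subspace_V by (auto simp: span_eq_iff[THEN iffD2])
  ultimately show False using z(1) by (simp add: mult_le_0_iff)
qed

section \<open>Linear independence of the simple roots and the dual basis\<close>

lemma simple_inner_le_0: "\<alpha> \<in> B \<Longrightarrow> \<beta> \<in> B \<Longrightarrow> \<alpha> \<noteq> \<beta> \<Longrightarrow> \<alpha> \<bullet> \<beta> \<le> 0"
  using simple_inner by fastforce

text \<open>Splitting a dependence into positive and negative coefficients represents one vector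
  \<open>x\<close> in two ways. Then \<open>x \<bullet> x\<close> is a sum of nonpositive terms, the
  diagonal ones vanishing because a coefficient is never in both parts; so \<open>x = 0\<close>.
  Pairing with \<open>base_point\<close> then annihilates the nonnegative coefficients.\<close>

lemma independent_B: "independent B"
proof -
  have "v \<alpha> = 0" if sum0: "(\<Sum>\<alpha>\<in>B. v \<alpha> *\<^sub>R \<alpha>) = 0" and \<alpha>: "\<alpha> \<in> B" for v \<alpha>
  proof -
    define P N where "P \<alpha> = max (v \<alpha>) 0" and "N \<alpha> = max (- v \<alpha>) 0" for \<alpha>
    define x where "x = (\<Sum>\<alpha>\<in>B. P \<alpha> *\<^sub>R \<alpha>)"
    have "v \<alpha> = P \<alpha> - N \<alpha>" for \<alpha> by (simp add: P_def N_def max_def)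
    then have x': "x = (\<Sum>\<alpha>\<in>B. N \<alpha> *\<^sub>R \<alpha>)"
      using sum0 by (simp add: x_def scaleR_diff_left sum_subtractf)
    have "x \<bullet> x = (\<Sum>\<alpha>\<in>B. \<Sum>\<beta>\<in>B. P \<alpha> * N \<beta> * (\<alpha> \<bullet> \<beta>))"
      by (subst (2) x') (simp only: x_def inner_sum_scaleR)
    also have "\<dots> \<le> 0"
    proof (intro sum_nonpos)
      fix \<alpha> \<beta> assume "\<alpha> \<in> B" "\<beta> \<in> B"
      show "P \<alpha> * N \<beta> * (\<alpha> \<bullet> \<beta>) \<le> 0"
      proof (cases "\<alpha> = \<beta>")
        case True
        then show ?thesis by (simp add: P_def N_def max_def)
      next
        case False
        moreover have "P \<alpha> * N \<beta> \<ge> 0" by (simp add: P_def N_def)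
        ultimately show ?thesis
          using simple_inner_le_0 \<open>\<alpha> \<in> B\<close> \<open>\<beta> \<in> B\<close> mult_nonneg_nonpos by blast
      qed
    qed
    finally have "x = 0" using inner_gt_zero_iff[of x] by (simp add: not_less[symmetric])
    have *: "F \<alpha> = 0" if F: "\<And>\<alpha>. F \<alpha> \<ge> 0" "x = (\<Sum>\<alpha>\<in>B. F \<alpha> *\<^sub>R \<alpha>)" for F
    proof -
      have "(\<Sum>\<alpha>\<in>B. F \<alpha> * (\<alpha> \<bullet> base_point)) = x \<bullet> base_point"
        by (simp add: F(2) inner_sum_left)
      then have "(\<Sum>\<alpha>\<in>B. F \<alpha> * (\<alpha> \<bullet> base_point)) = 0" using \<open>x = 0\<close> by simp
      then have "F \<alpha> * (\<alpha> \<bullet> base_point) = 0"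
        using sum_nonneg_eq_0_iff[OF finite_B, of "\<lambda>\<alpha>. F \<alpha> * (\<alpha> \<bullet> base_point)"]
          F(1) base_point(2) \<alpha> by (auto simp: less_imp_le)
      then show ?thesis using base_point(2)[OF \<alpha>] by simp
    qed
    have "P \<alpha> = 0" by (rule *) (auto simp: P_def x_def)
    moreover have "N \<alpha> = 0" by (rule *) (auto simp: N_def x')
    ultimately show "v \<alpha> = 0" by (simp add: \<open>\<And>\<alpha>. v \<alpha> = P \<alpha> - N \<alpha>\<close>)
  qed
  then show ?thesis using dependent_finite[OF finite_B] by blast
qed

lemma exists_dual_basis: "\<exists>\<omega>. dual_basis B \<omega>"
proof (rule bchoice, rule ballI)
  fix \<alpha> assume "\<alpha> \<in> B"
  obtain f :: "'a \<Rightarrow> real" where f: "linear f" "\<And>\<beta>. \<beta> \<in> B \<Longrightarrow> f \<beta> = (if \<alpha> = \<beta> then 1 else 0)"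
    using linear_independent_extend[OF independent_B, of "\<lambda>\<beta>. if \<alpha> = \<beta> then 1 else 0"] by auto
  \<comment> \<open>\<open>adjoint f 1\<close> represents the functional \<open>f\<close> as an
    inner product; its projection to the span of \<open>B\<close> has the same products with
    \<open>B\<close>.\<close>
  obtain y z where yz: "y \<in> span B" "\<And>w. w \<in> span B \<Longrightarrow> orthogonal z w" "adjoint f 1 = y + z"
    using orthogonal_subspace_decomp_exists[of B "adjoint f 1"] by metis
  have "y \<bullet> \<beta> = (if \<alpha> = \<beta> then 1 else 0)" if "\<beta> \<in> B" for \<beta>
  proof -
    have "y \<bullet> \<beta> = adjoint f 1 \<bullet> \<beta>"
      using yz(2)[of \<beta>] yz(3) that by (simp add: inner_add_left Linear_Algebra.orthogonal_def span_base)
    also have "\<dots> = f \<beta>" using adjoint_works[OF f(1), of \<beta> 1] by (simp add: inner_commute)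
    finally show ?thesis using f(2) that by simp
  qed
  then show "\<exists>w. w \<in> span B \<and> (\<forall>\<beta>\<in>B. w \<bullet> \<beta> = (if \<alpha> = \<beta> then 1 else 0))" using yz(1) by blast
qed

end

section \<open>The Gram matrix of a simple system\<close>

abbreviation lin_comb :: "('a::real_vector \<Rightarrow> real) \<Rightarrow> 'a set \<Rightarrow> 'a" where
  "lin_comb v B \<equiv> (\<Sum>\<alpha>\<in>B. v \<alpha> *\<^sub>R \<alpha>)"

text \<open>
  Some vector has at most one non-orthogonal partner because the squared norm of the sum of all
  vectors is positive. Hence the Coxeter graph is a forest, and it can be coloured recursively.
\<close>

lemma two_colouring:
  fixes B :: "'a::euclidean_space set"
  assumes "finite B" "independent B" "\<And>\<alpha>. \<alpha> \<in> B \<Longrightarrow> norm \<alpha> = 1"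
    and "\<And>\<alpha> \<beta>. \<alpha> \<in> B \<Longrightarrow> \<beta> \<in> B \<Longrightarrow> \<alpha> \<noteq> \<beta> \<Longrightarrow> \<alpha> \<bullet> \<beta> = 0 \<or> \<alpha> \<bullet> \<beta> \<le> - 1 / 2"
  shows "\<exists>\<epsilon>::'a \<Rightarrow> real. (\<forall>\<alpha>. \<epsilon> \<alpha> = 1 \<or> \<epsilon> \<alpha> = - 1) \<and>
    (\<forall>\<alpha>\<in>B. \<forall>\<beta>\<in>B. \<alpha> \<noteq> \<beta> \<longrightarrow> \<alpha> \<bullet> \<beta> \<noteq> 0 \<longrightarrow> \<epsilon> \<alpha> = - \<epsilon> \<beta>)"
  using assms
proof (induction "card B" arbitrary: B)
  case 0
  then show ?case by (auto intro: exI[of _ "\<lambda>_. 1"])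
next
  case (Suc n)
  then have "B \<noteq> {}" by auto
  have "(\<Sum>\<alpha>\<in>B. \<alpha>) \<noteq> 0"
  proof
    assume "(\<Sum>\<alpha>\<in>B. \<alpha>) = 0"
    then have "(\<exists>\<alpha>\<in>B. (1::real) \<noteq> 0) \<and> (\<Sum>\<alpha>\<in>B. 1 *\<^sub>R \<alpha>) = 0" using \<open>B \<noteq> {}\<close> by auto
    then have "dependent B" unfolding dependent_finite[OF Suc.prems(1)] by (rule exI[of _ "\<lambda>_. 1"])
    then show False using Suc.prems(2) by simp
  qed
  then have "0 < (\<Sum>\<alpha>\<in>B. \<alpha>) \<bullet> (\<Sum>\<alpha>\<in>B. \<alpha>)" by simp
  also have "\<dots> = (\<Sum>\<alpha>\<in>B. \<Sum>\<beta>\<in>B. \<alpha> \<bullet> \<beta>)"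
    by (subst inner_sum_left) (simp add: inner_sum_right)
  finally obtain \<alpha> where \<alpha>: "\<alpha> \<in> B" "(\<Sum>\<beta>\<in>B. \<alpha> \<bullet> \<beta>) > 0"
    by (meson not_less sum_nonpos)
  let ?N = "{\<beta>\<in>B - {\<alpha>}. \<alpha> \<bullet> \<beta> \<noteq> 0}"
  have fin: "finite ?N" using Suc.prems(1) by simp
  have "(\<Sum>\<beta>\<in>B. \<alpha> \<bullet> \<beta>) = 1 + (\<Sum>\<beta>\<in>B - {\<alpha>}. \<alpha> \<bullet> \<beta>)"
    using \<alpha>(1) Suc.prems(1,3) by (simp add: sum.remove norm_eq_1)
  also have "(\<Sum>\<beta>\<in>B - {\<alpha>}. \<alpha> \<bullet> \<beta>) = (\<Sum>\<beta>\<in>?N. \<alpha> \<bullet> \<beta>)"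
    using Suc.prems(1) by (intro sum.mono_neutral_right) auto
  \<comment> \<open>Each neighbour lowers the sum, which starts at 1, by at least 1/2. As it stays
    positive, there are fewer than two neighbours.\<close>
  also have "\<dots> \<le> (\<Sum>\<beta>\<in>?N. - 1 / 2)"
    using Suc.prems(4)[OF \<alpha>(1)] by (intro sum_mono) force
  finally have "card ?N < 2" using \<alpha>(2) by simp
  then have "card ?N = 0 \<or> card ?N = 1" by linarith
  then have N_cases: "?N = {} \<or> (\<exists>\<beta>. ?N = {\<beta>})"
  proof (elim disjE)
    assume "card ?N = 0"
    then show ?thesis unfolding card_0_eq[OF fin] by (rule disjI1)
  next
    assume "card ?N = 1"
    then show ?thesis by (rule card_1_singletonE) (rule disjI2, rule exI)
  qed
  have "n = card (B - {\<alpha>})" using Suc.hyps(2) \<alpha>(1) Suc.prems(1) by simp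
  then obtain \<epsilon> :: "'a \<Rightarrow> real" where \<epsilon>: "\<forall>\<alpha>. \<epsilon> \<alpha> = 1 \<or> \<epsilon> \<alpha> = - 1"
    "\<forall>\<gamma>\<in>B - {\<alpha>}. \<forall>\<beta>\<in>B - {\<alpha>}. \<gamma> \<noteq> \<beta> \<longrightarrow> \<gamma> \<bullet> \<beta> \<noteq> 0 \<longrightarrow> \<epsilon> \<gamma> = - \<epsilon> \<beta>"
    using Suc.hyps(1)[of "B - {\<alpha>}"] Suc.prems independent_mono[of B "B - {\<alpha>}"] by auto
  have "\<exists>s. (s = 1 \<or> s = - 1) \<and> (\<forall>\<beta>\<in>?N. s = - \<epsilon> \<beta>)"
    using N_cases
  proof (elim disjE exE)
    assume N: "?N = {}"
    show ?thesis unfolding N by blast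
  next
    fix \<beta> assume N: "?N = {\<beta>}"
    have "- \<epsilon> \<beta> = 1 \<or> - \<epsilon> \<beta> = - 1" using \<epsilon>(1)[rule_format, of \<beta>] by linarith
    then show ?thesis unfolding N by (intro exI[of _ "- \<epsilon> \<beta>"]) simp
  qed
  then obtain s where s: "s = 1 \<or> s = - 1" "\<And>\<beta>. \<beta> \<in> ?N \<Longrightarrow> s = - \<epsilon> \<beta>" by blast
  show ?case
  proof (intro exI[of _ "\<epsilon>(\<alpha> := s)"] conjI allI ballI impI)
    fix \<beta> show "(\<epsilon>(\<alpha> := s)) \<beta> = 1 \<or> (\<epsilon>(\<alpha> := s)) \<beta> = - 1" using \<epsilon>(1) s(1) by simp
  next
    fix \<beta> \<gamma> assume *: "\<beta> \<in> B" "\<gamma> \<in> B" "\<beta> \<noteq> \<gamma>" "\<beta> \<bullet> \<gamma> \<noteq> 0"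
    consider "\<beta> = \<alpha>" | "\<gamma> = \<alpha>" | "\<beta> \<noteq> \<alpha>" "\<gamma> \<noteq> \<alpha>" by blast
    then show "(\<epsilon>(\<alpha> := s)) \<beta> = - (\<epsilon>(\<alpha> := s)) \<gamma>"
    proof cases
      case 1
      then show ?thesis using s(2)[of \<gamma>] * by auto
    next
      case 2
      then show ?thesis using s(2)[of \<beta>] * by (auto simp: inner_commute)
    next
      case 3
      then show ?thesis using \<epsilon>(2) * by auto
    qed
  qed
qed

text \<open>
  The largest eigenvalue of the identity minus the Gram matrix of \<open>B\<close> if \<open>B\<close> is a nonempty simple
  system; it is \<open>0\<close> for \<open>B = {}\<close>.
\<close>

definition coupling :: "'a::euclidean_space set \<Rightarrow> real" where
  "coupling B = Sup (insert 0 {1 - (norm (lin_comb v B))\<^sup>2 |v. (\<Sum>\<alpha>\<in>B. (v \<alpha>)\<^sup>2) = 1})"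

lemma coupling_bdd: "bdd_above (insert 0 {1 - (norm (lin_comb v B))\<^sup>2 |v. (\<Sum>\<alpha>\<in>B. (v \<alpha>)\<^sup>2) = 1})"
  by (rule bdd_aboveI[of _ 1]) auto

lemma coupling_nonneg: "coupling B \<ge> 0"
  unfolding coupling_def by (intro cSup_upper coupling_bdd) simp

lemma coupling_le:
  assumes "r \<ge> 0" "\<And>v. (\<Sum>\<alpha>\<in>B. (v \<alpha>)\<^sup>2) = 1 \<Longrightarrow> 1 - (norm (lin_comb v B))\<^sup>2 \<le> r"
  shows "coupling B \<le> r"
  unfolding coupling_def using assms by (intro cSup_least) auto

lemma gram_lower_bound:
  assumes "finite B"
  shows "(1 - coupling B) * (\<Sum>\<alpha>\<in>B. (v \<alpha>)\<^sup>2) \<le> (norm (lin_comb v B))\<^sup>2"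
proof -
  define s where "s = sqrt (\<Sum>\<alpha>\<in>B. (v \<alpha>)\<^sup>2)"
  have s2: "s\<^sup>2 = (\<Sum>\<alpha>\<in>B. (v \<alpha>)\<^sup>2)" by (simp add: s_def sum_nonneg)
  show ?thesis
  proof (cases "s = 0")
    case True
    then show ?thesis using s2 by simp
  next
    case False
    define w where "w \<alpha> = v \<alpha> / s" for \<alpha>
    have "(\<Sum>\<alpha>\<in>B. (w \<alpha>)\<^sup>2) = 1"
      using False by (simp add: w_def power_divide s2[symmetric] flip: sum_divide_distrib)
    then have "1 - (norm (lin_comb w B))\<^sup>2 \<le> coupling B"
      unfolding coupling_def by (intro cSup_upper coupling_bdd) auto
    then have "(1 - coupling B) * s\<^sup>2 \<le> (norm (lin_comb w B))\<^sup>2 * s\<^sup>2"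
      by (intro mult_right_mono) auto
    also have "\<dots> = (norm (s *\<^sub>R (lin_comb w B)))\<^sup>2" by (simp add: power_mult_distrib)
    also have "s *\<^sub>R (lin_comb w B) = (lin_comb v B)"
      using False by (simp add: scaleR_sum_right w_def)
    finally show ?thesis by (simp add: s2)
  qed
qed

definition coupling_cond :: "'a::euclidean_space set \<Rightarrow> real" where
  "coupling_cond B = sqrt (1 + coupling B) / sqrt (1 - coupling B)"

lemma norm_sum_scaleR_sq:
  "(norm (lin_comb v B))\<^sup>2 = (\<Sum>\<alpha>\<in>B. \<Sum>\<beta>\<in>B. v \<alpha> * v \<beta> * (\<alpha> \<bullet> \<beta>))"
  by (simp only: power2_norm_eq_inner inner_sum_scaleR)

context simple_refl
begin

lemma sum_dual_basis:
  assumes "\<forall>\<alpha>\<in>B. \<forall>\<beta>\<in>B. \<omega> \<alpha> \<bullet> \<beta> = (if \<alpha> = \<beta> then 1 else 0)" "\<alpha> \<in> B"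
  shows "\<omega> \<alpha> \<bullet> lin_comb v B = v \<alpha>"
proof -
  have "\<omega> \<alpha> \<bullet> lin_comb v B = (\<Sum>\<beta>\<in>B. if \<beta> = \<alpha> then v \<beta> else 0)"
    unfolding inner_sum_right using assms by (intro sum.cong) auto
  then show ?thesis using assms(2) finite_B by simp
qed

text \<open>\<open>coupling\<close> is a supremum, so a uniform margin is needed. The dual basis
  recovers the coefficients from the combination, and Cauchy-Schwarz bounds them by its
  norm.\<close>

lemma coupling_less_1: "coupling B < 1"
proof -
  obtain \<omega> where \<omega>: "dual_basis B \<omega>"
    using exists_dual_basis by blast
  define K where "K = (\<Sum>\<alpha>\<in>B. (norm (\<omega> \<alpha>))\<^sup>2)"
  have K: "K \<ge> 0" by (simp add: K_def sum_nonneg)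
  \<comment> \<open>With \<open>1 + K\<close> instead of \<open>K\<close> the denominator is
    positive even for empty \<open>B\<close>, and the bound is nonnegative, as
    \<open>coupling_le\<close> demands.\<close>
  have "coupling B \<le> 1 - 1 / (1 + K)"
  proof (rule coupling_le)
    show "0 \<le> 1 - 1 / (1 + K)" using K by simp
    fix v :: "'a \<Rightarrow> real" assume 1: "(\<Sum>\<alpha>\<in>B. (v \<alpha>)\<^sup>2) = 1"
    let ?x = "\<Sum>\<alpha>\<in>B. v \<alpha> *\<^sub>R \<alpha>"
    have "1 = (\<Sum>\<alpha>\<in>B. (\<omega> \<alpha> \<bullet> ?x)\<^sup>2)" using 1 sum_dual_basis \<omega> by simp
    also have "\<dots> \<le> (\<Sum>\<alpha>\<in>B. (norm (\<omega> \<alpha>))\<^sup>2 * (norm ?x)\<^sup>2)"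
    proof (rule sum_mono)
      fix \<alpha>
      show "(\<omega> \<alpha> \<bullet> ?x)\<^sup>2 \<le> (norm (\<omega> \<alpha>))\<^sup>2 * (norm ?x)\<^sup>2"
        using Cauchy_Schwarz_ineq[of "\<omega> \<alpha>" ?x] by (simp add: power2_norm_eq_inner)
    qed
    also have "\<dots> = K * (norm ?x)\<^sup>2" by (simp add: K_def sum_distrib_right)
    also have "\<dots> \<le> (1 + K) * (norm ?x)\<^sup>2" by (simp add: mult_right_mono)
    finally have "1 / (1 + K) \<le> (norm ?x)\<^sup>2" using K by (simp add: field_simps)
    then show "1 - (norm ?x)\<^sup>2 \<le> 1 - 1 / (1 + K)" by simp
  qed
  then show ?thesis using K by (smt (verit) divide_pos_pos)
qed

text \<open>
  Flipping signs according to a colouring of the Coxeter graph reverses the off-diagonal part of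
  the Gram matrix, so its spectrum is symmetric about \<open>1\<close>.
\<close>

lemma exists_signs:
  "\<exists>\<epsilon>::'a \<Rightarrow> real. (\<forall>\<alpha>. \<bar>\<epsilon> \<alpha>\<bar> = 1) \<and>
    (\<forall>v. (norm (lin_comb v B))\<^sup>2 + (norm (lin_comb (\<lambda>\<alpha>. \<epsilon> \<alpha> * v \<alpha>) B))\<^sup>2
       = 2 * (\<Sum>\<alpha>\<in>B. (v \<alpha>)\<^sup>2))"
proof -
  obtain \<epsilon> :: "'a \<Rightarrow> real" where \<epsilon>: "\<And>\<alpha>. \<epsilon> \<alpha> = 1 \<or> \<epsilon> \<alpha> = - 1"
    "\<And>\<alpha> \<beta>. \<alpha> \<in> B \<Longrightarrow> \<beta> \<in> B \<Longrightarrow> \<alpha> \<noteq> \<beta> \<Longrightarrow> \<alpha> \<bullet> \<beta> \<noteq> 0 \<Longrightarrow> \<epsilon> \<alpha> = - \<epsilon> \<beta>"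
    using two_colouring[OF finite_B independent_B norm_B simple_inner] by blast
  have sq: "\<epsilon> \<alpha> * \<epsilon> \<alpha> = 1" for \<alpha> using \<epsilon>(1)[of \<alpha>] by auto
  have "(norm (lin_comb v B))\<^sup>2 + (norm (lin_comb (\<lambda>\<alpha>. \<epsilon> \<alpha> * v \<alpha>) B))\<^sup>2
       = 2 * (\<Sum>\<alpha>\<in>B. (v \<alpha>)\<^sup>2)" for v
  proof -
    have "v \<alpha> * v \<beta> * (\<alpha> \<bullet> \<beta>) + \<epsilon> \<alpha> * v \<alpha> * (\<epsilon> \<beta> * v \<beta>) * (\<alpha> \<bullet> \<beta>)
        = (if \<beta> = \<alpha> then 2 * (v \<alpha>)\<^sup>2 else 0)" if "\<alpha> \<in> B" "\<beta> \<in> B" for \<alpha> \<beta>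
    proof (cases "\<beta> = \<alpha>")
      case True
      have "\<epsilon> \<alpha> * v \<alpha> * (\<epsilon> \<alpha> * v \<alpha>) = v \<alpha> * v \<alpha>" using sq[of \<alpha>] by (simp add: algebra_simps)
      then show ?thesis using True norm_B[OF that(1)] by (simp add: norm_eq_1 power2_eq_square)
    next
      case False
      show ?thesis
      proof (cases "\<alpha> \<bullet> \<beta> = 0")
        case nz: False
        have "\<epsilon> \<alpha> = - \<epsilon> \<beta>" using \<epsilon>(2) that False nz by metis
        then have "\<epsilon> \<alpha> * v \<alpha> * (\<epsilon> \<beta> * v \<beta>) = - (v \<alpha> * v \<beta>)"
          using sq[of \<beta>] by (simp add: algebra_simps)
        then show ?thesis using False by simp
      qed (use False in simp)
    qed
    then show ?thesis
      unfolding norm_sum_scaleR_sq sum.distrib[symmetric]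
      by (simp add: finite_B sum_distrib_left cong: sum.cong)
  qed
  moreover have "\<bar>\<epsilon> \<alpha>\<bar> = 1" for \<alpha> using \<epsilon>(1)[of \<alpha>] by auto
  ultimately show ?thesis by blast
qed

text \<open>This is the lower bound for the sign-flipped coefficients, read through the identity of
  \<open>exists_signs\<close>.\<close>

lemma gram_upper_bound:
  "(norm (lin_comb v B))\<^sup>2 \<le> (1 + coupling B) * (\<Sum>\<alpha>\<in>B. (v \<alpha>)\<^sup>2)"
proof -
  obtain \<epsilon> :: "'a \<Rightarrow> real" where \<epsilon>: "\<forall>\<alpha>. \<bar>\<epsilon> \<alpha>\<bar> = 1"
    "(norm (lin_comb v B))\<^sup>2 + (norm (lin_comb (\<lambda>\<alpha>. \<epsilon> \<alpha> * v \<alpha>) B))\<^sup>2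
       = 2 * (\<Sum>\<alpha>\<in>B. (v \<alpha>)\<^sup>2)"
    using exists_signs by blast
  have "(\<epsilon> \<alpha> * v \<alpha>)\<^sup>2 = (v \<alpha>)\<^sup>2" for \<alpha>
    using \<epsilon>(1) by (metis abs_mult mult_1 power2_abs)
  then have "(1 - coupling B) * (\<Sum>\<alpha>\<in>B. (v \<alpha>)\<^sup>2) \<le> (norm (lin_comb (\<lambda>\<alpha>. \<epsilon> \<alpha> * v \<alpha>) B))\<^sup>2"
    using gram_lower_bound[OF finite_B, of "\<lambda>\<alpha>. \<epsilon> \<alpha> * v \<alpha>"] by simp
  then show ?thesis using \<epsilon>(2) by (simp add: algebra_simps)
qed

section \<open>The optimal condition number and optimal templates\<close>

text \<open>
  For \<open>v \<ge> 0\<close> put \<open>x = \<Sum>\<alpha>. v \<alpha> \<alpha>\<close> and let \<open>y\<close> be the same sum with signs. A template \<open>t\<close> in the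
  chamber satisfies \<open>|t \<bullet> y| \<le> t \<bullet> x\<close>, although \<open>y\<close> can be much longer than \<open>x\<close>.
\<close>

lemma lipschitz_ratio_ge:
  assumes "set ts \<subseteq> V" "V \<noteq> {0}" "upper_lipschitz_bound V G ts C" "lower_lipschitz_bound V G ts c"
  shows "coupling_cond B \<le> C / c"
proof -
  have C: "C > 0" "\<And>z. z \<in> V \<Longrightarrow> bank_norm ts z \<le> C * norm z"
    using assms(3) upper_lipschitz_bound_iff[OF assms(1)] by auto
  have c: "c > 0" "\<And>z. z \<in> V \<Longrightarrow> c * norm z \<le> bank_norm ts z"
    using assms(4) lower_lipschitz_bound_iff[OF assms(1)] by auto
  \<comment> \<open>A nonzero vector forces \<open>c \<le> C\<close>. In \<open>{0}\<close> any two
    positive constants would be Lipschitz bounds, with arbitrarily small quotient.\<close>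
  obtain z where z: "z \<in> V" "z \<noteq> 0" using assms(2) subspace_0[OF subspace_V] by blast
  have "c * norm z \<le> C * norm z" using C(2)[OF z(1)] c(2)[OF z(1)] by linarith
  then have "c \<le> C" using z(2) by simp
  then have sq: "c\<^sup>2 \<le> C\<^sup>2" using c(1) by (simp add: power_mono)
  have pos: "C\<^sup>2 + c\<^sup>2 > 0" using c(1) by (simp add: add_nonneg_pos)
  obtain \<epsilon> :: "'a \<Rightarrow> real" where \<epsilon>: "\<And>\<alpha>. \<bar>\<epsilon> \<alpha>\<bar> = 1"
    "\<And>v. (norm (lin_comb v B))\<^sup>2 + (norm (lin_comb (\<lambda>\<alpha>. \<epsilon> \<alpha> * v \<alpha>) B))\<^sup>2
       = 2 * (\<Sum>\<alpha>\<in>B. (v \<alpha>)\<^sup>2)"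
    using exists_signs by blast
  \<comment> \<open>The right-hand side is the number \<open>r\<close> with
    \<open>(1 + r) / (1 - r) = C\<^sup>2 / c\<^sup>2\<close>.\<close>
  have "coupling B \<le> (C\<^sup>2 - c\<^sup>2) / (C\<^sup>2 + c\<^sup>2)"
  proof (rule coupling_le)
    show "0 \<le> (C\<^sup>2 - c\<^sup>2) / (C\<^sup>2 + c\<^sup>2)" using sq pos by simp
    fix v :: "'a \<Rightarrow> real" assume 1: "(\<Sum>\<alpha>\<in>B. (v \<alpha>)\<^sup>2) = 1"
    define x where "x = (\<Sum>\<alpha>\<in>B. \<bar>v \<alpha>\<bar> *\<^sub>R \<alpha>)"
    define y where "y = (\<Sum>\<alpha>\<in>B. (\<epsilon> \<alpha> * \<bar>v \<alpha>\<bar>) *\<^sub>R \<alpha>)"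
    have xV: "x \<in> V" "y \<in> V"
      unfolding x_def y_def using B_subset subspace_V by (auto intro!: subspace_sum subspace_scale)
    have xy: "(norm x)\<^sup>2 + (norm y)\<^sup>2 = 2"
      using \<epsilon>(2)[of "\<lambda>\<alpha>. \<bar>v \<alpha>\<bar>"] 1 by (simp add: x_def y_def)
    have le: "\<bar>t \<bullet> y\<bar> \<le> t \<bullet> x" if "t \<in> closed_chamber" for t
    proof -
      have "\<bar>t \<bullet> y\<bar> \<le> (\<Sum>\<alpha>\<in>B. \<bar>\<epsilon> \<alpha> * \<bar>v \<alpha>\<bar> * (t \<bullet> \<alpha>)\<bar>)"
        unfolding y_def inner_sum_right inner_scaleR_right by (rule sum_abs)
      also have "\<dots> = t \<bullet> x"
        unfolding x_def inner_sum_right inner_scaleR_right abs_mult \<epsilon>(1)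
        using that by (intro sum.cong) (auto simp: closed_chamber_def inner_commute)
      finally show ?thesis .
    qed
    have "bank_norm ts y = L2_set (\<lambda>i. \<bar>chamber_rep (ts ! i) \<bullet> y\<bar>) {..<length ts}"
      by (simp add: bank_norm_def L2_set_def)
    also have "\<dots> \<le> bank_norm ts x"
      unfolding bank_norm_def using assms(1) by (intro L2_set_mono le chamber_rep(1)) auto
    finally have "c * norm y \<le> C * norm x" using C(2)[OF xV(1)] c(2)[OF xV(2)] by linarith
    then have "(c * norm y)\<^sup>2 \<le> (C * norm x)\<^sup>2" using c(1) by (intro power_mono) auto
    moreover have "(norm y)\<^sup>2 = 2 - (norm x)\<^sup>2" using xy by simp
    ultimately have "c\<^sup>2 * (2 - (norm x)\<^sup>2) \<le> C\<^sup>2 * (norm x)\<^sup>2"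
      by (simp add: power_mult_distrib)
    then have "1 - (norm x)\<^sup>2 \<le> (C\<^sup>2 - c\<^sup>2) / (C\<^sup>2 + c\<^sup>2)"
      unfolding pos_le_divide_eq[OF pos] by (simp add: algebra_simps)
    moreover have "(norm x)\<^sup>2 \<le> (norm (lin_comb v B))\<^sup>2"
      unfolding x_def norm_sum_scaleR_sq
    proof (intro sum_mono)
      fix \<alpha> \<beta> assume "\<alpha> \<in> B" "\<beta> \<in> B"
      show "\<bar>v \<alpha>\<bar> * \<bar>v \<beta>\<bar> * (\<alpha> \<bullet> \<beta>) \<le> v \<alpha> * v \<beta> * (\<alpha> \<bullet> \<beta>)"
      proof (cases "\<alpha> = \<beta>")
        case False
        have "v \<alpha> * v \<beta> \<le> \<bar>v \<alpha>\<bar> * \<bar>v \<beta>\<bar>" by (metis abs_ge_self abs_mult)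
        then show ?thesis
          using simple_inner_le_0[OF \<open>\<alpha> \<in> B\<close> \<open>\<beta> \<in> B\<close> False] by (rule mult_right_mono_neg)
      qed simp
    qed
    ultimately show "1 - (norm (lin_comb v B))\<^sup>2 \<le> (C\<^sup>2 - c\<^sup>2) / (C\<^sup>2 + c\<^sup>2)" by linarith
  qed
  then have "c\<^sup>2 * (1 + coupling B) \<le> C\<^sup>2 * (1 - coupling B)"
    unfolding pos_le_divide_eq[OF pos] by (simp add: algebra_simps)
  then have "sqrt (c\<^sup>2 * (1 + coupling B)) \<le> sqrt (C\<^sup>2 * (1 - coupling B))" by simp
  then have "c * sqrt (1 + coupling B) \<le> C * sqrt (1 - coupling B)"
    using C(1) c(1) by (simp add: real_sqrt_mult)
  moreover have "sqrt (1 - coupling B) > 0" using coupling_less_1 by simp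
  ultimately show ?thesis
    unfolding coupling_cond_def using c(1) by (simp add: field_simps)
qed

end

text \<open>For empty \<open>B\<close> this is an orthonormal basis of \<open>V\<close>, for a
  spanning \<open>B\<close> the dual basis alone; so trivial, essential and mixed groups share one
  notion.\<close>

definition dual_templates :: "'a::euclidean_space set \<Rightarrow> 'a set \<Rightarrow> 'a set \<Rightarrow> bool" where
  "dual_templates V B T \<longleftrightarrow> (\<exists>\<omega> E. T = \<omega> ` B \<union> E \<and>
     dual_basis B \<omega> \<and>
     orthonormal_basis {x\<in>V. \<forall>\<alpha>\<in>B. \<alpha> \<bullet> x = 0} E)"

section \<open>Optimality of the dual templates\<close>

context simple_refl
begin

lemma exists_dual_templates: "\<exists>T. finite T \<and> dual_templates V B T"
proof -
  let ?W = "{x\<in>V. \<forall>\<alpha>\<in>B. \<alpha> \<bullet> x = 0}"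
  have "subspace ?W" using subspace_V by (auto simp: subspace_def inner_add_right)
  then obtain E where "E \<subseteq> ?W" and E: "pairwise orthogonal E"
    "\<And>x. x \<in> E \<Longrightarrow> norm x = 1" "independent E" "card E = dim ?W" "span E = ?W"
    by (rule orthonormal_basis_subspace) (rule that)
  have "finite E" using E(3) by (simp add: independent_imp_finite)
  obtain \<omega> where "dual_basis B \<omega>"
    using exists_dual_basis by blast
  then have "dual_templates V B (\<omega> ` B \<union> E)"
    unfolding dual_templates_def orthonormal_basis_def using E(1,2,5)
    by (intro exI[of _ \<omega>] exI[of _ E]) simp
  then show ?thesis using \<open>finite E\<close> finite_B by (intro exI[of _ "\<omega> ` B \<union> E"]) simp
qed

text \<open>Writing \<open>z\<close> as a combination of \<open>B\<close> with coefficients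
  \<open>v\<close> plus a part \<open>y\<close> orthogonal to \<open>B\<close>, the dual vectors
  read off \<open>v\<close> and the orthonormal part reads off \<open>y\<close>. So the squared bank
  norm is the squared length of \<open>v\<close> plus that of \<open>y\<close>, and the Gram bounds
  compare it with \<open>norm z\<close>; the factor 1 belonging to \<open>y\<close> lies between the
  two extremes.\<close>

lemma dual_templates_bank:
  assumes T: "dual_templates V B T" and ts: "distinct ts" "set ts = T"
  shows "T \<subseteq> V" "length ts \<le> dim V"
    "upper_lipschitz_bound V G ts (1 / sqrt (1 - coupling B))"
    "lower_lipschitz_bound V G ts (1 / sqrt (1 + coupling B))"
proof -
  let ?W = "{x\<in>V. \<forall>\<alpha>\<in>B. \<alpha> \<bullet> x = 0}"
  obtain \<omega> E where \<omega>: "T = \<omega> ` B \<union> E" "\<And>\<alpha>. \<alpha> \<in> B \<Longrightarrow> \<omega> \<alpha> \<in> span B"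
    "\<forall>\<alpha>\<in>B. \<forall>\<beta>\<in>B. \<omega> \<alpha> \<bullet> \<beta> = (if \<alpha> = \<beta> then 1 else 0)"
    and E: "pairwise orthogonal E" "\<And>e. e \<in> E \<Longrightarrow> norm e = 1" "span E = ?W"
    using T unfolding dual_templates_def orthonormal_basis_def by blast
  have spanB: "span B \<subseteq> V" using B_subset subspace_V by (simp add: span_minimal)
  have "0 \<notin> E" using E(2) by force
  have indE: "independent E" using E(1) \<open>0 \<notin> E\<close> by (rule pairwise_orthogonal_independent)
  have finE: "finite E" using indE by (simp add: independent_imp_finite)
  have EW: "E \<subseteq> ?W" using E(3) span_superset by blast
  have Wspan: "w \<bullet> x = 0" if "w \<in> ?W" "x \<in> span B" for w x
    using that(2)
  proof (induction rule: span_induct)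
    case base
    show ?case by (auto simp: subspace_def inner_add_right)
  qed (use that in \<open>auto simp: inner_commute\<close>)
  \<comment> \<open>The templates already lie in the chamber, so passing to chamber representatives
    leaves them unchanged.\<close>
  have Tchamber: "T \<subseteq> closed_chamber"
    using \<omega> EW spanB by (force simp: closed_chamber_def inner_commute)
  then show TV: "T \<subseteq> V" by (auto simp: closed_chamber_def)
  have inj: "inj_on \<omega> B"
    using \<omega>(3) by (intro inj_onI) (metis zero_neq_one)
  have disj: "\<omega> ` B \<inter> E = {}"
  proof -
    have False if "\<alpha> \<in> B" "\<omega> \<alpha> \<in> E" for \<alpha>
    proof -
      have "\<omega> \<alpha> \<bullet> \<omega> \<alpha> = 0" using Wspan EW that \<omega>(2) by blast
      then show False using E(2)[OF that(2)] by simp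
    qed
    then show ?thesis by blast
  qed
  have "dim ?W + dim (span B) = dim V"
  proof -
    have "{y \<in> V. \<forall>x\<in>span B. orthogonal x y} = ?W"
      using Wspan by (auto simp: Linear_Algebra.orthogonal_def span_base inner_commute)
    then show ?thesis
      using dim_subspace_orthogonal_to_vectors[OF subspace_span subspace_V spanB] by simp
  qed
  moreover have "dim ?W = card E" using E(3) indE by (metis dim_span_eq_card_independent)
  moreover have "dim (span B) = card B" using independent_B by (rule dim_span_eq_card_independent)
  moreover have "length ts = card T" using ts by (metis distinct_card)
  moreover have "card T \<le> card B + card E"
    using card_Un_le[of "\<omega> ` B" E] card_image_le[OF finite_B, of \<omega>] \<omega>(1) by simp
  ultimately show "length ts \<le> dim V" by simp
  have bank: "(bank_norm ts z)\<^sup>2 = (\<Sum>\<alpha>\<in>B. (\<omega> \<alpha> \<bullet> z)\<^sup>2) + (\<Sum>e\<in>E. (e \<bullet> z)\<^sup>2)" for z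
  proof -
    have "(bank_norm ts z)\<^sup>2 = (\<Sum>i<length ts. (chamber_rep (ts ! i) \<bullet> z)\<^sup>2)"
      by (simp add: bank_norm_def L2_set_def sum_nonneg)
    also have "\<dots> = (\<Sum>i<length ts. (ts ! i \<bullet> z)\<^sup>2)"
      using Tchamber ts(2) by (intro sum.cong) (auto simp: chamber_rep_eq subset_iff)
    also have "\<dots> = (\<Sum>t\<in>T. (t \<bullet> z)\<^sup>2)"
      using sum.reindex_bij_betw[OF bij_betw_nth[OF ts(1) refl ts(2)[symmetric]], of "\<lambda>t. (t \<bullet> z)\<^sup>2"]
      by simp
    also have "\<dots> = (\<Sum>t\<in>\<omega> ` B. (t \<bullet> z)\<^sup>2) + (\<Sum>e\<in>E. (e \<bullet> z)\<^sup>2)"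
      using disj finE finite_B by (simp add: \<omega>(1) sum.union_disjoint)
    finally show ?thesis using inj by (simp add: sum.reindex)
  qed
  let ?r = "coupling B"
  have r: "0 \<le> ?r" "?r < 1" using coupling_nonneg coupling_less_1 by auto
  have bounds: "(norm z)\<^sup>2 / (1 + ?r) \<le> (bank_norm ts z)\<^sup>2 \<and> (bank_norm ts z)\<^sup>2 \<le> (norm z)\<^sup>2 / (1 - ?r)"
    if "z \<in> V" for z
  proof -
    obtain x y where xy: "x \<in> span B" "\<And>w. w \<in> span B \<Longrightarrow> orthogonal y w" "z = x + y"
      using orthogonal_subspace_decomp_exists[of B z] by metis
    have yV: "y \<in> V" using xy(1,3) that spanB subspace_V
      by (metis add_diff_cancel_left' subset_iff subspace_diff)
    have yW: "y \<in> ?W" using yV xy(2) by (auto simp: Linear_Algebra.orthogonal_def span_base inner_commute)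
    obtain v where v: "x = (lin_comb v B)"
      using xy(1) span_finite[OF finite_B] by auto
    have "\<omega> \<alpha> \<bullet> z = v \<alpha>" if "\<alpha> \<in> B" for \<alpha>
      using sum_dual_basis[OF \<omega>(3) that, of v] xy(2)[OF \<omega>(2)[OF that]]
      by (simp add: xy(3) v[symmetric] inner_add_right Linear_Algebra.orthogonal_def inner_commute)
    moreover have "e \<bullet> z = e \<bullet> y" if "e \<in> E" for e
      using Wspan[of e x] EW that xy(1) by (auto simp: xy(3) inner_add_right)
    moreover have "(\<Sum>e\<in>E. (e \<bullet> y)\<^sup>2) = (norm y)\<^sup>2"
    proof -
      have "(\<Sum>e\<in>E. (y \<bullet> e) *\<^sub>R e) = y"
        using yW E finE by (intro orthonormal_basis_expand) auto
      then have "y \<bullet> (\<Sum>e\<in>E. (y \<bullet> e) *\<^sub>R e) = (norm y)\<^sup>2" by (simp add: power2_norm_eq_inner)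
      then show ?thesis by (simp add: inner_sum_right power2_eq_square inner_commute)
    qed
    ultimately have b: "(bank_norm ts z)\<^sup>2 = (\<Sum>\<alpha>\<in>B. (v \<alpha>)\<^sup>2) + (norm y)\<^sup>2"
      by (simp add: bank)
    have n: "(norm z)\<^sup>2 = (norm x)\<^sup>2 + (norm y)\<^sup>2"
      unfolding xy(3) using xy(1,2) by (intro norm_add_Pythagorean) (simp add: orthogonal_commute)
    have "(norm x)\<^sup>2 \<le> (1 + ?r) * (\<Sum>\<alpha>\<in>B. (v \<alpha>)\<^sup>2)" "(1 - ?r) * (\<Sum>\<alpha>\<in>B. (v \<alpha>)\<^sup>2) \<le> (norm x)\<^sup>2"
      unfolding v using gram_upper_bound gram_lower_bound[OF finite_B] by auto
    moreover have "(norm y)\<^sup>2 \<le> (1 + ?r) * (norm y)\<^sup>2" "(1 - ?r) * (norm y)\<^sup>2 \<le> (norm y)\<^sup>2"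
      using r by (auto simp: mult_le_cancel_right1 mult_le_cancel_right2)
    ultimately have "(norm z)\<^sup>2 \<le> (1 + ?r) * (bank_norm ts z)\<^sup>2" "(1 - ?r) * (bank_norm ts z)\<^sup>2 \<le> (norm z)\<^sup>2"
      unfolding b n distrib_left by linarith+
    then show ?thesis using r by (simp add: field_simps)
  qed
  have nn: "bank_norm ts z \<ge> 0" for z by (simp add: bank_norm_def L2_set_nonneg)
  have "bank_norm ts z \<le> 1 / sqrt (1 - ?r) * norm z" if "z \<in> V" for z
  proof (rule power2_le_imp_le)
    show "(bank_norm ts z)\<^sup>2 \<le> (1 / sqrt (1 - ?r) * norm z)\<^sup>2"
      using bounds[OF that] r by (simp add: power_mult_distrib power_divide)
  qed (use r in simp)
  then show "upper_lipschitz_bound V G ts (1 / sqrt (1 - ?r))"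
    using r TV ts(2) by (simp add: upper_lipschitz_bound_iff)
  have "1 / sqrt (1 + ?r) * norm z \<le> bank_norm ts z" if "z \<in> V" for z
  proof (rule power2_le_imp_le)
    show "(1 / sqrt (1 + ?r) * norm z)\<^sup>2 \<le> (bank_norm ts z)\<^sup>2"
      using bounds[OF that] r by (simp add: power_mult_distrib power_divide)
  qed (rule nn)
  then show "lower_lipschitz_bound V G ts (1 / sqrt (1 + ?r))"
    using r TV ts(2) by (simp add: lower_lipschitz_bound_iff)
qed

lemma opt_cond_eq:
  assumes "V \<noteq> {0}"
  shows "opt_cond V G = coupling_cond B"
  unfolding opt_cond_def
proof (rule cInf_eq_minimum)
  obtain T ts where T: "dual_templates V B T" "distinct ts" "set ts = T"
    using exists_dual_templates finite_distinct_list by metis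
  have "coupling_cond B = (1 / sqrt (1 - coupling B)) / (1 / sqrt (1 + coupling B))"
    by (simp add: coupling_cond_def)
  then show "coupling_cond B \<in> {C / c |ts C c. set ts \<subseteq> V \<and>
     upper_lipschitz_bound V G ts C \<and> lower_lipschitz_bound V G ts c}"
    using dual_templates_bank[OF T] T(3) by blast
next
  fix r assume "r \<in> {C / c |ts C c. set ts \<subseteq> V \<and>
     upper_lipschitz_bound V G ts C \<and> lower_lipschitz_bound V G ts c}"
  then show "coupling_cond B \<le> r" using lipschitz_ratio_ge[OF _ assms] by blast
qed

lemma minimal_optimal_dual_templates:
  assumes "V \<noteq> {0}" "dual_templates V B T" "distinct ts" "set ts = T"
  shows "minimal_optimal_templates V G ts"
proof -
  note bank = dual_templates_bank[OF assms(2-4)]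
  have "opt_cond V G = (1 / sqrt (1 - coupling B)) / (1 / sqrt (1 + coupling B))"
    using opt_cond_eq[OF assms(1)] by (simp add: coupling_cond_def)
  then have "optimal_templates V G ts"
    unfolding optimal_templates_def using bank assms(4) by metis
  moreover have "length ts \<le> length ts'" if "optimal_templates V G ts'" for ts'
    using that bank(2) length_ge_dim unfolding optimal_templates_def by (meson le_trans)
  ultimately show ?thesis by (simp add: minimal_optimal_templates_def)
qed

end

section \<open>Existence of simple systems\<close>

text \<open>The component of \<open>u\<close> orthogonal to \<open>\<alpha>\<close> lies in the
  hyperplane of \<open>\<alpha>\<close>, hence in that of \<open>u\<close>, and is thus orthogonal
  to itself.\<close>

lemma hyperplane_eqD:
  assumes "subspace V" "\<alpha> \<in> V" "u \<in> V" "norm \<alpha> = 1" "u \<noteq> 0" "hyperplane V \<alpha> = hyperplane V u"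
  shows "reflection \<alpha> = reflection u"
proof -
  define v where "v = u - (\<alpha> \<bullet> u) *\<^sub>R \<alpha>"
  have \<alpha>v: "\<alpha> \<bullet> v = 0" using assms(4) by (simp add: v_def inner_diff_right norm_eq_1)
  have "v \<in> V" using assms by (simp add: v_def subspace_diff subspace_scale)
  then have "u \<bullet> v = 0" using \<alpha>v assms(6) unfolding hyperplane_def by blast
  then have "v \<bullet> v = 0" using \<alpha>v by (subst (1) v_def) (simp add: inner_diff_left)
  then have u: "u = (\<alpha> \<bullet> u) *\<^sub>R \<alpha>" by (simp add: v_def)
  then have "\<alpha> \<bullet> u \<noteq> 0" using assms(5) by force
  then show ?thesis using reflection_scaleR[of "\<alpha> \<bullet> u" \<alpha>] u by simp
qed

text \<open>The cone where all \<open>\<alpha> \<in> B\<close> are positive lies in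
  \<open>C\<close>: a segment leaving \<open>C\<close> meets the frontier and thus a hyperplane of
  \<open>B\<close>, but from a point of \<open>C\<close> to a point of the cone all products stay
  positive. So no root vanishes on the cone. Minimality of \<open>B\<close> supplies the wall
  points: without \<open>\<alpha>\<close> some frontier point is uncovered.\<close>

lemma simple_system_of_fundamental:
  assumes V: "subspace V" and B: "fundamental_system V G B"
  shows "simple_system V G B"
proof -
  obtain C where C: "C \<in> weyl_chambers V G" and BC: "fundamental_system_of V G C B"
    using B unfolding fundamental_system_def by blast
  have fin: "finite B"
    and B1: "\<And>\<alpha>. \<alpha> \<in> B \<Longrightarrow> \<alpha> \<in> V" "\<And>\<alpha>. \<alpha> \<in> B \<Longrightarrow> norm \<alpha> = 1"
    "\<And>\<alpha>. \<alpha> \<in> B \<Longrightarrow> hyperplane V \<alpha> \<in> reflecting_hyperplanes V G"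
    "\<And>\<alpha> x. \<alpha> \<in> B \<Longrightarrow> x \<in> C \<Longrightarrow> \<alpha> \<bullet> x \<ge> 0"
    and front: "(top_of_set V) frontier_of C \<subseteq> (\<Union>\<alpha>\<in>B. hyperplane V \<alpha>)"
    and minimal: "\<And>\<H>. \<H> \<subseteq> reflecting_hyperplanes V G \<Longrightarrow> finite \<H> \<Longrightarrow>
      (top_of_set V) frontier_of C \<subseteq> \<Union>\<H> \<Longrightarrow> card B \<le> card \<H>"
    using BC unfolding fundamental_system_of_def by blast+
  have CV: "C \<subseteq> V - \<Union>(reflecting_hyperplanes V G)" and "C \<noteq> {}"
    using C unfolding weyl_chambers_def by (auto dest: in_components_subset in_components_nonempty)
  then obtain c where c: "c \<in> C" by blast
  have Cpos: "\<alpha> \<bullet> x > 0" if "\<alpha> \<in> B" "x \<in> C" for \<alpha> x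
  proof -
    have "x \<notin> hyperplane V \<alpha>" "x \<in> V" using CV that B1(3) by blast+
    then have "\<alpha> \<bullet> x \<noteq> 0" by (simp add: hyperplane_def)
    then show ?thesis using B1(4)[OF that] by linarith
  qed
  have inC: "y \<in> C" if y: "y \<in> V" "\<And>\<alpha>. \<alpha> \<in> B \<Longrightarrow> \<alpha> \<bullet> y > 0" for y
  proof (rule ccontr)
    assume "y \<notin> C"
    have seg: "closed_segment c y \<subseteq> V"
      using CV c y(1) V by (intro closed_segment_subset subspace_imp_convex) auto
    have "connectedin (top_of_set V) (closed_segment c y)"
      using seg by (simp add: connectedin_subtopology)
    moreover have "closed_segment c y \<inter> C \<noteq> {}" "closed_segment c y - C \<noteq> {}"
      using c \<open>y \<notin> C\<close> by auto
    ultimately obtain z where "z \<in> closed_segment c y" "z \<in> (top_of_set V) frontier_of C"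
      using connectedin_Int_frontier_of by blast
    then obtain \<alpha> where \<alpha>: "\<alpha> \<in> B" "\<alpha> \<bullet> z = 0" using front by (auto simp: hyperplane_def)
    obtain u where u: "0 \<le> u" "u \<le> 1" "z = (1 - u) *\<^sub>R c + u *\<^sub>R y"
      using \<open>z \<in> closed_segment c y\<close> by (auto simp: in_segment)
    have "\<alpha> \<bullet> z = (1 - u) * (\<alpha> \<bullet> c) + u * (\<alpha> \<bullet> y)" by (simp add: u(3) inner_add_right)
    moreover have "(1 - u) * (\<alpha> \<bullet> c) + u * (\<alpha> \<bullet> y) > 0"
      using u(1,2) Cpos[OF \<alpha>(1) c] y(2)[OF \<alpha>(1)]
      by (cases "u = 0") (auto intro!: add_nonneg_pos mult_nonneg_nonneg)
    ultimately show False using \<alpha>(2) by simp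
  qed
  have closureC: "\<alpha> \<bullet> p \<ge> 0" "p \<in> V" if "\<alpha> \<in> B" "p \<in> (top_of_set V) frontier_of C" for \<alpha> p
  proof -
    have "(top_of_set V) closure_of C \<subseteq> V \<inter> {x. \<alpha> \<bullet> x \<ge> 0}"
      using CV B1(4)[OF that(1)] by (intro closure_of_minimal closedin_closed_Int closed_halfspace_ge) auto
    then show "\<alpha> \<bullet> p \<ge> 0" "p \<in> V" using that(2) unfolding frontier_of_def by auto
  qed
  show ?thesis
    unfolding simple_system_def
  proof (intro conjI ballI impI)
    show "finite B" by (rule fin)
  next
    fix \<alpha> assume \<alpha>: "\<alpha> \<in> B"
    show "\<alpha> \<in> V" "norm \<alpha> = 1" using B1 \<alpha> by auto
    obtain u where u: "hyperplane V \<alpha> = hyperplane V u" "u \<in> V" "u \<noteq> 0" "reflection u \<in> G"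
      using B1(3)[OF \<alpha>] unfolding reflecting_hyperplanes_def by blast
    then show "reflection \<alpha> \<in> G"
      using hyperplane_eqD[OF V] B1(1,2)[OF \<alpha>] by metis
    have "card (hyperplane V ` (B - {\<alpha>})) \<le> card (B - {\<alpha>})" using fin by (simp add: card_image_le)
    also have "\<dots> < card B" using \<alpha> fin by (simp add: card_Diff1_less del: card_Diff_insert)
    finally have "\<not> (top_of_set V) frontier_of C \<subseteq> \<Union>(hyperplane V ` (B - {\<alpha>}))"
      using minimal[of "hyperplane V ` (B - {\<alpha>})"] B1(3) fin by force
    then obtain p where p: "p \<in> (top_of_set V) frontier_of C" "\<And>\<beta>. \<beta> \<in> B - {\<alpha>} \<Longrightarrow> p \<notin> hyperplane V \<beta>"
      by blast
    have pV: "p \<in> V" using closureC(2)[OF \<alpha> p(1)] .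
    have "\<alpha> \<bullet> p = 0" using front p by (auto simp: hyperplane_def)
    moreover have "\<beta> \<bullet> p > 0" if "\<beta> \<in> B - {\<alpha>}" for \<beta>
      using p(2)[OF that] closureC(1)[OF _ p(1), of \<beta>] that pV by (auto simp: hyperplane_def less_le)
    ultimately show "\<exists>p\<in>V. \<alpha> \<bullet> p = 0 \<and> (\<forall>\<beta>\<in>B - {\<alpha>}. \<beta> \<bullet> p > 0)" using pV by blast
  next
    show "\<exists>c\<in>V. \<forall>\<alpha>\<in>B. \<alpha> \<bullet> c > 0" using c CV Cpos by blast
  next
    fix \<gamma> x assume \<gamma>: "\<gamma> \<in> V" "\<gamma> \<noteq> 0 \<and> reflection \<gamma> \<in> G" and x: "x \<in> V" "\<forall>\<alpha>\<in>B. \<alpha> \<bullet> x > 0"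
    have "hyperplane V \<gamma> \<in> reflecting_hyperplanes V G" using \<gamma> unfolding reflecting_hyperplanes_def by blast
    moreover have "x \<in> C" using inC x by blast
    ultimately have "x \<notin> hyperplane V \<gamma>" using CV by blast
    then show "\<gamma> \<bullet> x \<noteq> 0" using x(1) by (simp add: hyperplane_def)
  qed
qed

lemma exists_generic_point:
  assumes "finite \<Gamma>" "subspace V" "\<Gamma> \<subseteq> V - {0}"
  shows "\<exists>c\<in>V. \<forall>\<gamma>\<in>\<Gamma>. \<gamma> \<bullet> c \<noteq> 0"
  using assms(1,3)
proof (induction \<Gamma> rule: finite_induct)
  case empty
  then show ?case using subspace_0[OF assms(2)] by auto
next
  case (insert \<gamma> \<Gamma>)
  then obtain c where c: "c \<in> V" "\<forall>\<delta>\<in>\<Gamma>. \<delta> \<bullet> c \<noteq> 0" by auto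
  \<comment> \<open>The steps along \<open>\<gamma>\<close> at which some \<open>\<delta>\<close>
    would vanish. If \<open>\<delta>\<close> is orthogonal to \<open>\<gamma>\<close>, the division
    by zero merely excludes the step 0 as well.\<close>
  let ?S = "(\<lambda>\<delta>. - (\<delta> \<bullet> c) / (\<delta> \<bullet> \<gamma>)) ` insert \<gamma> \<Gamma>"
  have "finite ?S" using insert.hyps by simp
  then obtain e where e: "e \<notin> ?S" using ex_new_if_finite[OF infinite_UNIV_char_0] by blast
  have "\<delta> \<bullet> (c + e *\<^sub>R \<gamma>) \<noteq> 0" if \<delta>: "\<delta> \<in> insert \<gamma> \<Gamma>" for \<delta>
  proof
    assume "\<delta> \<bullet> (c + e *\<^sub>R \<gamma>) = 0"
    then have eq: "\<delta> \<bullet> c + e * (\<delta> \<bullet> \<gamma>) = 0" by (simp add: inner_add_right)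
    show False
    proof (cases "\<delta> \<bullet> \<gamma> = 0")
      case True
      then have "\<delta> \<noteq> \<gamma>" using insert.prems by auto
      then show False using eq True c(2) \<delta> by auto
    next
      case False
      then have "e = - (\<delta> \<bullet> c) / (\<delta> \<bullet> \<gamma>)" using eq by (simp add: field_simps)
      then show False using e \<delta> by blast
    qed
  qed
  moreover have "c + e *\<^sub>R \<gamma> \<in> V"
    using c(1) insert.prems assms(2) by (auto intro!: subspace_add subspace_scale)
  ultimately show ?case by blast
qed

text \<open>\<open>B\<close> is a smallest set of positive unit roots whose positivity at a point
  forces that of all of \<open>P\<close>. Dropping an element destroys this property, and a point
  witnessing the failure can be moved onto the wall of the dropped root.\<close>

lemma exists_simple_system:
  assumes V: "subspace V" and "finite G"
  shows "\<exists>B. simple_system V G B"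
proof -
  \<comment> \<open>Unit length leaves at most two roots per reflection, so finiteness of the group
    carries over to the roots.\<close>
  define \<Phi> where "\<Phi> = {\<gamma>\<in>V. norm \<gamma> = 1 \<and> reflection \<gamma> \<in> G}"
  have "finite {\<gamma>\<in>\<Phi>. reflection \<gamma> = g}" for g
  proof (cases "\<exists>\<gamma>\<in>\<Phi>. reflection \<gamma> = g")
    case True
    then obtain \<gamma> where \<gamma>: "\<gamma> \<in> \<Phi>" "reflection \<gamma> = g" by blast
    have "\<delta> \<in> {\<gamma>, - \<gamma>}" if \<delta>: "\<delta> \<in> \<Phi>" "reflection \<delta> = g" for \<delta>
    proof -
      obtain r where r: "\<delta> = r *\<^sub>R \<gamma>"
      proof (rule reflection_eq_parallel[of \<delta> \<gamma>])
        show "reflection \<delta> = reflection \<gamma>" "\<delta> \<noteq> 0" "\<gamma> \<noteq> 0" using \<delta> \<gamma> by (auto simp: \<Phi>_def)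
      qed (rule that)
      then have "\<bar>r\<bar> = 1" using \<delta>(1) \<gamma>(1) by (simp add: \<Phi>_def)
      then have "r = 1 \<or> r = - 1" by linarith
      then show ?thesis using r by auto
    qed
    then have "{\<gamma>\<in>\<Phi>. reflection \<gamma> = g} \<subseteq> {\<gamma>, - \<gamma>}" by blast
    then show ?thesis by (rule finite_subset) simp
  next
    case False
    then have "{\<gamma>\<in>\<Phi>. reflection \<gamma> = g} = {}" by blast
    then show ?thesis by (simp only: finite.emptyI)
  qed
  then have "finite (\<Union>g\<in>G. {\<gamma>\<in>\<Phi>. reflection \<gamma> = g})" using assms(2) by (rule finite_UN_I[rotated])
  moreover have "\<Phi> \<subseteq> (\<Union>g\<in>G. {\<gamma>\<in>\<Phi>. reflection \<gamma> = g})" by (auto simp: \<Phi>_def)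
  ultimately have fin: "finite \<Phi>" by (rule rev_finite_subset)
  have \<Phi>V: "\<Phi> \<subseteq> V - {0}" by (auto simp: \<Phi>_def)
  obtain c where c: "c \<in> V" "\<And>\<gamma>. \<gamma> \<in> \<Phi> \<Longrightarrow> \<gamma> \<bullet> c \<noteq> 0"
    using exists_generic_point[OF fin V \<Phi>V] by auto
  define P where "P = {\<gamma>\<in>\<Phi>. \<gamma> \<bullet> c > 0}"
  have \<Phi>P: "\<gamma> \<in> P \<or> - \<gamma> \<in> P" if "\<gamma> \<in> \<Phi>" for \<gamma>
    using c(2)[OF that] that V by (auto simp: P_def \<Phi>_def subspace_neg)
  define cone where "cone B \<longleftrightarrow> B \<subseteq> P \<and> (\<forall>x\<in>V. (\<forall>\<alpha>\<in>B. \<alpha> \<bullet> x > 0) \<longrightarrow> (\<forall>\<gamma>\<in>P. \<gamma> \<bullet> x > 0))" for B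
  have "cone P" by (auto simp: cone_def)
  then obtain B where B: "cone B" "\<And>A. cone A \<Longrightarrow> card B \<le> card A"
    using ex_has_least_nat[of cone P card] by blast
  then have BP: "B \<subseteq> P" by (simp add: cone_def)
  have finB: "finite B" using BP fin by (metis (no_types) P_def finite_Collect_conjI finite_subset mem_Collect_eq Collect_mem_eq)
  have "simple_system V G B"
    unfolding simple_system_def
  proof (intro conjI ballI impI)
    show "finite B" by (rule finB)
  next
    fix \<alpha> assume \<alpha>: "\<alpha> \<in> B"
    then show "\<alpha> \<in> V" "norm \<alpha> = 1" "reflection \<alpha> \<in> G" using BP by (auto simp: P_def \<Phi>_def)
    have "card (B - {\<alpha>}) < card B" using \<alpha> finB by (simp add: card_Diff1_less del: card_Diff_insert)
    then have "\<not> cone (B - {\<alpha>})" using B(2) by (meson not_le)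
    then obtain x where x: "x \<in> V" "\<forall>\<beta>\<in>B - {\<alpha>}. \<beta> \<bullet> x > 0" "\<not> (\<forall>\<gamma>\<in>P. \<gamma> \<bullet> x > 0)"
      using BP unfolding cone_def by blast
    then have "\<alpha> \<bullet> x \<le> 0" using B(1) unfolding cone_def by (metis insertE insert_Diff not_le \<alpha>)
    have \<alpha>c: "\<alpha> \<bullet> c > 0" using \<alpha> BP by (auto simp: P_def)
    \<comment> \<open>The point \<open>x\<close> is pushed towards \<open>c\<close> until
      \<open>\<alpha>\<close> vanishes; as \<open>t \<ge> 0\<close>, the other inequalities remain
      strict.\<close>
    define t where "t = - (\<alpha> \<bullet> x) / (\<alpha> \<bullet> c)"
    have t: "t \<ge> 0" using \<open>\<alpha> \<bullet> x \<le> 0\<close> \<alpha>c by (simp add: t_def divide_nonpos_pos)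
    show "\<exists>p\<in>V. \<alpha> \<bullet> p = 0 \<and> (\<forall>\<beta>\<in>B - {\<alpha>}. \<beta> \<bullet> p > 0)"
    proof (intro bexI conjI ballI)
      show "x + t *\<^sub>R c \<in> V" using x c V by (simp add: subspace_add subspace_scale)
      show "\<alpha> \<bullet> (x + t *\<^sub>R c) = 0"
        unfolding inner_add_right inner_scaleR_right using \<alpha>c by (simp add: t_def)
      fix \<beta> assume \<beta>: "\<beta> \<in> B - {\<alpha>}"
      have "\<beta> \<bullet> c > 0" using \<beta> BP by (auto simp: P_def)
      then show "\<beta> \<bullet> (x + t *\<^sub>R c) > 0"
        unfolding inner_add_right inner_scaleR_right using x(2) \<beta> t by (intro add_pos_nonneg) auto
    qed
  next
    show "\<exists>c\<in>V. \<forall>\<alpha>\<in>B. \<alpha> \<bullet> c > 0" using BP c(1) by (auto simp: P_def)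
  next
    fix \<gamma> x assume \<gamma>: "\<gamma> \<in> V" "\<gamma> \<noteq> 0 \<and> reflection \<gamma> \<in> G" and x: "x \<in> V" "\<forall>\<alpha>\<in>B. \<alpha> \<bullet> x > 0"
    let ?u = "(1 / norm \<gamma>) *\<^sub>R \<gamma>"
    have "?u \<in> \<Phi>" using \<gamma> V reflection_scaleR[of "1 / norm \<gamma>" \<gamma>] by (simp add: \<Phi>_def subspace_scale)
    then have "?u \<in> P \<or> - ?u \<in> P" by (rule \<Phi>P)
    moreover have "\<delta> \<bullet> x > 0" if "\<delta> \<in> P" for \<delta> using B(1) x that unfolding cone_def by blast
    ultimately have "?u \<bullet> x \<noteq> 0" by force
    then show "\<gamma> \<bullet> x \<noteq> 0" by auto
  qed
  then show ?thesis by blast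
qed

text \<open>The reflections in \<open>B\<close> generate the group, so the part of a vector
  orthogonal to \<open>B\<close> is a fixed point and hence zero.\<close>

lemma (in simple_refl) essential_span:
  assumes "essential V G" shows "span B = V"
proof
  show "span B \<subseteq> V" using B_subset subspace_V by (simp add: span_minimal)
  show "V \<subseteq> span B"
  proof
    fix x assume "x \<in> V"
    obtain y z where yz: "y \<in> span B" "\<And>w. w \<in> span B \<Longrightarrow> orthogonal z w" "x = y + z"
      using orthogonal_subspace_decomp_exists[of B x] by metis
    have "z \<in> V" using yz(1,3) \<open>x \<in> V\<close> \<open>span B \<subseteq> V\<close> subspace_V
      by (metis add_diff_cancel_left' subset_iff subspace_diff)
    moreover have "g z = z" if "g \<in> G" for g
    proof -
      have "g \<in> refl_word ` lists B" using that generated_by_simple by simp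
      then obtain us where "g = refl_word us" "us \<in> lists B" by (rule imageE)
      then show ?thesis
        using yz(2) by (auto intro!: refl_word_orth simp: Linear_Algebra.orthogonal_def span_base inner_commute)
    qed
    ultimately have "z = 0" using assms unfolding essential_def by blast
    then show "x \<in> span B" using yz by simp
  qed
qed

lemma (in simple_refl) B_empty_iff: "B = {} \<longleftrightarrow> G = {id}"
proof
  show "G = {id}" if "B = {}"
    using generated_by_simple that by (simp only: lists_empty image_insert image_empty refl_word.simps)
  show "B = {}" if "G = {id}"
    using reflection_B reflection_ne_id B_nonzero that by blast
qed

section \<open>Orthogonal decompositions\<close>

text \<open>The list parameter generalises the product so that induction over its factors is
  possible.\<close>

definition prod_map :: "nat list \<Rightarrow> (nat \<Rightarrow> 'a \<Rightarrow> 'a) \<Rightarrow> 'a \<Rightarrow> 'a" where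
  "prod_map js h = foldr (\<lambda>i f. h i \<circ> f) js id"

locale orth_decomposition =
  fixes k :: nat and V :: "nat \<Rightarrow> 'a::euclidean_space set" and H
  assumes subspace: "i < k \<Longrightarrow> subspace (V i)"
    and orth: "i < k \<Longrightarrow> j < k \<Longrightarrow> i \<noteq> j \<Longrightarrow> x \<in> V i \<Longrightarrow> y \<in> V j \<Longrightarrow> x \<bullet> y = 0"
    and span_V: "span (\<Union>i<k. V i) = UNIV"
    and refl: "i < k \<Longrightarrow> reflection_group (V i) (H i)"
begin

lemma components:
  obtains \<xi> where "\<And>i. i < k \<Longrightarrow> \<xi> i \<in> V i" "x = (\<Sum>i<k. \<xi> i)"
proof -
  let ?S = "{x. \<exists>\<xi>. (\<forall>i<k. \<xi> i \<in> V i) \<and> x = (\<Sum>i<k. \<xi> i)}"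
  have "x \<in> span (\<Union>i<k. V i)" using span_V by simp
  moreover have "subspace ?S"
    proof (rule subspaceI)
      show "0 \<in> ?S" using subspace by (auto intro!: exI[of _ "\<lambda>_. 0"] subspace_0)
    next
      fix x y assume "x \<in> ?S" "y \<in> ?S"
      then obtain \<xi> \<zeta> where "\<forall>i<k. \<xi> i \<in> V i" "x = (\<Sum>i<k. \<xi> i)" "\<forall>i<k. \<zeta> i \<in> V i" "y = (\<Sum>i<k. \<zeta> i)"
        by blast
      then show "x + y \<in> ?S"
        using subspace by (auto intro!: exI[of _ "\<lambda>i. \<xi> i + \<zeta> i"] simp: subspace_add sum.distrib)
    next
      fix r x assume "x \<in> ?S"
      then obtain \<xi> where "\<forall>i<k. \<xi> i \<in> V i" "x = (\<Sum>i<k. \<xi> i)" by blast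
      then show "r *\<^sub>R x \<in> ?S"
        using subspace by (auto intro!: exI[of _ "\<lambda>i. r *\<^sub>R \<xi> i"] simp: subspace_scale scaleR_sum_right)
    qed
  moreover have "(\<Union>i<k. V i) \<subseteq> ?S"
  proof
    fix x assume "x \<in> (\<Union>i<k. V i)"
    then obtain j where j: "j < k" "x \<in> V j" by blast
    have "x = (\<Sum>i<k. if i = j then x else 0)" using j(1) by simp
    then show "x \<in> ?S"
      using j subspace by (auto intro!: exI[of _ "\<lambda>i. if i = j then x else 0"] subspace_0)
  qed
  ultimately have "x \<in> ?S" using span_minimal by blast
  then show ?thesis using that by blast
qed

lemma inner_components:
  assumes "\<And>i. i < k \<Longrightarrow> \<xi> i \<in> V i" "j < k" "y \<in> V j"
  shows "y \<bullet> (\<Sum>i<k. \<xi> i) = y \<bullet> \<xi> j"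
proof -
  have "y \<bullet> (\<Sum>i<k. \<xi> i) = (\<Sum>i<k. if i = j then y \<bullet> \<xi> j else 0)"
    unfolding inner_sum_right using assms orth[of j _ y] by (intro sum.cong) auto
  then show ?thesis using assms(2) by simp
qed

lemma decomposition_ext:
  assumes "linear f" "linear g" "\<And>j x. j < k \<Longrightarrow> x \<in> V j \<Longrightarrow> f x = g x"
  shows "f = g"
proof
  fix x
  show "f x = g x"
    using span_V by (intro linear_eq_on[OF assms(1,2), of x "\<Union>i<k. V i"]) (auto intro: assms(3))
qed

lemma component_fixes:
  assumes "i < k" "j < k" "i \<noteq> j" "f \<in> H i" "x \<in> V j" shows "f x = x"
  using assms orth[of i j] by (intro refl_group_orth[OF refl]) auto

lemma component_invariant: "j < k \<Longrightarrow> f \<in> H j \<Longrightarrow> x \<in> V j \<Longrightarrow> f x \<in> V j"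
  using refl_group_invariant[OF refl subspace] by blast

lemma linear_component: "j < k \<Longrightarrow> f \<in> H j \<Longrightarrow> linear f"
  using refl_group_linear[OF refl] by blast

section \<open>Products of maps acting on the summands\<close>

lemma prod_map_apply:
  assumes "\<And>i. i \<in> set js \<Longrightarrow> i < k \<and> h i \<in> H i" "distinct js" "j < k" "x \<in> V j"
  shows "prod_map js h x = (if j \<in> set js then h j x else x)"
  using assms(1,2)
proof (induction js)
  case Nil
  then show ?case by (simp add: prod_map_def)
next
  case (Cons i js)
  have eq: "prod_map (i # js) h x = h i (prod_map js h x)" by (simp add: prod_map_def)
  have IH: "prod_map js h x = (if j \<in> set js then h j x else x)" using Cons by simp
  show ?case
  proof (cases "i = j")
    case True
    then show ?thesis using eq IH Cons.prems by auto
  next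
    case False
    have "prod_map js h x \<in> V j" using IH Cons.prems(1) assms(3,4) component_invariant by auto
    then have "h i (prod_map js h x) = prod_map js h x"
      using component_fixes False Cons.prems(1) assms(3) by (meson list.set_intros(1))
    then show ?thesis using eq IH False by simp
  qed
qed

lemma linear_prod_map:
  assumes "\<And>i. i \<in> set js \<Longrightarrow> i < k \<and> h i \<in> H i"
  shows "linear (prod_map js h)"
  using assms
proof (induction js)
  case Nil
  then show ?case by (simp add: prod_map_def module_hom_ident id_def linear_ident)
next
  case (Cons i js)
  have "prod_map (i # js) h = h i \<circ> prod_map js h" by (simp add: prod_map_def)
  moreover have "linear (h i)" using Cons.prems linear_component by (meson list.set_intros(1))
  ultimately show ?case using Cons linear_compose[of "prod_map js h" "h i"]
    by (simp del: comp_apply)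
qed

abbreviation prod_all :: "(nat \<Rightarrow> 'a \<Rightarrow> 'a) \<Rightarrow> 'a \<Rightarrow> 'a" where
  "prod_all \<equiv> prod_map [0..<k]"

lemma prod_all_apply: "h \<in> PiE {..<k} H \<Longrightarrow> j < k \<Longrightarrow> x \<in> V j \<Longrightarrow> prod_all h x = h j x"
  using prod_map_apply[of "[0..<k]" h j x] by (auto simp: PiE_iff)

lemma linear_prod_all: "h \<in> PiE {..<k} H \<Longrightarrow> linear (prod_all h)"
  by (rule linear_prod_map) (auto simp: PiE_iff)

lemma prod_all_comp:
  assumes "h \<in> PiE {..<k} H" "h' \<in> PiE {..<k} H"
  shows "(\<lambda>i\<in>{..<k}. h i \<circ> h' i) \<in> PiE {..<k} H"
    and "prod_all (\<lambda>i\<in>{..<k}. h i \<circ> h' i) = prod_all h \<circ> prod_all h'"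
proof -
  show *: "(\<lambda>i\<in>{..<k}. h i \<circ> h' i) \<in> PiE {..<k} H"
    using assms refl by (auto simp: PiE_iff intro!: refl_group_comp simp del: comp_apply)
  show "prod_all (\<lambda>i\<in>{..<k}. h i \<circ> h' i) = prod_all h \<circ> prod_all h'"
  proof (rule decomposition_ext)
    show "linear (prod_all (\<lambda>i\<in>{..<k}. h i \<circ> h' i))" "linear (prod_all h \<circ> prod_all h')"
      using linear_prod_all[OF *] linear_compose[OF linear_prod_all[OF assms(2)] linear_prod_all[OF assms(1)]]
      by auto
    fix j x assume j: "j < k" "x \<in> V j"
    then have "h' j x \<in> V j" using assms(2) component_invariant by auto
    then show "prod_all (\<lambda>i\<in>{..<k}. h i \<circ> h' i) x = (prod_all h \<circ> prod_all h') x"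
      using prod_all_apply[OF * j] prod_all_apply[OF assms(2) j] prod_all_apply[OF assms(1) j(1)] j
      by simp
  qed
qed

lemma component_ext:
  assumes "j < k" "f \<in> H j" "g \<in> H j" "\<And>x. x \<in> V j \<Longrightarrow> f x = g x"
  shows "f = g"
  using assms component_fixes[of j] linear_component by (intro decomposition_ext) metis+

lemma inj_on_prod_all: "inj_on prod_all (PiE {..<k} H)"
proof (rule inj_onI)
  fix h h' assume h: "h \<in> PiE {..<k} H" "h' \<in> PiE {..<k} H" "prod_all h = prod_all h'"
  show "h = h'"
  proof (rule PiE_ext[OF h(1,2)])
    fix j assume "j \<in> {..<k}"
    then have j: "j < k" by simp
    show "h j = h' j"
      using h j by (intro component_ext[OF j]) (auto simp: prod_all_apply[OF _ j, symmetric])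
  qed
qed

lemma component_in_prod:
  assumes "j < k" "f \<in> H j"
  shows "f \<in> prod_all ` PiE {..<k} H"
proof -
  define h where "h = (\<lambda>i\<in>{..<k}. if i = j then f else id)"
  have h: "h \<in> PiE {..<k} H"
    unfolding h_def using refl_group_id[OF refl] assms(2) by (auto simp: PiE_iff simp del: id_apply)
  have "prod_all h = f"
  proof (rule decomposition_ext)
    fix i x assume i: "i < k" "x \<in> V i"
    then show "prod_all h x = f x"
      using prod_all_apply[OF h i] component_fixes[OF assms(1) i(1) _ assms(2) i(2)] by (auto simp: h_def)
  qed (use linear_prod_all[OF h] linear_component[OF assms] in auto)
  then show ?thesis using h by blast
qed

text \<open>Factors acting on orthogonal summands commute and are recovered from the product by
  restriction. So the homomorphism property and injectivity are automatic, and only the image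
  matters.\<close>

lemma is_direct_product_iff: "is_direct_product k H G \<longleftrightarrow> G = prod_all ` PiE {..<k} H"
proof -
  have eq: "(\<lambda>h. foldr (\<lambda>i f. h i \<circ> f) [0..<k] id) = prod_all" by (simp add: prod_map_def fun_eq_iff)
  show ?thesis
    unfolding is_direct_product_def eq iso_def hom_def bij_betw_def
    using inj_on_prod_all prod_all_comp(2) by auto
qed

end

locale refl_decomposition = orth_decomposition k V H for k V and H :: "nat \<Rightarrow> ('a::euclidean_space \<Rightarrow> 'a) set" +
  fixes G
  assumes G: "G = prod_all ` PiE {..<k} H"
    and finite_G: "finite G"
    and refl_G: "reflection_group UNIV G"
begin

lemma component_subset: "j < k \<Longrightarrow> H j \<subseteq> G"
  using component_in_prod G by blast

lemma finite_component: "j < k \<Longrightarrow> finite (H j)"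
  using component_subset finite_G finite_subset by blast

lemma group_apply:
  assumes "g \<in> G" "j < k" shows "\<exists>f\<in>H j. \<forall>x\<in>V j. g x = f x"
proof -
  have "g \<in> prod_all ` PiE {..<k} H" using assms(1) G by simp
  then obtain h where h: "g = prod_all h" "h \<in> PiE {..<k} H" by (rule imageE)
  show ?thesis
    using h(2) assms(2) prod_all_apply[OF h(2) assms(2)]
    by (intro bexI[of _ "h j"]) (auto simp: h(1))
qed

text \<open>Some component \<open>\<xi> j\<close> of \<open>\<gamma>\<close> is nonzero. The
  reflection moves it by a nonzero multiple of \<open>\<gamma>\<close> but keeps it in
  \<open>V j\<close>, so \<open>\<gamma>\<close> itself lies in \<open>V j\<close>.\<close>

lemma reflection_component:
  assumes "\<gamma> \<noteq> 0" "reflection \<gamma> \<in> G"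
  obtains j where "j < k" "\<gamma> \<in> V j" "reflection \<gamma> \<in> H j"
proof -
  obtain \<xi> where \<xi>: "\<And>i. i < k \<Longrightarrow> \<xi> i \<in> V i" "\<gamma> = (\<Sum>i<k. \<xi> i)" using components by blast
  have "\<exists>j<k. \<xi> j \<noteq> 0" using assms(1) \<xi>(2) by (metis lessThan_iff sum.neutral)
  then obtain j where j: "j < k" "\<xi> j \<noteq> 0" by blast
  obtain f where f: "f \<in> H j" "\<And>x. x \<in> V j \<Longrightarrow> reflection \<gamma> x = f x"
    using group_apply[OF assms(2) j(1)] by blast
  have "\<gamma> \<bullet> \<xi> j = \<xi> j \<bullet> \<xi> j"
    using inner_components[of \<xi>, OF \<xi>(1) j(1) \<xi>(1)[OF j(1)]] \<xi>(2) by (simp add: inner_commute)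
  then have nz: "\<gamma> \<bullet> \<xi> j \<noteq> 0" using j(2) by simp
  have "reflection \<gamma> (\<xi> j) \<in> V j" using f \<xi>(1) component_invariant j(1) by metis
  then have "\<xi> j - reflection \<gamma> (\<xi> j) \<in> V j" using \<xi>(1) j(1) subspace by (simp add: subspace_diff)
  moreover have "\<xi> j - reflection \<gamma> (\<xi> j) = (2 / (norm \<gamma>)\<^sup>2 * (\<gamma> \<bullet> \<xi> j)) *\<^sub>R \<gamma>"
    by (simp add: reflection_def)
  ultimately have "(1 / (2 / (norm \<gamma>)\<^sup>2 * (\<gamma> \<bullet> \<xi> j))) *\<^sub>R ((2 / (norm \<gamma>)\<^sup>2 * (\<gamma> \<bullet> \<xi> j)) *\<^sub>R \<gamma>) \<in> V j"
    using subspace j(1) by (metis subspace_scale)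
  then have \<gamma>: "\<gamma> \<in> V j" using nz assms(1) by simp
  have "reflection \<gamma> = f"
  proof (rule decomposition_ext)
    fix i x assume i: "i < k" "x \<in> V i"
    show "reflection \<gamma> x = f x"
    proof (cases "i = j")
      case False
      then have "reflection \<gamma> x = x" using orth[OF j(1) i(1) _ \<gamma> i(2)] by (simp add: reflection_orth)
      then show ?thesis using component_fixes[OF j(1) i(1) _ f(1) i(2)] False by simp
    qed (use f i in auto)
  qed (use linear_reflection linear_component[OF j(1) f(1)] in auto)
  then show ?thesis using that j(1) \<gamma> f(1) by blast
qed

section \<open>Simple systems, dual templates and coupling of a product\<close>

lemma simple_system_Union:
  assumes B: "\<And>i. i < k \<Longrightarrow> simple_system (V i) (H i) (B i)"
  shows "simple_system UNIV G (\<Union>i<k. B i)"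
proof -
  have BV: "\<alpha> \<in> V i" if "i < k" "\<alpha> \<in> B i" for i \<alpha> using B that by (auto simp: simple_system_def)
  have "\<exists>c. \<forall>i<k. c i \<in> V i \<and> (\<forall>\<alpha>\<in>B i. \<alpha> \<bullet> c i > 0)"
    using B unfolding simple_system_def by metis
  then obtain c where c: "\<And>i. i < k \<Longrightarrow> c i \<in> V i" "\<And>i \<alpha>. i < k \<Longrightarrow> \<alpha> \<in> B i \<Longrightarrow> \<alpha> \<bullet> c i > 0"
    by blast
  show ?thesis
    unfolding simple_system_def
  proof (intro conjI ballI impI)
    show "finite (\<Union>i<k. B i)" using B by (auto simp: simple_system_def)
  next
    fix \<alpha> assume "\<alpha> \<in> (\<Union>i<k. B i)"
    then obtain j where j: "j < k" "\<alpha> \<in> B j" by blast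
    have Bj: "norm \<alpha> = 1" "reflection \<alpha> \<in> H j"
      "\<exists>p\<in>V j. \<alpha> \<bullet> p = 0 \<and> (\<forall>\<beta>\<in>B j - {\<alpha>}. \<beta> \<bullet> p > 0)"
      using B[OF j(1)] j(2) by (auto simp: simple_system_def)
    show "\<alpha> \<in> UNIV" "norm \<alpha> = 1" "reflection \<alpha> \<in> G"
      using Bj component_subset j(1) by auto
    obtain p where p: "p \<in> V j" "\<alpha> \<bullet> p = 0" "\<And>\<beta>. \<beta> \<in> B j - {\<alpha>} \<Longrightarrow> \<beta> \<bullet> p > 0" using Bj(3) by blast
    \<comment> \<open>A wall point in the summand of \<open>\<alpha>\<close> together with interior
      points in all other summands.\<close>
    define \<xi> where "\<xi> = c(j := p)"
    have \<xi>: "\<xi> i \<in> V i" if "i < k" for i using c p that by (simp add: \<xi>_def)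
    have in\<xi>: "\<beta> \<bullet> (\<Sum>i<k. \<xi> i) = \<beta> \<bullet> \<xi> i" if "i < k" "\<beta> \<in> B i" for \<beta> i
      using inner_components[of \<xi>, OF \<xi> that(1) BV[OF that]] .
    show "\<exists>p\<in>UNIV. \<alpha> \<bullet> p = 0 \<and> (\<forall>\<beta>\<in>(\<Union>i<k. B i) - {\<alpha>}. \<beta> \<bullet> p > 0)"
    proof (intro bexI conjI ballI)
      show "\<alpha> \<bullet> (\<Sum>i<k. \<xi> i) = 0" using in\<xi>[OF j] p(2) by (simp add: \<xi>_def)
      fix \<beta> assume "\<beta> \<in> (\<Union>i<k. B i) - {\<alpha>}"
      then obtain i where i: "i < k" "\<beta> \<in> B i" "\<beta> \<noteq> \<alpha>" by blast
      then show "\<beta> \<bullet> (\<Sum>i<k. \<xi> i) > 0"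
        using in\<xi>[OF i(1,2)] p(3) c(2) by (cases "i = j") (auto simp: \<xi>_def)
    qed simp
  next
    have "\<alpha> \<bullet> (\<Sum>i<k. c i) > 0" if "i < k" "\<alpha> \<in> B i" for i \<alpha>
      using inner_components[of c, OF c(1) that(1) BV[OF that]] c(2)[OF that] by simp
    then show "\<exists>c\<in>UNIV. \<forall>\<alpha>\<in>(\<Union>i<k. B i). \<alpha> \<bullet> c > 0" by blast
  next
    fix \<gamma> x :: 'a assume \<gamma>: "\<gamma> \<noteq> 0 \<and> reflection \<gamma> \<in> G" and x: "\<forall>\<alpha>\<in>(\<Union>i<k. B i). \<alpha> \<bullet> x > 0"
    obtain j where j: "j < k" "\<gamma> \<in> V j" "reflection \<gamma> \<in> H j" using reflection_component \<gamma> by blast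
    obtain \<xi> where \<xi>: "\<And>i. i < k \<Longrightarrow> \<xi> i \<in> V i" "x = (\<Sum>i<k. \<xi> i)" using components by blast
    have "\<alpha> \<bullet> \<xi> j > 0" if "\<alpha> \<in> B j" for \<alpha>
      using x inner_components[of \<xi>, OF \<xi>(1) j(1) BV[OF j(1) that]] that j(1) \<xi>(2) by force
    then have "\<gamma> \<bullet> \<xi> j \<noteq> 0"
      using B[OF j(1)] \<gamma> j \<xi>(1)[OF j(1)] unfolding simple_system_def by blast
    then show "\<gamma> \<bullet> x \<noteq> 0" using inner_components[of \<xi>, OF \<xi>(1) j(1,2)] \<xi>(2) by simp
  qed
qed

lemma dual_templates_Union:
  assumes B: "\<And>i. i < k \<Longrightarrow> simple_system (V i) (H i) (B i)"
    and T: "\<And>i. i < k \<Longrightarrow> dual_templates (V i) (B i) (T i)"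
  shows "dual_templates UNIV (\<Union>i<k. B i) (\<Union>i<k. T i)"
proof -
  have BV: "\<alpha> \<in> V i" "\<alpha> \<noteq> 0" if "i < k" "\<alpha> \<in> B i" for i \<alpha>
    using B that by (force simp: simple_system_def)+
  have spanBV: "span (B i) \<subseteq> V i" if "i < k" for i
    using BV(1) subspace that by (simp add: span_minimal subsetI)
  define Q where "Q i \<omega> E \<longleftrightarrow> T i = \<omega> ` B i \<union> E \<and>
     dual_basis (B i) \<omega> \<and>
     orthonormal_basis {x\<in>V i. \<forall>\<alpha>\<in>B i. \<alpha> \<bullet> x = 0} E" for i \<omega> E
  have "\<forall>i. \<exists>\<omega> E. i < k \<longrightarrow> Q i \<omega> E"
  proof
    fix i
    show "\<exists>\<omega> E. i < k \<longrightarrow> Q i \<omega> E"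
      using T[of i] unfolding dual_templates_def Q_def by (cases "i < k") simp_all
  qed
  then obtain \<omega> E where "\<And>i. i < k \<Longrightarrow> Q i (\<omega> i) (E i)" by metis
  then have \<omega>: "\<And>i. i < k \<Longrightarrow> T i = \<omega> i ` B i \<union> E i"
     "\<And>i \<alpha>. i < k \<Longrightarrow> \<alpha> \<in> B i \<Longrightarrow> \<omega> i \<alpha> \<in> span (B i)"
     "\<And>i \<alpha> \<beta>. i < k \<Longrightarrow> \<alpha> \<in> B i \<Longrightarrow> \<beta> \<in> B i \<Longrightarrow> \<omega> i \<alpha> \<bullet> \<beta> = (if \<alpha> = \<beta> then 1 else 0)"
     and E: "\<And>i. i < k \<Longrightarrow> orthonormal_basis {x\<in>V i. \<forall>\<alpha>\<in>B i. \<alpha> \<bullet> x = 0} (E i)"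
    unfolding Q_def by auto
  have idx: "i = j" if "i < k" "j < k" "\<alpha> \<in> B i" "\<alpha> \<in> B j" for i j \<alpha>
    using orth[OF that(1,2) _ BV(1)[OF that(1,3)] BV(1)[OF that(2,4)]] BV(2)[OF that(1,3)] by auto
  \<comment> \<open>Roots of different summands are orthogonal and nonzero, so the index is unique
    and the dual bases can be glued to one function.\<close>
  define ind where "ind \<alpha> = (THE i. i < k \<and> \<alpha> \<in> B i)" for \<alpha>
  have ind: "ind \<alpha> = i" if "i < k" "\<alpha> \<in> B i" for i \<alpha>
    unfolding ind_def using that idx by (intro the_equality) auto
  define \<Omega> where "\<Omega> \<alpha> = \<omega> (ind \<alpha>) \<alpha>" for \<alpha>
  have \<Omega>: "\<Omega> \<alpha> = \<omega> i \<alpha>" if "i < k" "\<alpha> \<in> B i" for i \<alpha> using ind[OF that] by (simp add: \<Omega>_def)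
  have EV: "e \<in> V i" "\<forall>\<alpha>\<in>B i. \<alpha> \<bullet> e = 0" "norm e = 1" if "i < k" "e \<in> E i" for i e
    using E[OF that(1)] that(2) span_superset[of "E i"] unfolding orthonormal_basis_def by blast+
  show ?thesis
    unfolding dual_templates_def
  proof (intro exI conjI ballI)
    have "\<omega> i ` B i = \<Omega> ` B i" if "i < k" for i using \<Omega> that by auto
    then show "(\<Union>i<k. T i) = \<Omega> ` (\<Union>i<k. B i) \<union> (\<Union>i<k. E i)" using \<omega>(1) by auto
  next
    fix \<alpha> assume "\<alpha> \<in> (\<Union>i<k. B i)"
    then obtain i where i: "i < k" "\<alpha> \<in> B i" by blast
    show "\<Omega> \<alpha> \<in> span (\<Union>i<k. B i)"
      using \<omega>(2)[OF i] \<Omega>[OF i] span_mono[of "B i" "\<Union>i<k. B i"] i(1) by auto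
    fix \<beta> assume "\<beta> \<in> (\<Union>i<k. B i)"
    then obtain j where j: "j < k" "\<beta> \<in> B j" by blast
    show "\<Omega> \<alpha> \<bullet> \<beta> = (if \<alpha> = \<beta> then 1 else 0)"
    proof (cases "i = j")
      case True
      then show ?thesis using \<omega>(3) i j \<Omega> by simp
    next
      case False
      then have "\<Omega> \<alpha> \<bullet> \<beta> = 0"
        using orth[OF i(1) j(1) False _ BV(1)[OF j]] \<omega>(2)[OF i] spanBV[OF i(1)] \<Omega>[OF i] by auto
      moreover have "\<alpha> \<noteq> \<beta>" using False idx i j by blast
      ultimately show ?thesis by simp
    qed
  next
    show "orthonormal_basis {x\<in>UNIV. \<forall>\<alpha>\<in>(\<Union>i<k. B i). \<alpha> \<bullet> x = 0} (\<Union>i<k. E i)"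
      unfolding orthonormal_basis_def
    proof (intro conjI)
      show "pairwise orthogonal (\<Union>i<k. E i)"
      proof (rule pairwiseI)
        fix e e' assume "e \<in> (\<Union>i<k. E i)" "e' \<in> (\<Union>i<k. E i)" "e \<noteq> e'"
        then obtain i j where ij: "i < k" "e \<in> E i" "j < k" "e' \<in> E j" by blast
        show "orthogonal e e'"
        proof (cases "i = j")
          case True
          then show ?thesis
            using E[OF ij(1)] ij \<open>e \<noteq> e'\<close> unfolding orthonormal_basis_def pairwise_def by blast
        next
          case False
          then show ?thesis
            using orth[OF ij(1,3) False] EV ij by (auto simp: Linear_Algebra.orthogonal_def)
        qed
      qed
      show "\<forall>b\<in>(\<Union>i<k. E i). norm b = 1" using EV by blast
      let ?W = "{x\<in>UNIV. \<forall>\<alpha>\<in>(\<Union>i<k. B i). \<alpha> \<bullet> x = 0}"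
      show "span (\<Union>i<k. E i) = ?W"
      proof
        have "subspace ?W" by (auto simp: subspace_def inner_add_right)
        moreover have "(\<Union>i<k. E i) \<subseteq> ?W"
        proof -
          have "\<alpha> \<bullet> e = 0" if "i < k" "e \<in> E i" "j < k" "\<alpha> \<in> B j" for i j e \<alpha>
            using EV[OF that(1,2)] orth[of j i \<alpha> e] BV that by (cases "i = j") auto
          then show ?thesis by auto
        qed
        ultimately show "span (\<Union>i<k. E i) \<subseteq> ?W" by (rule span_minimal[rotated])
        show "?W \<subseteq> span (\<Union>i<k. E i)"
        proof
          fix x assume x: "x \<in> ?W"
          obtain \<xi> where \<xi>: "\<And>i. i < k \<Longrightarrow> \<xi> i \<in> V i" "x = (\<Sum>i<k. \<xi> i)" using components by blast
          have "\<xi> i \<in> span (\<Union>i<k. E i)" if i: "i < k" for i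
          proof -
            have "\<alpha> \<bullet> \<xi> i = 0" if "\<alpha> \<in> B i" for \<alpha>
              using inner_components[of \<xi>, OF \<xi>(1) i BV(1)[OF i that]] x \<xi>(2) i that by force
            then have "\<xi> i \<in> span (E i)" using E[OF i] \<xi>(1)[OF i] unfolding orthonormal_basis_def by blast
            then show ?thesis using span_mono[of "E i" "\<Union>i<k. E i"] i by blast
          qed
          then show "x \<in> span (\<Union>i<k. E i)" unfolding \<xi>(2) by (intro span_sum) auto
        qed
      qed
    qed
  qed
qed

text \<open>The Gram matrix of the union is block diagonal, so the extreme value of its form is
  attained on the worst block. Conversely, coefficients on one block are extended by zero.\<close>

lemma coupling_Union:
  assumes B: "\<And>i. i < k \<Longrightarrow> simple_system (V i) (H i) (B i)" and "k > 0"
  shows "coupling (\<Union>i<k. B i) = Max ((\<lambda>i. coupling (B i)) ` {..<k})"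
proof (rule antisym)
  have BV: "\<alpha> \<in> V i" "\<alpha> \<noteq> 0" if "i < k" "\<alpha> \<in> B i" for i \<alpha>
    using B that by (force simp: simple_system_def)+
  have fin: "finite (B i)" if "i < k" for i using B[OF that] by (simp add: simple_system_def)
  have disj: "B i \<inter> B j = {}" if "i < k" "j < k" "i \<noteq> j" for i j
    using orth[OF that] BV that by force
  let ?M = "Max ((\<lambda>i. coupling (B i)) ` {..<k})"
  have M: "coupling (B i) \<le> ?M" if "i < k" for i using that by simp
  show "coupling (\<Union>i<k. B i) \<le> ?M"
  proof (rule coupling_le)
    show "0 \<le> ?M" using M[of 0] coupling_nonneg[of "B 0"] assms(2) by linarith
    fix v :: "'a \<Rightarrow> real" assume 1: "(\<Sum>\<alpha>\<in>(\<Union>i<k. B i). (v \<alpha>)\<^sup>2) = 1"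
    have U: "sum f (\<Union>i<k. B i) = (\<Sum>i<k. sum f (B i))" for f :: "'a \<Rightarrow> 'b::comm_monoid_add"
      using fin disj by (intro sum.UNION_disjoint) auto
    let ?x = "\<lambda>i. \<Sum>\<alpha>\<in>B i. v \<alpha> *\<^sub>R \<alpha>"
    have xV: "?x i \<in> V i" if "i < k" for i
      using BV that subspace by (intro subspace_sum) (auto intro: subspace_scale)
    have "(norm (\<Sum>i<k. ?x i))\<^sup>2 = (\<Sum>i<k. ?x i \<bullet> (\<Sum>i<k. ?x i))"
      by (simp add: power2_norm_eq_inner inner_sum_left)
    also have "\<dots> = (\<Sum>i<k. (norm (?x i))\<^sup>2)"
      using inner_components[of ?x, OF xV] xV by (intro sum.cong) (auto simp: power2_norm_eq_inner)
    finally have n: "(norm (\<Sum>i<k. ?x i))\<^sup>2 = (\<Sum>i<k. (norm (?x i))\<^sup>2)" .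
    have "(1 - ?M) * (\<Sum>\<alpha>\<in>B i. (v \<alpha>)\<^sup>2) \<le> (norm (?x i))\<^sup>2" if "i < k" for i
    proof -
      have "(1 - ?M) * (\<Sum>\<alpha>\<in>B i. (v \<alpha>)\<^sup>2) \<le> (1 - coupling (B i)) * (\<Sum>\<alpha>\<in>B i. (v \<alpha>)\<^sup>2)"
        using M[OF that] by (intro mult_right_mono) (auto simp: sum_nonneg)
      then show ?thesis using gram_lower_bound[OF fin[OF that], of v] by linarith
    qed
    then have "(\<Sum>i<k. (1 - ?M) * (\<Sum>\<alpha>\<in>B i. (v \<alpha>)\<^sup>2)) \<le> (norm (\<Sum>i<k. ?x i))\<^sup>2"
      unfolding n by (intro sum_mono) auto
    then have "(1 - ?M) * (\<Sum>\<alpha>\<in>(\<Union>i<k. B i). (v \<alpha>)\<^sup>2) \<le> (norm (lin_comb v (\<Union>i<k. B i)))\<^sup>2"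
      unfolding U by (simp add: sum_distrib_left)
    then show "1 - (norm (lin_comb v (\<Union>i<k. B i)))\<^sup>2 \<le> ?M" using 1 by simp
  qed
  have "coupling (B i) \<le> coupling (\<Union>i<k. B i)" if i: "i < k" for i
  proof (rule coupling_le[OF coupling_nonneg])
    fix v :: "'a \<Rightarrow> real" assume 1: "(\<Sum>\<alpha>\<in>B i. (v \<alpha>)\<^sup>2) = 1"
    define w where "w \<alpha> = (if \<alpha> \<in> B i then v \<alpha> else 0)" for \<alpha>
    have fU: "finite (\<Union>i<k. B i)" using fin by blast
    have "(\<Sum>\<alpha>\<in>(\<Union>i<k. B i). (w \<alpha>)\<^sup>2) = (\<Sum>\<alpha>\<in>B i. (v \<alpha>)\<^sup>2)"
      using fU i by (intro sum.mono_neutral_cong_right) (auto simp: w_def)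
    moreover have "(lin_comb w (\<Union>i<k. B i)) = (lin_comb v (B i))"
      using fU i by (intro sum.mono_neutral_cong_right) (auto simp: w_def)
    ultimately show "1 - (norm (lin_comb v (B i)))\<^sup>2 \<le> coupling (\<Union>i<k. B i)"
      using gram_lower_bound[OF fU, of w] 1 by simp
  qed
  then show "?M \<le> coupling (\<Union>i<k. B i)" using assms(2) by (intro Max.boundedI) auto
qed

lemma simple_refl_component:
  "i < k \<Longrightarrow> simple_system (V i) (H i) B \<Longrightarrow> simple_refl (V i) (H i) B"
  by (simp add: simple_refl_def subspace finite_component refl)

lemma simple_refl_Union:
  "(\<And>i. i < k \<Longrightarrow> simple_system (V i) (H i) (B i)) \<Longrightarrow> simple_refl UNIV G (\<Union>i<k. B i)"
  by (simp add: simple_refl_def finite_G refl_G simple_system_Union)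

text \<open>\<open>coupling_cond\<close> is monotone in a coupling between 0 and 1, so the maximum
  passes from couplings to condition numbers.\<close>

lemma opt_cond_Max:
  assumes "\<And>i. i < k \<Longrightarrow> V i \<noteq> {0}" "k > 0"
  shows "opt_cond UNIV G = Max ((\<lambda>i. opt_cond (V i) (H i)) ` {..<k})"
proof -
  have "\<forall>i<k. \<exists>B. simple_system (V i) (H i) B"
    using exists_simple_system subspace finite_component by blast
  then obtain B where B: "\<And>i. i < k \<Longrightarrow> simple_system (V i) (H i) (B i)" by metis
  have U: "(UNIV :: 'a set) \<noteq> {0}" using assms subspace_0[OF subspace] by blast
  interpret U: simple_refl UNIV G "\<Union>i<k. B i" using simple_refl_Union B by blast
  have oi: "opt_cond (V i) (H i) = coupling_cond (B i)" if "i < k" for i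
    using simple_refl.opt_cond_eq[OF simple_refl_component] that B assms(1) by blast
  let ?C = "(\<lambda>i. coupling (B i)) ` {..<k}"
  have cU: "coupling (\<Union>i<k. B i) = Max ?C" using coupling_Union B assms(2) by blast
  have "Max ?C \<in> ?C" using assms(2) by (intro Max_in) auto
  then obtain j where j: "j < k" "Max ?C = coupling (B j)" by auto
  have "coupling_cond (B i) \<le> coupling_cond (B j)" if "i < k" for i
  proof -
    have "coupling (B i) \<le> coupling (B j)" using j that by (metis Max_ge finite_imageI finite_lessThan imageI lessThan_iff)
    moreover have "coupling (B j) < 1" using U.coupling_less_1 cU j by simp
    ultimately show ?thesis unfolding coupling_cond_def using coupling_nonneg[of "B i"]
      by (intro frac_le) auto
  qed
  then have "Max ((\<lambda>i. opt_cond (V i) (H i)) ` {..<k}) = coupling_cond (B j)"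
    using j(1) oi by (intro Max_eqI) auto
  moreover have "opt_cond UNIV G = coupling_cond (B j)"
    using U.opt_cond_eq[OF U] cU j(2) by (simp add: coupling_cond_def)
  ultimately show ?thesis by simp
qed

end

section \<open>Decomposition into irreducible constituents\<close>

lemma reflection_in_words: "u \<in> S \<Longrightarrow> reflection u \<in> refl_word ` lists S"
proof -
  assume "u \<in> S"
  then have "refl_word [u] \<in> refl_word ` lists S" by (intro imageI) simp
  then show ?thesis by simp
qed

lemma orth_spans:
  assumes "\<And>a b. a \<in> S \<Longrightarrow> b \<in> T \<Longrightarrow> a \<bullet> b = 0" "x \<in> span S" "y \<in> span T"
  shows "x \<bullet> y = (0::real)"
proof -
  have 1: "a \<bullet> y = 0" if "a \<in> S" for a
    using assms(3)
  proof (induction rule: span_induct)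
    case base
    show ?case by (auto simp: subspace_def inner_add_right)
  qed (use assms(1) that in auto)
  show ?thesis
    using assms(2)
  proof (induction rule: span_induct)
    case base
    show ?case by (auto simp: subspace_def inner_add_left)
  qed (use 1 in auto)
qed

text \<open>Conjugating \<open>reflection v\<close> by \<open>reflection u\<close> gives the
  reflection in \<open>reflection u v\<close>; if they commute, this vector is a multiple of
  \<open>v\<close>. It differs from \<open>v\<close> by a multiple of \<open>u\<close>, so unless
  that multiple is zero, \<open>u\<close> and \<open>v\<close> are parallel and the reflections
  coincide.\<close>

lemma commuting_reflections:
  assumes "reflection u \<circ> reflection v = reflection v \<circ> reflection u"
    and "reflection u \<noteq> reflection v" "u \<noteq> 0" "v \<noteq> 0"
  shows "u \<bullet> v = 0"
proof (rule ccontr)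
  assume uv: "u \<bullet> v \<noteq> 0"
  have "reflection (reflection u v) = reflection v"
  proof
    fix x
    have "reflection u (reflection v (reflection u x)) = reflection (reflection u v) (reflection u (reflection u x))"
      by (rule reflection_conj[OF isometry_reflection])
    moreover have "reflection u (reflection v (reflection u x)) = reflection v (reflection u (reflection u x))"
      using assms(1) by (metis comp_apply)
    ultimately show "reflection (reflection u v) x = reflection v x" by simp
  qed
  moreover have "reflection u v \<noteq> 0" using inner_reflection[of u v v] assms(4) by force
  ultimately obtain s where s: "reflection u v = s *\<^sub>R v"
    using reflection_eq_parallel[OF _ _ assms(4)] by metis
  define r where "r = 2 / (norm u)\<^sup>2 * (u \<bullet> v)"
  have r: "r \<noteq> 0" using uv assms(3) by (simp add: r_def)
  have "v - r *\<^sub>R u = s *\<^sub>R v" using s by (simp add: reflection_def r_def)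
  then have "r *\<^sub>R u = (1 - s) *\<^sub>R v" by (simp add: algebra_simps)
  then have "u = ((1 - s) / r) *\<^sub>R v"
    using r by (metis divide_inverse_commute real_vector_eq_affinity scaleR_scaleR vector_fraction_eq_iff inverse_eq_divide scaleR_one left_inverse)
  then show False using reflection_scaleR[of "(1 - s) / r" v] assms(2,3) by force
qed

lemma foldr_single:
  "distinct js \<Longrightarrow> foldr (\<lambda>i g. (if i = j then f else id) \<circ> g) js id = (if j \<in> set js then f else id)"
  by (induction js) (auto simp: fun_eq_iff)

lemma foldr_comp_induct:
  "P x \<Longrightarrow> (\<And>i y. i \<in> set js \<Longrightarrow> P y \<Longrightarrow> P (h i y)) \<Longrightarrow> P (foldr (\<lambda>i f. h i \<circ> f) js id x)"
  by (induction js) auto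

text \<open>
  If \<open>G\<close> were a product of reflection groups, every vector of \<open>K\<close> would lie in the span of the roots
  of one factor, and connectedness would put all of \<open>K\<close> into the same one.
\<close>

lemma irreducible_on_connected:
  assumes K: "K \<subseteq> - {0}"
    and connected: "\<And>S. S \<inter> K \<noteq> {} \<Longrightarrow> (\<And>\<gamma> \<delta>. \<gamma> \<in> S \<inter> K \<Longrightarrow> \<delta> \<in> K \<Longrightarrow> \<gamma> \<bullet> \<delta> \<noteq> 0 \<Longrightarrow> \<delta> \<in> S) \<Longrightarrow> K \<subseteq> S"
  shows "irreducible_on (span K) (refl_word ` lists K)"
proof
  let ?V = "span K" and ?G = "refl_word ` lists K"
  assume "reducible ?V ?G"
  then obtain k H where k: "k \<ge> 2" and H: "\<And>i. i < k \<Longrightarrow> reflection_group ?V (H i)"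
    "\<And>i. i < k \<Longrightarrow> H i \<noteq> {id}" and prod: "is_direct_product k H ?G"
    unfolding reducible_def by blast
  define \<psi> where "\<psi> h = foldr (\<lambda>i f. h i \<circ> f) [0..<k] id" for h :: "nat \<Rightarrow> 'a \<Rightarrow> 'a"
  have \<psi>: "\<psi> ` PiE {..<k} H = ?G" "inj_on \<psi> (PiE {..<k} H)"
    "\<And>x y. x \<in> PiE {..<k} H \<Longrightarrow> y \<in> PiE {..<k} H \<Longrightarrow> \<psi> (\<lambda>i\<in>{..<k}. x i \<circ> y i) = \<psi> x \<circ> \<psi> y"
    using prod unfolding is_direct_product_def \<psi>_def[abs_def] iso_def hom_def bij_betw_def by auto
  \<comment> \<open>Tuples with one prescribed entry embed the factors into the product. Different
    places commute, and injectivity of \<open>\<psi>\<close> makes two factors meet only in the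
    identity.\<close>
  define single where "single j f = (\<lambda>i\<in>{..<k}. if i = j then f else id)" for j and f :: "'a \<Rightarrow> 'a"
  have single: "single j f \<in> PiE {..<k} H" if "f \<in> H j" for j f
    unfolding single_def using refl_group_id[OF H(1)] that by (auto simp: PiE_iff simp del: id_apply)
  have \<psi>_single: "\<psi> (single j f) = f" if "j < k" for j f
  proof -
    have "\<psi> (single j f) = foldr (\<lambda>i g. (if i = j then f else id) \<circ> g) [0..<k] id"
      unfolding \<psi>_def single_def by (rule foldr_cong) auto
    then show ?thesis using foldr_single[of "[0..<k]" j f] that by simp
  qed
  have commute: "f \<circ> g = g \<circ> f" if "i < k" "j < k" "i \<noteq> j" "f \<in> H i" "g \<in> H j" for i j f g
  proof -
    have "(\<lambda>l\<in>{..<k}. single i f l \<circ> single j g l) = (\<lambda>l\<in>{..<k}. single j g l \<circ> single i f l)"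
      using that(3) by (auto simp: single_def fun_eq_iff)
    then have "\<psi> (single i f) \<circ> \<psi> (single j g) = \<psi> (single j g) \<circ> \<psi> (single i f)"
      using \<psi>(3)[OF single[OF that(4)] single[OF that(5)]] \<psi>(3)[OF single[OF that(5)] single[OF that(4)]]
      by (simp only:)
    then show ?thesis unfolding \<psi>_single[OF that(1)] \<psi>_single[OF that(2)] .
  qed
  have inter: "f = id" if "i < k" "j < k" "i \<noteq> j" "f \<in> H i" "f \<in> H j" for i j f
  proof -
    have "single i f = single j f"
      using \<psi>(2) single[OF that(4)] single[OF that(5)] \<psi>_single that(1,2) by (metis inj_onD)
    then have "single i f i = single j f i" by simp
    then show ?thesis using that(1,3) by (simp add: single_def)
  qed
  have "\<exists>U. i < k \<longrightarrow> U \<subseteq> ?V - {0} \<and> H i = refl_word ` lists U" for i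
    using H(1)[of i] unfolding refl_group_iff by (cases "i < k") simp_all
  then have "\<forall>i. \<exists>U. i < k \<longrightarrow> U \<subseteq> ?V - {0} \<and> H i = refl_word ` lists U" by (rule allI)
  then obtain U where U: "\<And>i. i < k \<Longrightarrow> U i \<subseteq> ?V - {0}" "\<And>i. i < k \<Longrightarrow> H i = refl_word ` lists (U i)"
    by metis
  have U_refl: "reflection u \<in> H i" if "i < k" "u \<in> U i" for i u
    using reflection_in_words[OF that(2)] U(2)[OF that(1)] by simp
  have U_ne: "U i \<noteq> {}" if "i < k" for i
    using H(2)[OF that] U(2)[OF that] by auto
  \<comment> \<open>Reducibility is a condition on groups, all of whose factors may act on the whole
    of \<open>?V\<close>; orthogonality of their roots has to be won from commutation.\<close>
  have U_orth: "u \<bullet> v = 0" if "i < k" "j < k" "i \<noteq> j" "u \<in> U i" "v \<in> U j" for i j u v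
  proof (rule commuting_reflections)
    have nz: "u \<noteq> 0" "v \<noteq> 0" using U(1) that by blast+
    then show "u \<noteq> 0" "v \<noteq> 0" by auto
    show "reflection u \<circ> reflection v = reflection v \<circ> reflection u"
      using commute U_refl that by blast
    show "reflection u \<noteq> reflection v"
      using inter[OF that(1,2,3), of "reflection u"] U_refl that reflection_ne_id nz by metis
  qed
  have W_orth: "x \<bullet> y = 0" if "i < k" "j < k" "i \<noteq> j" "x \<in> span (U i)" "y \<in> span (U j)" for i j x y
    using orth_spans[of "U i" "U j" x y] U_orth that by blast
  have Hfix: "f x = x" if "i < k" "f \<in> H i" "\<And>u. u \<in> U i \<Longrightarrow> u \<bullet> x = 0" for i f x
    using that(2,3) U(2)[OF that(1)] by (auto intro!: refl_word_orth)
  have Hinv: "f x \<in> span (U j)" if ij: "i < k" "j < k" "f \<in> H i" "x \<in> span (U j)" for i j f x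
  proof (cases "i = j")
    case True
    then obtain us where "us \<in> lists (U j)" "f = refl_word us" using U(2)[OF ij(2)] ij(3) by auto
    then show ?thesis
      using that(4) span_superset[of "U j"] by (auto intro!: refl_word_in_subspace)
  next
    case False
    then have "f x = x" using Hfix[OF that(1,3)] W_orth[OF that(1,2) False] that(4) span_base by metis
    then show ?thesis using that(4) by simp
  qed
  \<comment> \<open>A predicate kept by every factor is kept by the whole group. It serves for the
    invariance of a span and for a common fixed vector.\<close>
  have Gind: "P (g x)" if "g \<in> ?G" "P x" "\<And>i f y. i < k \<Longrightarrow> f \<in> H i \<Longrightarrow> P y \<Longrightarrow> P (f y)" for P g x
  proof -
    have "g \<in> \<psi> ` PiE {..<k} H" using that(1) \<psi>(1) by simp
    then obtain h where h: "g = \<psi> h" "h \<in> PiE {..<k} H" by (rule imageE)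
    show ?thesis unfolding h(1) \<psi>_def
    proof (rule foldr_comp_induct[where P = P, OF that(2)])
      fix i y assume "i \<in> set [0..<k]" "P y"
      then show "P (h i y)" using that(3)[of i "h i" y] h(2) by (auto simp: PiE_iff)
    qed
  qed
  note refl_G = reflection_in_words[of _ K]
  have in_W: "\<alpha> \<in> span (U j)" if "\<alpha> \<in> K" "j < k" "x \<in> span (U j)" "\<alpha> \<bullet> x \<noteq> 0" for \<alpha> j x
  proof -
    have "\<alpha> \<noteq> 0" using K that(1) by blast
    define r where "r = 2 / (norm \<alpha>)\<^sup>2 * (\<alpha> \<bullet> x)"
    have r: "r \<noteq> 0" using that(4) \<open>\<alpha> \<noteq> 0\<close> by (simp add: r_def)
    have "reflection \<alpha> x \<in> span (U j)"
      by (rule Gind[where P = "\<lambda>y. y \<in> span (U j)", OF refl_G[OF that(1)] that(3)])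
        (rule Hinv[OF _ that(2)])
    then have "x - reflection \<alpha> x \<in> span (U j)" using that(3) by (simp add: span_diff)
    moreover have "x - reflection \<alpha> x = r *\<^sub>R \<alpha>" by (simp add: reflection_def r_def)
    ultimately have "(1 / r) *\<^sub>R (r *\<^sub>R \<alpha>) \<in> span (U j)" by (metis span_scale)
    then show ?thesis using r by simp
  qed
  \<comment> \<open>Otherwise \<open>\<alpha>\<close> is orthogonal to the roots of all factors and
    hence fixed by the whole group, although its own reflection negates it.\<close>
  have ex_W: "\<exists>j<k. \<alpha> \<in> span (U j)" if \<alpha>: "\<alpha> \<in> K" for \<alpha>
  proof (rule ccontr)
    assume *: "\<not> ?thesis"
    have "u \<bullet> \<alpha> = 0" if "j < k" "u \<in> U j" for j u
      using in_W[OF \<alpha> that(1) span_base[OF that(2)]] * that(1) by (auto simp: inner_commute)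
    then have "f \<alpha> = \<alpha>" if "i < k" "f \<in> H i" for i f using Hfix that by blast
    then have "reflection \<alpha> \<alpha> = \<alpha>"
      by (intro Gind[where P = "\<lambda>y. y = \<alpha>", OF refl_G[OF \<alpha>]]) auto
    then show False using reflection_fix_iff[of \<alpha> \<alpha>] K \<alpha> by auto
  qed
  have "K \<noteq> {}"
    using U_ne[of 0] U(1)[of 0] k by force
  then obtain \<alpha> where "\<alpha> \<in> K" by blast
  then obtain j where j: "j < k" "\<alpha> \<in> span (U j)" using ex_W by blast
  have "K \<subseteq> span (U j)"
  proof (rule connected)
    show "span (U j) \<inter> K \<noteq> {}" using j \<open>\<alpha> \<in> K\<close> by blast
    show "\<delta> \<in> span (U j)" if "\<gamma> \<in> span (U j) \<inter> K" "\<delta> \<in> K" "\<gamma> \<bullet> \<delta> \<noteq> 0" for \<gamma> \<delta>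
      using in_W[OF that(2) j(1), of \<gamma>] that by (simp add: inner_commute)
  qed
  \<comment> \<open>A second factor would have its roots in this span and orthogonal to it at the
    same time.\<close>
  then have VW: "?V \<subseteq> span (U j)" by (simp add: span_minimal)
  obtain i where i: "i < k" "i \<noteq> j"
    using k that[of 0] that[of 1] by (cases "j = 0") auto
  obtain u where "u \<in> U i" using U_ne[OF i(1)] by blast
  then have "u \<bullet> u = 0" "u \<noteq> 0"
    using W_orth[OF i(1) j(1) i(2) span_base] U(1)[OF i(1)] VW by blast+
  then show False by simp
qed

text \<open>The nontrivial constituents are generated by the connected components of the Coxeter
  graph, each acting on the span of its roots. Distinct components are orthogonal, which makes the
  product direct; connectedness excludes a finer product.\<close>

lemma exists_irreducible_decomposition:
  fixes G :: "('a::euclidean_space \<Rightarrow> 'a) set"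
  assumes "finite G" "reflection_group UNIV G"
  shows "\<exists>k V H. irreducible_decomposition G k V H"
proof -
  obtain B where B: "simple_system UNIV G B" using exists_simple_system assms(1) subspace_UNIV by blast
  interpret simple_refl UNIV G B by (simp add: simple_refl_def assms B)
  define R where "R = {(\<alpha>, \<beta>) \<in> B \<times> B. \<alpha> \<bullet> \<beta> \<noteq> 0}"
  define comp where "comp \<alpha> = {\<beta>\<in>B. (\<alpha>, \<beta>) \<in> R\<^sup>*}" for \<alpha>
  have "sym R" by (auto simp: R_def sym_def inner_commute)
  then have "sym (R\<^sup>*)" by (rule sym_rtrancl)
  have comp_eq: "comp \<beta> = comp \<alpha>" if "\<beta> \<in> comp \<alpha>" for \<alpha> \<beta>
    using that \<open>sym (R\<^sup>*)\<close> unfolding comp_def sym_def by (auto intro: rtrancl_trans)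
  have comp_self: "\<alpha> \<in> comp \<alpha>" if "\<alpha> \<in> B" for \<alpha> using that by (simp add: comp_def)
  have "finite (comp ` B)" using finite_B by simp
  then obtain K where K: "bij_betw K {0..<card (comp ` B)} (comp ` B)"
    using ex_bij_betw_nat_finite by blast
  define m where "m = card (comp ` B)"
  have Kc: "\<exists>\<alpha>\<in>B. K i = comp \<alpha>" if "i < m" for i
  proof -
    have "K i \<in> comp ` B" using bij_betwE[OF K] that by (auto simp: m_def simp del: image_iff)
    then show ?thesis by blast
  qed
  have KB: "K i \<subseteq> B" "K i \<noteq> {}" if "i < m" for i
    using Kc[OF that] comp_self by (auto simp: comp_def)
  have KU: "\<exists>i<m. \<alpha> \<in> K i" if "\<alpha> \<in> B" for \<alpha>
  proof -
    have "comp \<alpha> \<in> K ` {0..<m}" using K that by (simp add: bij_betw_def m_def)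
    then show ?thesis using comp_self[OF that] by auto
  qed
  have Korth: "\<alpha> \<bullet> \<beta> = 0" if "i < m" "j < m" "i \<noteq> j" "\<alpha> \<in> K i" "\<beta> \<in> K j" for i j \<alpha> \<beta>
  proof (rule ccontr)
    assume "\<alpha> \<bullet> \<beta> \<noteq> 0"
    then have "\<beta> \<in> comp \<alpha>" using KB that by (auto simp: comp_def R_def)
    then have "comp \<alpha> = comp \<beta>" using comp_eq by blast
    moreover have "K i = comp \<alpha>" "K j = comp \<beta>" using Kc that comp_eq by metis+
    ultimately have "K i = K j" by simp
    then show False using K that(1-3) by (auto simp: bij_betw_def inj_on_def m_def)
  qed
  have Kconn: "K i \<subseteq> S" if i: "i < m" "S \<inter> K i \<noteq> {}"
    and S: "\<And>\<gamma> \<delta>. \<gamma> \<in> S \<inter> K i \<Longrightarrow> \<delta> \<in> K i \<Longrightarrow> \<gamma> \<bullet> \<delta> \<noteq> 0 \<Longrightarrow> \<delta> \<in> S" for i S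
  proof
    fix \<beta> assume "\<beta> \<in> K i"
    obtain \<alpha> where \<alpha>: "\<alpha> \<in> S" "\<alpha> \<in> K i" using i by blast
    have Ki: "K i = comp \<alpha>" using Kc i \<alpha> comp_eq by metis
    have "(\<alpha>, \<beta>) \<in> R\<^sup>*" using \<open>\<beta> \<in> K i\<close> Ki by (simp add: comp_def)
    then have "\<beta> \<in> S \<inter> K i"
    proof (induction rule: rtrancl_induct)
      case base
      then show ?case using \<alpha> by simp
    next
      case (step \<gamma> \<delta>)
      then have "\<delta> \<in> K i" unfolding Ki comp_def R_def by (auto intro: rtrancl_into_rtrancl)
      then show ?case using S[of \<gamma> \<delta>] step by (auto simp: R_def)
    qed
    then show "\<beta> \<in> S" by blast
  qed
  define W where "W = {x. \<forall>\<alpha>\<in>B. \<alpha> \<bullet> x = 0}"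
  \<comment> \<open>The index \<open>m\<close> is reserved for the trivial group on the orthogonal
    complement of \<open>B\<close>, and it occurs only if \<open>G\<close> has nonzero fixed
    points.\<close>
  define k where "k = (if essential UNIV G then m else Suc m)"
  define V where "V i = (if i < m then span (K i) else W)" for i
  define H where "H i = (if i < m then refl_word ` lists (K i) else {id})" for i
  have sub: "subspace (V i)" for i
    by (auto simp: V_def W_def subspace_def inner_add_right span_add span_scale span_zero)
  have W_span: "x \<bullet> y = 0" if "x \<in> span B" "y \<in> W" for x y
    using orth_spans[of B "{y}" x y] that by (auto simp: W_def span_base)
  have orth: "x \<bullet> y = 0" if ij: "i < k" "j < k" "i \<noteq> j" "x \<in> V i" "y \<in> V j" for i j x y
  proof -
    have VB: "V l \<subseteq> span B" if "l < m" for l using that KB by (simp add: V_def span_mono)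
    consider "i < m" "j < m" | "i < m" "j = m" | "i = m" "j < m"
      using ij(1-3) unfolding k_def by (auto simp: less_Suc_eq split: if_splits)
    then show ?thesis
    proof cases
      case 1
      then show ?thesis using orth_spans[of "K i" "K j" x y] Korth ij by (auto simp: V_def)
    next
      case 2
      then show ?thesis using W_span VB ij by (auto simp: V_def)
    next
      case 3
      then show ?thesis using W_span[of y x] VB ij by (auto simp: V_def inner_commute)
    qed
  qed
  have mk: "m \<le> k" by (simp add: k_def)
  have BV: "B \<subseteq> span (\<Union>i<k. V i)"
    using KU mk by (force simp: V_def intro!: span_base)
  have span_V: "span (\<Union>i<k. V i) = UNIV"
  proof (cases "essential UNIV G")
    case True
    then show ?thesis using essential_span BV by (metis span_minimal subspace_span top.extremum_uniqueI)
  next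
    case False
    have "x \<in> span (\<Union>i<k. V i)" for x
    proof -
      obtain y z where yz: "y \<in> span B" "\<And>w. w \<in> span B \<Longrightarrow> orthogonal z w" "x = y + z"
        using orthogonal_subspace_decomp_exists[of B x] by metis
      have "z \<in> W" using yz(2) by (auto simp: W_def Linear_Algebra.orthogonal_def span_base inner_commute)
      then have "z \<in> V m" by (simp add: V_def)
      then have "z \<in> span (\<Union>i<k. V i)" using False by (intro span_base) (auto simp: k_def)
      moreover have "y \<in> span (\<Union>i<k. V i)" using yz(1) BV by (metis span_minimal subspace_span subset_iff)
      ultimately show ?thesis unfolding yz(3) by (rule span_add[rotated])
    qed
    then show ?thesis by blast
  qed
  have refl: "reflection_group (V i) (H i)" for i
    unfolding refl_group_iff
  proof (cases "i < m")
    case True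
    then have "K i \<subseteq> V i - {0}" using KB(1) B_nonzero by (auto simp: V_def span_base)
    then show "\<exists>U\<subseteq>V i - {0}. H i = refl_word ` lists U" using True by (auto simp: H_def)
  next
    case False
    then have "H i = refl_word ` lists {}" by (simp add: H_def)
    then show "\<exists>U\<subseteq>V i - {0}. H i = refl_word ` lists U" by blast
  qed
  interpret D: orth_decomposition k V H
    by (unfold_locales) (use sub orth span_V refl in auto)
  have HG: "H i \<subseteq> G" for i
  proof (cases "i < m")
    case True
    then have "lists (K i) \<subseteq> lists B" using KB by blast
    then show ?thesis using True generated_by_simple by (auto simp: H_def)
  next
    case False
    then show ?thesis using refl_group_id[OF refl_G] by (simp add: H_def)
  qed
  have prod: "G = D.prod_all ` PiE {..<k} H"
  proof
    show "D.prod_all ` PiE {..<k} H \<subseteq> G"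
    proof
      fix g assume "g \<in> D.prod_all ` PiE {..<k} H"
      then obtain h where h: "g = D.prod_all h" "h \<in> PiE {..<k} H" by (rule imageE)
      have "prod_map js h \<in> G" if "set js \<subseteq> {..<k}" for js
        using that
      proof (induction js)
        case Nil
        have "prod_map [] h = id" by (simp add: prod_map_def)
        then show ?case using refl_group_id[OF refl_G] by (simp only:)
      next
        case (Cons j js)
        have "prod_map (j # js) h = h j \<circ> prod_map js h" by (simp add: prod_map_def)
        moreover have "h j \<in> G" using Cons.prems h(2) HG by auto
        ultimately show ?case using Cons refl_group_comp[OF refl_G] by (simp del: comp_apply)
      qed
      from this[of "[0..<k]"] show "g \<in> G" unfolding h(1) by (simp add: atLeast0LessThan)
    qed
    \<comment> \<open>The reflection of a letter lies in the factor of its component, and the image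
      of the product map is closed under composition.\<close>
    have *: "refl_word us \<in> D.prod_all ` PiE {..<k} H" if "us \<in> lists B" for us
      using that
    proof (induction us)
      case Nil
      have "(\<lambda>i\<in>{..<k}. id) \<in> PiE {..<k} H"
        using refl_group_id[OF refl] by (auto simp: PiE_iff simp del: id_apply)
      note 1 = this
      have "D.prod_all (\<lambda>i\<in>{..<k}. id) = id"
      proof (rule D.decomposition_ext[OF D.linear_prod_all[OF 1] linear_id])
        fix j x assume j: "j < k" "x \<in> V j"
        show "D.prod_all (\<lambda>i\<in>{..<k}. id) x = id x" using D.prod_all_apply[OF 1 j] j(1) by simp
      qed
      then show ?case using 1 by (metis image_eqI refl_word.simps(1))
    next
      case (Cons u us)
      obtain i where i: "i < m" "u \<in> K i" using KU Cons.hyps(1) by blast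
      have uH: "reflection u \<in> H i" using reflection_in_words[OF i(2)] i(1) by (simp add: H_def)
      have "i < k" using i(1) mk by simp
      then have "reflection u \<in> D.prod_all ` PiE {..<k} H" using uH by (rule D.component_in_prod)
      then obtain h where h: "reflection u = D.prod_all h" "h \<in> PiE {..<k} H" by (rule imageE)
      obtain h' where h': "refl_word us = D.prod_all h'" "h' \<in> PiE {..<k} H" using Cons.IH by (rule imageE)
      have eq: "refl_word (u # us) = D.prod_all (\<lambda>i\<in>{..<k}. h i \<circ> h' i)"
        by (simp only: refl_word.simps h(1) h'(1) D.prod_all_comp(2)[OF h(2) h'(2)])
      show ?case unfolding eq by (rule imageI, rule D.prod_all_comp(1)[OF h(2) h'(2)])
    qed
    show "G \<subseteq> D.prod_all ` PiE {..<k} H"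
      using * by (subst generated_by_simple) blast
  qed
  have H_ne: "H i \<noteq> {id}" if i: "i < m" for i
  proof -
    obtain u where u: "u \<in> K i" using KB(2)[OF i] by blast
    have "reflection u \<in> H i" using reflection_in_words[OF u] i by (simp add: H_def)
    moreover have "reflection u \<noteq> id" using reflection_ne_id B_nonzero KB(1)[OF i] u by blast
    ultimately show ?thesis by blast
  qed
  have H_eq: "H m = {id}" by (simp add: H_def)
  have invariant: "g ` V i \<subseteq> V i" if "i < k" "g \<in> G" for i g
  proof -
    have "g \<in> D.prod_all ` PiE {..<k} H" using prod that(2) by simp
    then obtain h where h: "g = D.prod_all h" "h \<in> PiE {..<k} H" by (rule imageE)
    then have "h i \<in> H i" using that(1) by auto
    then show ?thesis
      using h(1) D.prod_all_apply[OF h(2) that(1)] D.component_invariant[OF that(1)] by auto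
  qed
  have ess: "essential (V i) (H i)" if i: "i < m" for i
  proof -
    have "x = 0" if "x \<in> V i" "\<forall>g\<in>H i. g x = x" for x
    proof -
      have "\<alpha> \<bullet> x = 0" if "\<alpha> \<in> K i" for \<alpha>
      proof -
        have "reflection \<alpha> \<in> H i" using reflection_in_words[OF that] i by (simp add: H_def)
        then have "reflection \<alpha> x = x" using \<open>\<forall>g\<in>H i. g x = x\<close> by blast
        then show ?thesis using reflection_fix_iff B_nonzero KB(1)[OF i] that by blast
      qed
      then have "x \<bullet> x = 0"
        using orth_spans[of "K i" "{x}" x x] that(1) i by (auto simp: V_def span_base)
      then show ?thesis by simp
    qed
    moreover have "g 0 = 0" if "g \<in> H i" for g
      using linear_0 refl_group_linear[OF refl that] by blast
    ultimately show ?thesis using subspace_0[OF sub] unfolding essential_def by auto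
  qed
  have irr: "irreducible_on (V i) (H i)" if i: "i < m" for i
  proof -
    have "K i \<subseteq> - {0}" using KB(1)[OF i] B_nonzero by auto
    then show ?thesis
      using irreducible_on_connected[of "K i"] Kconn[OF i] i by (simp add: V_def H_def)
  qed
  have "irreducible_decomposition G k V H"
    unfolding irreducible_decomposition_def
  proof (intro conjI)
    show "\<forall>i<k. subspace (V i) \<and> (\<forall>g\<in>G. g ` V i \<subseteq> V i)" using sub invariant by blast
    show "\<forall>i<k. \<forall>j<k. i \<noteq> j \<longrightarrow> (\<forall>x\<in>V i. \<forall>y\<in>V j. orthogonal x y)"
      using orth by (auto simp: Linear_Algebra.orthogonal_def)
    show "span (\<Union>i<k. V i) = UNIV" by (rule span_V)
    show "\<forall>i<k. reflection_group (V i) (H i)" using refl by blast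
    show "is_direct_product k H G" using D.is_direct_product_iff prod by blast
    show "if essential UNIV G then \<forall>i<k. H i \<noteq> {id} else \<exists>!i. i < k \<and> H i = {id}"
      using H_ne H_eq by (auto simp: k_def less_Suc_eq)
    have "i < m" if "i < k" "H i \<noteq> {id}" for i
      using that by (cases "i < m") (auto simp: H_def)
    then show "\<forall>i<k. H i \<noteq> {id} \<longrightarrow> essential (V i) (H i) \<and> irreducible_on (V i) (H i)"
      using ess irr by blast
  qed
  then show ?thesis by blast
qed

section \<open>Matrices\<close>

text \<open>Connects matrices with sets of roots: rows and columns are paired by index, and duality
  itself shows that different indices give different roots. As the roots span \<open>V\<close>, the
  orthonormal part is empty.\<close>

lemma dual_templates_of_family:
  assumes "span B = V" "B = a ` I" "\<And>i. i \<in> I \<Longrightarrow> t i \<in> V"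
    and dual: "\<And>i j. i \<in> I \<Longrightarrow> j \<in> I \<Longrightarrow> a i \<bullet> t j = (if i = j then 1 else 0)"
  shows "dual_templates V B (t ` I)"
proof -
  have inj: "inj_on a I"
    using dual by (intro inj_onI) (metis zero_neq_one)
  define \<omega> where "\<omega> \<beta> = t (the_inv_into I a \<beta>)" for \<beta>
  have \<omega>: "\<omega> (a i) = t i" if "i \<in> I" for i
    using the_inv_into_f_f[OF inj that] by (simp add: \<omega>_def)
  have "x = 0" if "x \<in> V" "\<forall>\<alpha>\<in>B. \<alpha> \<bullet> x = 0" for x
    using orth_spans[of B "{x}" x x] that assms(1) by (auto simp: span_base)
  moreover have "0 \<in> V" using assms(1) span_zero by blast
  ultimately have "{x\<in>V. \<forall>\<alpha>\<in>B. \<alpha> \<bullet> x = 0} = {0}" by auto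
  then have "orthonormal_basis {x\<in>V. \<forall>\<alpha>\<in>B. \<alpha> \<bullet> x = 0} {}"
    by (simp add: orthonormal_basis_def)
  moreover have "t ` I = \<omega> ` B \<union> {}" using \<omega> assms(2) by force
  moreover have "dual_basis B \<omega>"
    using \<omega> assms(1,3) dual inj unfolding assms(2) by (auto simp: inner_commute inj_on_eq_iff)
  ultimately show ?thesis unfolding dual_templates_def by blast
qed

section \<open>Singular values as extreme values of the Gram form\<close>

lemma psd_kernel:
  fixes f :: "'a::euclidean_space \<Rightarrow> 'a"
  assumes "linear f" and sym: "\<And>x y. f x \<bullet> y = x \<bullet> f y" and psd: "\<And>x. x \<bullet> f x \<ge> 0"
    and "w \<bullet> f w = 0"
  shows "f w = 0"
proof (rule ccontr)
  assume "f w \<noteq> 0"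
  define u where "u = f w"
  define q where "q = u \<bullet> f u"
  define n where "n = u \<bullet> u"
  have n: "n > 0" using \<open>f w \<noteq> 0\<close> by (simp add: n_def u_def)
  have q: "q \<ge> 0" using psd by (simp add: q_def)
  \<comment> \<open>A zero of the form is a minimum, so a nonzero \<open>f w\<close> would give a
    descent. With this step the form at \<open>w + t *\<^sub>R u\<close> equals
    \<open>t * (n - t)\<close>, which is negative; the added 1 keeps the denominator
    positive.\<close>
  define t where "t = - n / (q + 1)"
  have tq: "t * (q + 1) = - n" using q by (simp add: t_def)
  have "0 \<le> (w + t *\<^sub>R u) \<bullet> f (w + t *\<^sub>R u)" by (rule psd)
  also have "f (w + t *\<^sub>R u) = u + t *\<^sub>R f u"
    using assms(1) by (simp add: linear_add linear_scale u_def)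
  also have "(w + t *\<^sub>R u) \<bullet> (u + t *\<^sub>R f u) = w \<bullet> u + t * (w \<bullet> f u) + t * (u \<bullet> u) + t * t * (u \<bullet> f u)"
    by (simp add: inner_add_left inner_add_right algebra_simps)
  also have "w \<bullet> f u = u \<bullet> u" using sym[of w u] by (simp add: u_def)
  also have "w \<bullet> u = 0" using assms(4) by (simp add: u_def)
  finally have "0 \<le> t * (2 * n + t * q)" by (simp add: n_def q_def algebra_simps)
  moreover have "t < 0" using n q by (simp add: t_def divide_neg_pos)
  moreover have "2 * n + t * q = n - t" using tq by (simp add: algebra_simps)
  ultimately show False using n by (simp add: mult_le_0_iff zero_le_mult_iff)
qed

lemma gram_apply: "(A ** transpose A) *v w = A *v (w v* A)"
  for A :: "real^'n^'n"
  by (simp add: matrix_vector_mul_assoc[symmetric])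

text \<open>If \<open>a\<close> is an extreme value of the Rayleigh quotient of
  \<open>A ** transpose A\<close>, this matrix minus \<open>a\<close> is semidefinite up to sign and
  its form vanishes at \<open>w\<close>, so \<open>psd_kernel\<close> makes \<open>w\<close> an
  eigenvector. Then \<open>w v* A\<close> is an eigenvector of
  \<open>transpose A ** A\<close>.\<close>

lemma singular_value_extremal:
  fixes A :: "real^'n^'n"
  assumes "a > 0" "w \<noteq> 0" "(norm (w v* A))\<^sup>2 = a * (norm w)\<^sup>2"
    and ext: "(\<forall>x. a * (norm x)\<^sup>2 \<le> (norm (x v* A))\<^sup>2) \<or> (\<forall>x. (norm (x v* A))\<^sup>2 \<le> a * (norm x)\<^sup>2)"
  shows "sqrt a \<in> singular_values A"
proof -
  have *: "A *v (w v* A) = a *\<^sub>R w"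
    if \<sigma>: "\<sigma> = 1 \<or> \<sigma> = - 1" "\<And>x. \<sigma> * ((norm (x v* A))\<^sup>2 - a * (norm x)\<^sup>2) \<ge> 0" for \<sigma>
  proof -
    define f where "f x = \<sigma> *\<^sub>R ((A ** transpose A) *v x - a *\<^sub>R x)" for x
    have dot: "x \<bullet> ((A ** transpose A) *v y) = (x v* A) \<bullet> (y v* A)" for x y
      unfolding gram_apply by (simp add: dot_lmul_matrix)
    have "f w = 0"
    proof (rule psd_kernel[where f = f and w = w])
      show "linear f" unfolding f_def
        by (intro linear_compose_scale_right linear_compose_sub matrix_vector_mul_linear linear_ident)
      show "f x \<bullet> y = x \<bullet> f y" for x y
        using dot[of y x] dot[of x y] by (simp add: f_def inner_diff_left inner_diff_right inner_commute)
      have xf: "x \<bullet> f x = \<sigma> * ((norm (x v* A))\<^sup>2 - a * (norm x)\<^sup>2)" for x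
        by (simp add: f_def dot inner_diff_right power2_norm_eq_inner)
      show "x \<bullet> f x \<ge> 0" for x using \<sigma>(2) by (simp add: xf)
      show "w \<bullet> f w = 0" using assms(3) by (simp add: xf)
    qed
    then show ?thesis using \<sigma>(1) unfolding f_def gram_apply by auto
  qed
  have eq: "A *v (w v* A) = a *\<^sub>R w"
    using ext
  proof
    assume "\<forall>x. a * (norm x)\<^sup>2 \<le> (norm (x v* A))\<^sup>2"
    then show ?thesis by (intro *[of 1]) auto
  next
    assume "\<forall>x. (norm (x v* A))\<^sup>2 \<le> a * (norm x)\<^sup>2"
    then show ?thesis by (intro *[of "- 1"]) auto
  qed
  have "(norm (w v* A))\<^sup>2 \<noteq> 0" using assms(1-3) by simp
  then have nz: "w v* A \<noteq> 0" by force
  have "(transpose A ** A) *v (w v* A) = transpose A *v (a *\<^sub>R w)"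
    by (simp add: matrix_vector_mul_assoc[symmetric] eq del: transpose_matrix_vector)
  also have "\<dots> = a *\<^sub>R (w v* A)"
    by (simp add: matrix_vector_mult_scaleR del: transpose_matrix_vector) simp
  finally show ?thesis
    using assms(1) nz unfolding singular_values_def by auto
qed

text \<open>Eigenvectors for different values are orthogonal, hence independent. Finiteness is what
  gives the \<open>Max\<close> and \<open>Min\<close> in \<open>sigma_max\<close> and
  \<open>sigma_min\<close> their meaning.\<close>

lemma finite_singular_values: "finite (singular_values A)"
proof -
  let ?M = "transpose A ** A"
  have "\<exists>v. v \<noteq> 0 \<and> ?M *v v = s\<^sup>2 *\<^sub>R v" if "s \<in> singular_values A" for s
    using that by (simp add: singular_values_def)
  then obtain v where v: "\<And>s. s \<in> singular_values A \<Longrightarrow> v s \<noteq> 0"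
    "\<And>s. s \<in> singular_values A \<Longrightarrow> ?M *v v s = s\<^sup>2 *\<^sub>R v s"
    by metis
  have dot: "x \<bullet> (?M *v y) = (A *v x) \<bullet> (A *v y)" for x y
    by (simp add: matrix_vector_mul_assoc[symmetric] inner_commute[of x] dot_lmul_matrix inner_commute[of "A *v y"])
  have orth: "v s \<bullet> v t = 0" if st: "s \<in> singular_values A" "t \<in> singular_values A" "s \<noteq> t" for s t
  proof -
    have "s\<^sup>2 * (v s \<bullet> v t) = t\<^sup>2 * (v s \<bullet> v t)"
      using dot[of "v s" "v t"] dot[of "v t" "v s"] v(2) st(1,2) by (simp add: inner_commute)
    moreover have "s\<^sup>2 \<noteq> t\<^sup>2" using st by (simp add: singular_values_def power2_eq_iff_nonneg)
    ultimately show ?thesis by simp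
  qed
  have inj: "inj_on v (singular_values A)"
  proof (rule inj_onI, rule ccontr)
    fix s t assume "s \<in> singular_values A" "t \<in> singular_values A" "v s = v t" "s \<noteq> t"
    then show False using orth[of s t] v(1)[of t] by simp
  qed
  have "pairwise orthogonal (v ` singular_values A)"
    using orth by (auto simp: pairwise_def Linear_Algebra.orthogonal_def)
  moreover have "0 \<notin> v ` singular_values A" using v(1) by force
  ultimately have "independent (v ` singular_values A)" by (rule pairwise_orthogonal_independent)
  then have "finite (v ` singular_values A)" by (rule independent_imp_finite)
  then show ?thesis using inj by (rule finite_imageD)
qed

lemma sigma_eqs:
  fixes A :: "real^'n^'n"
  assumes "invertible A" and r: "0 \<le> r" "r < 1"
    and lower: "\<And>x. (1 - r) * (norm x)\<^sup>2 \<le> (norm (x v* A))\<^sup>2"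
    and upper: "\<And>x. (norm (x v* A))\<^sup>2 \<le> (1 + r) * (norm x)\<^sup>2"
    and x: "x \<noteq> 0" "(norm (x v* A))\<^sup>2 = (1 - r) * (norm x)\<^sup>2"
    and y: "y \<noteq> 0" "(norm (y v* A))\<^sup>2 = (1 + r) * (norm y)\<^sup>2"
  shows "sigma_max A = sqrt (1 + r)" "sigma_min A = sqrt (1 - r)"
proof -
  have bounds: "sqrt (1 - r) \<le> s \<and> s \<le> sqrt (1 + r)" if s: "s \<in> singular_values A" for s
  proof -
    obtain v where v: "s \<ge> 0" "v \<noteq> 0" "(transpose A ** A) *v v = s\<^sup>2 *\<^sub>R v"
      using s by (auto simp: singular_values_def)
    \<comment> \<open>The hypotheses bound the form of \<open>A ** transpose A\<close>, while
      singular values come from \<open>transpose A ** A\<close>; applying \<open>A\<close> to the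
      eigenvector passes from one to the other.\<close>
    let ?w = "A *v v"
    have w: "?w v* A = s\<^sup>2 *\<^sub>R v" using v(3) by (simp add: matrix_vector_mul_assoc[symmetric])
    have "(norm ?w)\<^sup>2 = v \<bullet> (?w v* A)"
      by (simp add: power2_norm_eq_inner dot_lmul_matrix[symmetric] inner_commute)
    then have n: "(norm ?w)\<^sup>2 = s\<^sup>2 * (norm v)\<^sup>2" by (simp add: w power2_norm_eq_inner)
    have "?w \<noteq> 0"
      using assms(1) v(2) by (metis invertible_def matrix_vector_mul_assoc matrix_vector_mul_lid matrix_vector_mult_0_right)
    then have pos: "s\<^sup>2 * (norm v)\<^sup>2 > 0" using n by (metis zero_less_norm_iff zero_less_power)
    have m: "(norm (?w v* A))\<^sup>2 = s\<^sup>2 * (s\<^sup>2 * (norm v)\<^sup>2)"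
      unfolding w by (simp add: power_mult_distrib power2_eq_square)
    have "1 - r \<le> s\<^sup>2" "s\<^sup>2 \<le> 1 + r"
      using lower[of ?w] upper[of ?w] unfolding n m by (auto intro: mult_right_le_imp_le[OF _ pos])
    then show ?thesis using v(1) by (simp add: real_le_lsqrt real_le_rsqrt)
  qed
  have "sqrt (1 - r) \<in> singular_values A"
    using r lower by (intro singular_value_extremal[OF _ x]) auto
  then show "sigma_min A = sqrt (1 - r)"
    unfolding sigma_min_def using bounds finite_singular_values by (intro Min_eqI) auto
  have "sqrt (1 + r) \<in> singular_values A"
    using r upper by (intro singular_value_extremal[OF _ y]) auto
  then show "sigma_max A = sqrt (1 + r)"
    unfolding sigma_max_def using bounds finite_singular_values by (intro Max_eqI) auto
qed

lemma vector_mult_rows: "w v* A = (\<Sum>i\<in>UNIV. w $ i *\<^sub>R row i A)"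
  for A :: "real^'n^'n"
  using matrix_mult_sum[of "transpose A" w]
  by (simp add: scalar_mult_eq_scaleR)

context
  fixes G :: "(real^'n \<Rightarrow> real^'n) set" and A :: "real^'n^'n"
  assumes simple: "simple_refl UNIV G (rows A)"
    and span_rows: "span (rows A) = UNIV"
begin

interpretation simple_refl UNIV G "rows A"
  by (rule simple)

lemma rows_image: "rows A = range (\<lambda>i. row i A)"
  by (auto simp: Finite_Cartesian_Product.rows_def)

lemma invertible_fundamental: "invertible A"
  using matrix_left_invertible_span_rows[of A] span_rows invertible_left_inverse by blast

lemma row_inner_inverse_column:
  "row i A \<bullet> column j (matrix_inv A) = (if i = j then 1 else 0)"
proof -
  have "A ** matrix_inv A = mat 1"
    using invertible_fundamental by (simp add: invertible_def matrix_inv_def someI_ex) (metis (mono_tags, lifting) someI_ex)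
  then have "(A ** matrix_inv A) $ i $ j = (mat 1 :: real^'n^'n) $ i $ j" by simp
  then show ?thesis
    by (simp add: matrix_matrix_mult_def Finite_Cartesian_Product.row_def column_def
        inner_vec_def Finite_Cartesian_Product.mat_def)
qed

lemma dual_templates_columns:
  "dual_templates UNIV (rows A) (columns (matrix_inv A))"
proof -
  have "columns (matrix_inv A)
      = range (\<lambda>i. column i (matrix_inv A))"
    by (auto simp: columns_def)
  then show ?thesis
    using dual_templates_of_family[OF span_rows rows_image, of "\<lambda>i. column i (matrix_inv A)"]
      row_inner_inverse_column by simp
qed

lemma inj_row: "inj (\<lambda>i. row i A)"
  using row_inner_inverse_column by (intro injI) (metis zero_neq_one)

lemma sum_rows:
  "(\<Sum>\<alpha>\<in>rows A. f \<alpha>) = (\<Sum>i\<in>UNIV. f (row i A))"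
  unfolding rows_image using inj_row by (simp add: sum.reindex)

text \<open>\<open>coupling\<close> is only a supremum, so extremal vectors come from compactness:
  some unit vector \<open>x\<close> minimises the norm of the combination of rows, and the colouring
  signs turn it into a maximising \<open>y\<close>.\<close>

lemma sigma_ratio: "sigma_max A / sigma_min A = coupling_cond (rows A)"
proof -
  let ?B = "rows A" and ?r = "coupling (rows A)"
  let ?row = "\<lambda>i. row i A"
  define v where "v w \<alpha> = w $ (Hilbert_Choice.inv ?row \<alpha>)" for w :: "real^'n" and \<alpha>
  have v_row: "v w (?row i) = w $ i" for w i
    using inv_f_f[OF inj_row] by (simp add: v_def)
  have vA: "w v* A = (\<Sum>\<alpha>\<in>?B. v w \<alpha> *\<^sub>R \<alpha>)" for w
    by (simp add: sum_rows v_row vector_mult_rows)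
  have vn: "(norm w)\<^sup>2 = (\<Sum>\<alpha>\<in>?B. (v w \<alpha>)\<^sup>2)" for w
    unfolding power2_norm_eq_inner inner_vec_def by (simp add: sum_rows v_row power2_eq_square)
  have r: "0 \<le> ?r" "?r < 1" using coupling_nonneg coupling_less_1 by auto
  have lower: "(1 - ?r) * (norm x)\<^sup>2 \<le> (norm (x v* A))\<^sup>2" for x
    using gram_lower_bound[OF finite_B] by (simp add: vA vn)
  have upper: "(norm (x v* A))\<^sup>2 \<le> (1 + ?r) * (norm x)\<^sup>2" for x
    using gram_upper_bound by (simp add: vA vn)
  have "\<exists>x\<in>sphere 0 1. \<forall>y\<in>sphere 0 1. (norm (x v* A))\<^sup>2 \<le> (norm (y v* A))\<^sup>2"
  proof (rule continuous_attains_inf)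
    show "compact (sphere (0 :: real^'n) 1)" by simp
    show "sphere (0 :: real^'n) 1 \<noteq> {}" by simp
    have "linear (\<lambda>x. transpose A *v x)" by (rule matrix_vector_mul_linear)
    then have "continuous_on (sphere 0 1) (\<lambda>x. transpose A *v x)"
      by (rule linear_continuous_on[OF linear_conv_bounded_linear[THEN iffD1]])
    then show "continuous_on (sphere 0 1) (\<lambda>x. (norm (x v* A))\<^sup>2)"
      by (auto intro: continuous_intros)
  qed
  then obtain x where x: "norm x = 1" "\<And>y. norm y = 1 \<Longrightarrow> (norm (x v* A))\<^sup>2 \<le> (norm (y v* A))\<^sup>2"
    by auto
  obtain \<epsilon> :: "real^'n \<Rightarrow> real" where \<epsilon>: "\<And>\<alpha>. \<bar>\<epsilon> \<alpha>\<bar> = 1"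
    "\<And>v. (norm (lin_comb v ?B))\<^sup>2 + (norm (lin_comb (\<lambda>\<alpha>. \<epsilon> \<alpha> * v \<alpha>) ?B))\<^sup>2
       = 2 * (\<Sum>\<alpha>\<in>?B. (v \<alpha>)\<^sup>2)"
    using exists_signs by blast
  define y where "y = (\<chi> i. \<epsilon> (?row i) * x $ i)"
  have vy: "v y \<alpha> = \<epsilon> \<alpha> * v x \<alpha>" if "\<alpha> \<in> ?B" for \<alpha>
    using that v_row unfolding rows_image by (auto simp: y_def)
  have yx: "(norm (x v* A))\<^sup>2 + (norm (y v* A))\<^sup>2 = 2"
    using \<epsilon>(2)[of "v x"] x(1) vn[of x] by (simp add: vA vy cong: sum.cong)
  have "(\<epsilon> \<alpha> * v x \<alpha>)\<^sup>2 = (v x \<alpha>)\<^sup>2" for \<alpha>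
    using \<epsilon>(1) by (metis abs_mult mult_1 power2_abs)
  then have "(norm y)\<^sup>2 = (norm x)\<^sup>2" unfolding vn by (intro sum.cong) (auto simp: vy)
  then have ny: "norm y = 1" using x(1) by (simp add: power2_eq_1_iff) (metis abs_norm_cancel abs_1 abs_minus power2_eq_1_iff)
  \<comment> \<open>\<open>y\<close> competes with the minimiser \<open>x\<close> and the two values
    have sum 2. So \<open>1 - (norm (x v* A))\<^sup>2\<close> is nonnegative, as
    \<open>coupling_le\<close> demands.\<close>
  have min_le: "(norm (x v* A))\<^sup>2 \<le> 1" using x(2)[OF ny] yx by linarith
  have "?r \<le> 1 - (norm (x v* A))\<^sup>2"
  proof (rule coupling_le)
    show "0 \<le> 1 - (norm (x v* A))\<^sup>2" using min_le by simp
    fix u :: "real^'n \<Rightarrow> real" assume u: "(\<Sum>\<alpha>\<in>?B. (u \<alpha>)\<^sup>2) = 1"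
    define w where "w = (\<chi> i. u (?row i))"
    have vw: "v w \<alpha> = u \<alpha>" if "\<alpha> \<in> ?B" for \<alpha>
      using that v_row unfolding rows_image by (auto simp: w_def)
    have "(norm w)\<^sup>2 = 1" unfolding vn using u by (simp add: vw cong: sum.cong)
    then have "norm w = 1" by (metis norm_ge_zero power2_eq_1_iff neg_0_le_iff_le not_one_le_zero)
    then have "(norm (x v* A))\<^sup>2 \<le> (norm (w v* A))\<^sup>2" by (rule x(2))
    also have "w v* A = (lin_comb u ?B)" unfolding vA by (intro sum.cong) (auto simp: vw)
    finally show "1 - (norm (lin_comb u ?B))\<^sup>2 \<le> 1 - (norm (x v* A))\<^sup>2" by simp
  qed
  then have xr: "(norm (x v* A))\<^sup>2 = (1 - ?r) * (norm x)\<^sup>2" using lower[of x] x(1) by simp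
  then have yr: "(norm (y v* A))\<^sup>2 = (1 + ?r) * (norm y)\<^sup>2" using yx x(1) ny by simp
  have "x \<noteq> 0" "y \<noteq> 0" using x(1) ny by auto
  then show ?thesis
    using sigma_eqs[OF invertible_fundamental r lower upper _ xr _ yr] by (simp add: coupling_cond_def)
qed

end

section \<open>Fundamental matrices of a constituent in coordinates\<close>

lemma inner_from_coords:
  assumes "distinct es" "orthonormal_basis V (set es)"
  shows "from_coords es v \<bullet> from_coords es w = (\<Sum>j<length es. vec_index v j * vec_index w j)"
proof -
  have es: "es ! i \<bullet> es ! j = (if i = j then 1 else 0)" if "i < length es" "j < length es" for i j
  proof (cases "i = j")
    case True
    then show ?thesis using assms(2) that by (simp add: orthonormal_basis_def norm_eq_1)
  next
    case False
    then have "es ! i \<noteq> es ! j" using assms(1) that by (simp add: nth_eq_iff_index_eq)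
    then show ?thesis
      using assms(2) that False
      by (auto simp: orthonormal_basis_def pairwise_def Linear_Algebra.orthogonal_def)
  qed
  have "from_coords es v \<bullet> from_coords es w
      = (\<Sum>i<length es. \<Sum>j<length es. vec_index v i * vec_index w j * (es ! i \<bullet> es ! j))"
    unfolding from_coords_def
    by (subst inner_sum_left) (simp add: inner_sum_right sum_distrib_left ac_simps)
  also have "\<dots> = (\<Sum>i<length es. \<Sum>j<length es. if j = i then vec_index v i * vec_index w i else 0)"
    by (intro sum.cong) (auto simp: es)
  finally show ?thesis by simp
qed

lemma from_coords_in_span: "from_coords es v \<in> span (set es)"
  unfolding from_coords_def by (intro span_sum span_scale span_base) simp

lemma mat_mult_index:
  assumes "A \<in> carrier_mat n n" "A' \<in> carrier_mat n n" "i < n" "j < n"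
  shows "(A * A') $$ (i, j) = (\<Sum>l<n. vec_index (Matrix.row A i) l * vec_index (Matrix.col A' j) l)"
  using assms by (auto simp: scalar_prod_def atLeast0LessThan)

lemma fundamental_matrixD:
  assumes "fundamental_matrix V G es A"
  shows "distinct es" "orthonormal_basis V (set es)" "A \<in> carrier_mat (dim V) (dim V)"
    "fundamental_system V G ((\<lambda>i. from_coords es (Matrix.row A i)) ` {..<dim V})"
    "span (set es) = V" "length es = dim V"
proof -
  show es: "distinct es" "orthonormal_basis V (set es)" and A: "A \<in> carrier_mat (dim V) (dim V)"
    using assms by (auto simp: fundamental_matrix_def)
  have "from_coords es ` set (Matrix.rows A) = (\<lambda>i. from_coords es (Matrix.row A i)) ` {..<dim V}"
    using A by (auto simp: Matrix.rows_def)
  then show "fundamental_system V G ((\<lambda>i. from_coords es (Matrix.row A i)) ` {..<dim V})"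
    using assms by (simp add: fundamental_matrix_def)
  show span: "span (set es) = V" using es(2) by (simp add: orthonormal_basis_def)
  have "0 \<notin> set es" using es(2) by (force simp: orthonormal_basis_def)
  then have "independent (set es)"
    using es(2) unfolding orthonormal_basis_def by (intro pairwise_orthogonal_independent) simp_all
  then show "length es = dim V" using span es(1) by (metis dim_span_eq_card_independent distinct_card)
qed

lemma fundamental_matrix_invertible:
  fixes V :: "'a::euclidean_space set"
  assumes "subspace V" "finite G" "reflection_group V G" "essential V G"
    and A: "fundamental_matrix V G es A"
  shows "invertible_mat A"
proof -
  note es = fundamental_matrixD[OF A]
  let ?n = "dim V"
  let ?a = "\<lambda>i. from_coords es (Matrix.row A i)"
  interpret simple_refl V G "?a ` {..<?n}"
    using assms(1-3) simple_system_of_fundamental[OF assms(1) es(4)] by (simp add: simple_refl_def)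
  \<comment> \<open>The rows are given only as a set; a basis of \<open>V\<close> has
    \<open>dim V\<close> elements, so no two rows coincide.\<close>
  have "card (?a ` {..<?n}) = card {..<?n}"
    using independent_B essential_span[OF assms(4)] dim_span_eq_card_independent by (metis card_lessThan)
  then have inj: "inj_on ?a {..<?n}" by (rule eq_card_imp_inj_on[OF finite_lessThan])
  obtain \<omega> where \<omega>: "\<forall>\<alpha>\<in>?a ` {..<?n}. \<omega> \<alpha> \<in> span (?a ` {..<?n}) \<and>
      (\<forall>\<beta>\<in>?a ` {..<?n}. \<omega> \<alpha> \<bullet> \<beta> = (if \<alpha> = \<beta> then 1 else 0))"
    using exists_dual_basis by blast
  \<comment> \<open>The columns of the inverse are the coordinates of the dual basis with respect to
    \<open>es\<close>.\<close>
  define A' where "A' = Matrix.mat ?n ?n (\<lambda>(j, l). es ! j \<bullet> \<omega> (?a l))"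
  have A': "A' \<in> carrier_mat ?n ?n" by (simp add: A'_def)
  have "A * A' = 1\<^sub>m ?n"
  proof (rule eq_matI)
    fix i l assume il: "i < dim_row (1\<^sub>m ?n :: real mat)" "l < dim_col (1\<^sub>m ?n :: real mat)"
    have "(A * A') $$ (i, l) = (\<Sum>j<?n. vec_index (Matrix.row A i) j * (es ! j \<bullet> \<omega> (?a l)))"
      using il by (subst mat_mult_index[OF es(3) A']) (auto simp: A'_def)
    also have "\<dots> = ?a i \<bullet> \<omega> (?a l)"
      by (simp add: from_coords_def inner_sum_left es(6))
    also have "\<dots> = (if ?a l = ?a i then 1 else 0)"
      using \<omega> il by (auto simp: inner_commute)
    also have "\<dots> = 1\<^sub>m ?n $$ (i, l)" using inj il by (auto dest: inj_onD)
    finally show "(A * A') $$ (i, l) = 1\<^sub>m ?n $$ (i, l)" .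
  qed (use es(3) A' in auto)
  then show ?thesis
    using mat_mult_left_right_inverse[OF es(3) A'] es(3) A'
    unfolding invertible_mat_def inverts_mat_def by auto
qed

lemma constituent_dual:
  fixes V :: "'a::euclidean_space set"
  assumes V: "subspace V" and G: "finite G" "reflection_group V G" and "G \<noteq> {id} \<Longrightarrow> essential V G"
    and T: "constituent_templates V G T"
  shows "\<exists>B. simple_system V G B \<and> dual_templates V B T"
proof (cases "G = {id}")
  case True
  obtain B where B: "simple_system V G B" using exists_simple_system[OF V G(1)] by blast
  interpret simple_refl V G B using V G B by (simp add: simple_refl_def)
  have "B = {}" using B_empty_iff True by blast
  then have "dual_templates V B T"
    using T True unfolding dual_templates_def constituent_templates_def by (intro exI[of _ id] exI[of _ T]) auto
  then show ?thesis using B by blast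
next
  case False
  then obtain es A A' where A: "fundamental_matrix V G es A"
    and inv: "inverts_mat A A'" "inverts_mat A' A" and T': "T = from_coords es ` set (Matrix.cols A')"
    using T unfolding constituent_templates_def by auto
  note es = fundamental_matrixD[OF A]
  let ?n = "dim V"
  let ?a = "\<lambda>i. from_coords es (Matrix.row A i)" and ?t = "\<lambda>i. from_coords es (Matrix.col A' i)"
  have B: "simple_system V G (?a ` {..<?n})" by (rule simple_system_of_fundamental[OF V es(4)])
  interpret simple_refl V G "?a ` {..<?n}"
    using V G B by (simp add: simple_refl_def)
  \<comment> \<open>The shape of \<open>A'\<close> is not given; it follows by comparing dimensions
    in the two products.\<close>
  have AA': "A * A' = 1\<^sub>m ?n" using inv(1) es(3) by (simp add: inverts_mat_def)
  have "A' * A = 1\<^sub>m (dim_row A')" using inv(2) by (simp add: inverts_mat_def)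
  then have "dim_row A' = ?n" using es(3) by (metis carrier_matD(2) index_mult_mat(3) index_one_mat(3))
  moreover have "dim_col A' = ?n" using AA' by (metis index_mult_mat(3) index_one_mat(3))
  ultimately have A': "A' \<in> carrier_mat ?n ?n" by auto
  have "T = ?t ` {..<?n}" using T' A' by (auto simp: Matrix.cols_def)
  moreover have "dual_templates V (?a ` {..<?n}) (?t ` {..<?n})"
  proof (rule dual_templates_of_family)
    show "span (?a ` {..<?n}) = V" using essential_span assms(4) False by blast
    show "?a ` {..<?n} = ?a ` {..<?n}" by (rule refl)
    show "?t i \<in> V" for i using from_coords_in_span es(5) by blast
    fix i j assume ij: "i \<in> {..<?n}" "j \<in> {..<?n}"
    then have "?a i \<bullet> ?t j = (A * A') $$ (i, j)"
      using inner_from_coords[OF es(1,2)] mat_mult_index[OF es(3) A'] es(6) by simp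
    then show "?a i \<bullet> ?t j = (if i = j then 1 else 0)" using AA' ij by simp
  qed
  ultimately show ?thesis using B by blast
qed

section \<open>The three cases\<close>

lemma trivial_group_templates:
  fixes V :: "'a::euclidean_space set"
  assumes V: "subspace V" "V \<noteq> {0}" and G: "reflection_group V {id}"
  shows "opt_cond V {id} = 1"
    and "distinct ts \<Longrightarrow> orthonormal_basis V (set ts) \<Longrightarrow> minimal_optimal_templates V {id} ts"
proof -
  obtain B where B: "simple_system V {id} B" using exists_simple_system[OF V(1)] by blast
  interpret simple_refl V "{id}" B using V G B by (simp add: simple_refl_def)
  have "B = {}" using B_empty_iff by blast
  have "coupling ({} :: 'a set) \<le> 0" by (rule coupling_le) auto
  then have "coupling ({} :: 'a set) = 0" using coupling_nonneg[of "{} :: 'a set"] by linarith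
  then show "opt_cond V {id} = 1"
    using opt_cond_eq[OF V(2)] \<open>B = {}\<close> by (simp add: coupling_cond_def)
  assume ts: "distinct ts" "orthonormal_basis V (set ts)"
  have "dual_templates V B (set ts)"
    unfolding dual_templates_def using \<open>B = {}\<close> ts(2) by (intro exI[of _ id] exI[of _ "set ts"]) auto
  then show "minimal_optimal_templates V {id} ts"
    using minimal_optimal_dual_templates[OF V(2)] ts(1) by blast
qed

lemma irreducible_templates:
  fixes G :: "(real^'n \<Rightarrow> real^'n) set" and A :: "real^'n^'n"
  assumes "finite G" "reflection_group UNIV G" "essential UNIV G"
    and A: "fundamental_system UNIV G (rows A)"
  shows "invertible A \<and> opt_cond UNIV G = sigma_max A / sigma_min A \<and>
    (\<forall>ts. distinct ts \<and> set ts = columns (matrix_inv A) \<longrightarrow>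
       minimal_optimal_templates UNIV G ts)"
proof (intro conjI allI impI; (elim conjE)?)
  have S: "simple_refl UNIV G (rows A)"
    using assms simple_system_of_fundamental[OF subspace_UNIV A] by (simp add: simple_refl_def)
  interpret simple_refl UNIV G "rows A" by (rule S)
  have sp: "span (rows A) = UNIV" by (rule essential_span[OF assms(3)])
  have U: "(UNIV :: (real^'n) set) \<noteq> {0}" by (metis UNIV_I axis_eq_0_iff singletonD zero_neq_one)
  show "invertible A" by (rule invertible_fundamental[OF S sp])
  show "opt_cond UNIV G = sigma_max A / sigma_min A"
    using sigma_ratio[OF S sp] opt_cond_eq[OF U] by simp
  show "minimal_optimal_templates UNIV G ts"
    if "distinct ts" "set ts = columns (matrix_inv A)" for ts
    using minimal_optimal_dual_templates[OF U dual_templates_columns[OF S sp]] that by blast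
qed

lemma decomposition_templates:
  fixes G :: "('a::euclidean_space \<Rightarrow> 'a) set"
  assumes "finite G" "reflection_group UNIV G" and D: "irreducible_decomposition G k V H"
  shows "opt_cond UNIV G = Max ((\<lambda>i. opt_cond (V i) (H i)) ` {..<k}) \<and>
    (\<forall>i<k. H i \<noteq> {id} \<longrightarrow>
       (\<forall>es A. fundamental_matrix (V i) (H i) es A \<longrightarrow> invertible_mat A)) \<and>
    (\<forall>T. (\<forall>i<k. constituent_templates (V i) (H i) (T i)) \<longrightarrow>
       (\<forall>i<k. \<forall>ts. distinct ts \<and> set ts = T i \<longrightarrow> minimal_optimal_templates (V i) (H i) ts) \<and>
       (\<forall>ts. distinct ts \<and> set ts = (\<Union>i<k. T i) \<longrightarrow> minimal_optimal_templates UNIV G ts))"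
proof (intro conjI allI impI; (elim conjE)?)
  have O: "orth_decomposition k V H"
    using D unfolding irreducible_decomposition_def orth_decomposition_def Linear_Algebra.orthogonal_def by blast
  have "is_direct_product k H G" using D unfolding irreducible_decomposition_def by blast
  then have "refl_decomposition k V H G"
    using assms(1,2) orth_decomposition.is_direct_product_iff[OF O]
    by (intro refl_decomposition.intro[OF O] refl_decomposition_axioms.intro) simp_all
  then interpret refl_decomposition k V H G .
  have ess: "essential (V i) (H i)" if "i < k" "H i \<noteq> {id}" for i
    using D that unfolding irreducible_decomposition_def by blast
  have triv: "if essential UNIV G then \<forall>i<k. H i \<noteq> {id} else \<exists>!i. i < k \<and> H i = {id}"
    using D unfolding irreducible_decomposition_def by blast
  \<comment> \<open>A nontrivial group needs a nonzero root. For the trivial constituent,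
    \<open>G\<close> has a nonzero fixed vector; its components in the summands with essential
    action vanish, so its component in this summand does not.\<close>
  have V_ne: "V i \<noteq> {0}" if i: "i < k" for i
  proof (cases "H i = {id}")
    case False
    show ?thesis
    proof
      assume "V i = {0}"
      then obtain U where "U \<subseteq> {0} - {0}" "H i = refl_word ` lists U"
        using refl_groupE[OF refl[OF i]] by metis
      then show False using False by auto
    qed
  next
    case True
    then have "\<not> essential UNIV G" and uniq: "\<And>j. j < k \<Longrightarrow> H j = {id} \<Longrightarrow> j = i"
      using triv i by (auto split: if_splits)
    moreover have "g 0 = 0" if "g \<in> G" for g
      using linear_0 refl_group_linear[OF refl_G that] by blast
    ultimately obtain x where x: "x \<noteq> 0" "\<And>g. g \<in> G \<Longrightarrow> g x = x"
      unfolding essential_def by auto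
    obtain \<xi> where \<xi>: "\<And>j. j < k \<Longrightarrow> \<xi> j \<in> V j" "x = (\<Sum>j<k. \<xi> j)" using components by blast
    have "\<xi> j = 0" if j: "j < k" "j \<noteq> i" for j
    proof -
      have "f (\<xi> j) = \<xi> j" if f: "f \<in> H j" for f
      proof -
        have "(\<Sum>l<k. f (\<xi> l) - \<xi> l) = f x - x"
          unfolding \<xi>(2) using linear_component[OF j(1) f] by (simp add: linear_sum sum_subtractf)
        also have "\<dots> = 0" using x(2) f component_subset[OF j(1)] by auto
        finally have "(\<Sum>l<k. f (\<xi> l) - \<xi> l) = 0" .
        moreover have "(\<Sum>l<k. f (\<xi> l) - \<xi> l) = (\<Sum>l<k. if l = j then f (\<xi> j) - \<xi> j else 0)"
          using component_fixes[OF j(1) _ _ f] \<xi>(1) by (intro sum.cong) auto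
        ultimately show ?thesis using j(1) by simp
      qed
      moreover have "essential (V j) (H j)" using ess j uniq by blast
      ultimately show ?thesis using \<xi>(1)[OF j(1)] unfolding essential_def by blast
    qed
    then have "\<xi> i \<noteq> 0" using x(1) \<xi>(2) by (metis lessThan_iff sum.neutral)
    then show ?thesis using \<xi>(1)[OF i] by blast
  qed
  have "k > 0"
  proof (rule ccontr)
    assume "\<not> k > 0"
    then have "(UNIV :: 'a set) = {0}" using span_V by simp
    moreover obtain b :: 'a where "b \<in> Basis" using nonempty_Basis by blast
    ultimately show False using nonzero_Basis by blast
  qed
  then have U: "(UNIV :: 'a set) \<noteq> {0}" using V_ne subspace_0[OF subspace] by blast
  show "opt_cond UNIV G = Max ((\<lambda>i. opt_cond (V i) (H i)) ` {..<k})"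
    using opt_cond_Max V_ne \<open>k > 0\<close> by blast
  show "invertible_mat A" if "i < k" "H i \<noteq> {id}" "fundamental_matrix (V i) (H i) es A" for i es A
    using fundamental_matrix_invertible[OF subspace finite_component refl ess] that by blast
  have "\<exists>B. simple_system (V i) (H i) B \<and> dual_templates (V i) B (T i)"
    if "\<forall>i<k. constituent_templates (V i) (H i) (T i)" "i < k" for i T
    using constituent_dual[OF subspace finite_component refl ess] that by blast
  then have ex_B: "\<exists>B. \<forall>i<k. simple_system (V i) (H i) (B i) \<and> dual_templates (V i) (B i) (T i)"
    if "\<forall>i<k. constituent_templates (V i) (H i) (T i)" for T
    using that by metis
  show "minimal_optimal_templates (V i) (H i) ts"
    if T: "\<forall>i<k. constituent_templates (V i) (H i) (T i)" and i: "i < k" "distinct ts" "set ts = T i" for T i ts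
  proof -
    obtain B where B: "\<forall>i<k. simple_system (V i) (H i) (B i) \<and> dual_templates (V i) (B i) (T i)"
      using ex_B[OF T] by blast
    then show ?thesis
      using simple_refl.minimal_optimal_dual_templates[OF simple_refl_component V_ne] i by blast
  qed
  show "minimal_optimal_templates UNIV G ts"
    if T: "\<forall>i<k. constituent_templates (V i) (H i) (T i)" and ts: "distinct ts" "set ts = (\<Union>i<k. T i)" for T ts
  proof -
    obtain B where B: "\<And>i. i < k \<Longrightarrow> simple_system (V i) (H i) (B i)"
      "\<And>i. i < k \<Longrightarrow> dual_templates (V i) (B i) (T i)"
      using ex_B[OF T] by blast
    show ?thesis
      by (rule simple_refl.minimal_optimal_dual_templates[OF simple_refl_Union U dual_templates_Union ts])
        (use B in auto)
  qed
qed

theorem theorem6: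
  fixes G :: "(real^'n \<Rightarrow> real^'n) set"
  assumes "finite G" and "reflection_group UNIV G"
  shows
    "(G = {id} \<longrightarrow>
        opt_cond UNIV G = 1 \<and>
        (\<forall>ts. distinct ts \<and> orthonormal_basis UNIV (set ts) \<longrightarrow> minimal_optimal_templates UNIV G ts))
   \<and> (essential UNIV G \<and> irreducible_on UNIV G \<longrightarrow>
        (\<forall>A::real^'n^'n. fundamental_system UNIV G (Finite_Cartesian_Product.rows A) \<longrightarrow>
           invertible A \<and>
           opt_cond UNIV G = sigma_max A / sigma_min A \<and>
           (\<forall>ts. distinct ts \<and> set ts = Finite_Cartesian_Product.columns (matrix_inv A) \<longrightarrow>
              minimal_optimal_templates UNIV G ts)))
   \<and> (G \<noteq> {id} \<and> \<not> (essential UNIV G \<and> irreducible_on UNIV G) \<longrightarrow>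
        (\<exists>k V H. irreducible_decomposition G k V H) \<and>
        (\<forall>k V H. irreducible_decomposition G k V H \<longrightarrow>
           opt_cond UNIV G = Max ((\<lambda>i. opt_cond (V i) (H i)) ` {..<k}) \<and>
           (\<forall>i<k. H i \<noteq> {id} \<longrightarrow>
              (\<forall>es A. fundamental_matrix (V i) (H i) es A \<longrightarrow> invertible_mat A)) \<and>
           (\<forall>T. (\<forall>i<k. constituent_templates (V i) (H i) (T i)) \<longrightarrow>
              (\<forall>i<k. \<forall>ts. distinct ts \<and> set ts = T i \<longrightarrow>
                 minimal_optimal_templates (V i) (H i) ts) \<and>
              (\<forall>ts. distinct ts \<and> set ts = (\<Union>i<k. T i) \<longrightarrow>
                 minimal_optimal_templates UNIV G ts))))"
proof (intro conjI impI)
  have U: "(UNIV :: (real^'n) set) \<noteq> {0}" by (metis UNIV_I axis_eq_0_iff singletonD zero_neq_one)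
  assume "G = {id}"
  then show "opt_cond UNIV G = 1"
    and "\<forall>ts. distinct ts \<and> orthonormal_basis UNIV (set ts) \<longrightarrow> minimal_optimal_templates UNIV G ts"
    using trivial_group_templates[OF subspace_UNIV U] assms(2) by auto
qed (elim conjE, intro allI impI, rule irreducible_templates[OF assms], assumption+,
    rule exists_irreducible_decomposition[OF assms],
    intro allI impI, rule decomposition_templates[OF assms])

end
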